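(* Let $\mathrm{k}$ be an algebraically closed field of characteristic $p>0$. The only homaloidal line arrangements in $\mathbb{P}^2_{\mathrm{k}}$ are: (i) the unions of three general lines (three distinct lines not passing through a common point); (ii) the near-pencils of $n+1$ lines, where $p$ divides $n$ ($n\geq 1$). That is, a line arrangement in $\mathbb{P}^2_{\mathrm{k}}$ is homaloidal if and only if it is of type (i) or of type (ii).
   Context: A line arrangement in $\mathbb{P}^2_{\mathrm{k}}$ is a reduced plane curve that is a finite union of (distinct) lines, i.e. $\mathbb{V}(l_1\cdots l_d)$ with $d \ge 1$ and $l_1,\dots,l_d\in\mathrm{k}[x_0,x_1,x_2]$ pairwise non-proportional nonzero linear forms. A near-pencil of $n+1$ lines is the union of $n$ distinct lines through a given point $z_0$ together with one further line not passing through $z_0$. For a homogeneous polynomial $f\in \mathrm{k}[x_0,x_1,x_2]$, the polar map $\Phi_f:\mathbb{P}^2_{\mathrm{k}}\dashrightarrow\mathbb{P}^2_{\mathrm{k}}$ is the rational map defined by the partial derivatives $\left(\frac{\partial f}{\partial x_0}:\frac{\partial f}{\partial x_1}:\frac{\partial f}{\partial x_2}\right)$. The polynomial $f$ is called homaloidal if the linear system $\langle \frac{\partial f}{\partial x_0},\frac{\partial f}{\partial x_1},\frac{\partial f}{\partial x_2}\rangle$ has no fixed component (i.e. the three partial derivatives have no common factor of positive degree) and $\Phi_f$ is birational. A reduced projective plane curve $F=\mathbb{V}(f)\subset\mathbb{P}^2_{\mathrm{k}}$, with $f$ its reduced equation, is called homaloidal if $f$ is homaloidal. *)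

theory Defs
  imports
    "HOL-Analysis.Analysis"
    "HOL-Library.Poly_Mapping"
    "HOL-Library.Numeral_Type"
    "HOL-Computational_Algebra.Computational_Algebra"
begin

section \<open>Polynomials in three variables\<close>

text \<open>
  The ring \<open>k[x\<^sub>0, x\<^sub>1, x\<^sub>2]\<close>: a polynomial is a finitely supported map from monomials to
  coefficients, a monomial a map from the index type \<^typ>\<open>3\<close> (with elements \<open>0\<close>, \<open>1\<close>, \<open>2\<close>)
  to exponents. The ring structure is the convolution product of \<open>HOL-Library.Poly_Mapping\<close>.
\<close>

type_synonym monom3 = "3 \<Rightarrow>\<^sub>0 nat"
type_synonym 'k poly3 = "monom3 \<Rightarrow>\<^sub>0 'k"

definition Const3 :: "'k::zero \<Rightarrow> 'k poly3" where
  "Const3 c = Poly_Mapping.single 0 c"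

definition Var3 :: "3 \<Rightarrow> 'k::zero_neq_one poly3" where
  "Var3 i = Poly_Mapping.single (Poly_Mapping.single i 1) 1"

definition monom_degree :: "monom3 \<Rightarrow> nat" where
  "monom_degree m = (\<Sum>i\<in>UNIV. Poly_Mapping.lookup m i)"

definition total_degree :: "'k::zero poly3 \<Rightarrow> nat" where
  "total_degree f = Max (insert 0 (monom_degree ` Poly_Mapping.keys f))"

text \<open>The zero polynomial is homogeneous of every degree.\<close>

definition homogeneous :: "nat \<Rightarrow> 'k::zero poly3 \<Rightarrow> bool" where
  "homogeneous d f \<longleftrightarrow> (\<forall>m\<in>Poly_Mapping.keys f. monom_degree m = d)"

definition eval3 :: "'k::comm_semiring_1 poly3 \<Rightarrow> 'k ^ 3 \<Rightarrow> 'k" where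
  "eval3 f v = (\<Sum>m\<in>Poly_Mapping.keys f.
     Poly_Mapping.lookup f m * (\<Prod>i\<in>UNIV. (v $ i) ^ Poly_Mapping.lookup m i))"

text \<open>\<open>subst3 f P\<close> is \<open>f(P\<^sub>0, P\<^sub>1, P\<^sub>2)\<close>.\<close>

definition subst3 :: "'k::comm_semiring_1 poly3 \<Rightarrow> (3 \<Rightarrow> 'k poly3) \<Rightarrow> 'k poly3" where
  "subst3 f P = (\<Sum>m\<in>Poly_Mapping.keys f.
     Const3 (Poly_Mapping.lookup f m) * (\<Prod>i\<in>UNIV. P i ^ Poly_Mapping.lookup m i))"

text \<open>
  Formal partial derivative. The truncated subtraction of exponents is harmless: if \<open>x\<^sub>i\<close> does
  not occur in a monomial, the coefficient of the corresponding summand is zero.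
\<close>

definition partial_deriv :: "3 \<Rightarrow> 'k::comm_semiring_1 poly3 \<Rightarrow> 'k poly3" where
  "partial_deriv i f = (\<Sum>m\<in>Poly_Mapping.keys f.
     Poly_Mapping.single (m - Poly_Mapping.single i 1)
       (of_nat (Poly_Mapping.lookup m i) * Poly_Mapping.lookup f m))"


section \<open>The projective plane and plane curves\<close>

text \<open>The point of the projective plane with homogeneous coordinates \<open>v \<noteq> 0\<close>.\<close>

definition proj_point :: "'k::field ^ 3 \<Rightarrow> ('k ^ 3) set" where
  "proj_point v = {c *s v | c. c \<noteq> 0}"

definition proj_plane :: "('k::field ^ 3) set set" where
  "proj_plane = {proj_point v | v. v \<noteq> 0}"

text \<open>
  The zero locus of a homogeneous polynomial. Reduced curves over an algebraically closed field
  are identified with their sets of points.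
\<close>

definition zero_locus :: "'k::field poly3 \<Rightarrow> ('k ^ 3) set set" where
  "zero_locus f = {proj_point v | v. v \<noteq> 0 \<and> eval3 f v = 0}"

definition linear_form :: "'k::field poly3 \<Rightarrow> bool" where
  "linear_form l \<longleftrightarrow> l \<noteq> 0 \<and> homogeneous 1 l"

definition proportional :: "'k::field poly3 \<Rightarrow> 'k poly3 \<Rightarrow> bool" where
  "proportional f g \<longleftrightarrow> (\<exists>c. c \<noteq> 0 \<and> f = Const3 c * g)"

definition line :: "('k::field ^ 3) set set \<Rightarrow> bool" where
  "line L \<longleftrightarrow> (\<exists>l. linear_form l \<and> L = zero_locus l)"

definition line_arrangement :: "('k::field ^ 3) set set \<Rightarrow> bool" where
  "line_arrangement F \<longleftrightarrow>
     (\<exists>d\<ge>1. \<exists>l::nat \<Rightarrow> 'k poly3.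
        (\<forall>i<d. linear_form (l i)) \<and>
        (\<forall>i<d. \<forall>j<d. i \<noteq> j \<longrightarrow> \<not> proportional (l i) (l j)) \<and>
        F = zero_locus (\<Prod>i<d. l i))"

definition three_general_lines :: "('k::field ^ 3) set set \<Rightarrow> bool" where
  "three_general_lines F \<longleftrightarrow>
     (\<exists>L M N. line L \<and> line M \<and> line N \<and> L \<noteq> M \<and> L \<noteq> N \<and> M \<noteq> N \<and>
        L \<inter> M \<inter> N = {} \<and> F = L \<union> M \<union> N)"

text \<open>\<open>near_pencil n F\<close>: \<open>F\<close> is a near-pencil of \<open>n + 1\<close> lines.\<close>

definition near_pencil :: "nat \<Rightarrow> ('k::field ^ 3) set set \<Rightarrow> bool" where
  "near_pencil n F \<longleftrightarrow>
     (\<exists>z\<^sub>0\<in>proj_plane. \<exists>\<L> M.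
        finite \<L> \<and> card \<L> = n \<and> (\<forall>L\<in>\<L>. line L \<and> z\<^sub>0 \<in> L) \<and>
        line M \<and> z\<^sub>0 \<notin> M \<and> F = \<Union>\<L> \<union> M)"


section \<open>Rational maps of the projective plane\<close>

text \<open>
  A rational map from the projective plane to itself is represented by a triple of homogeneous
  polynomials of the same degree, not all zero. Common factors are allowed; two triples represent
  the same map iff all \<open>2 \<times> 2\<close> minors vanish.
\<close>

definition rational_map :: "(3 \<Rightarrow> 'k::field poly3) \<Rightarrow> bool" where
  "rational_map P \<longleftrightarrow> (\<exists>d. \<forall>i. homogeneous d (P i)) \<and> (\<exists>i. P i \<noteq> 0)"

definition same_rational_map :: "(3 \<Rightarrow> 'k::field poly3) \<Rightarrow> (3 \<Rightarrow> 'k poly3) \<Rightarrow> bool" where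
  "same_rational_map P Q \<longleftrightarrow> (\<forall>i j. P i * Q j = P j * Q i)"

text \<open>
  The composite \<open>Q \<circ> P\<close>. It is a rational map unless all three entries vanish, i.e. unless the
  image of \<open>P\<close> lies in the common zeros of \<open>Q\<close>.
\<close>

definition comp_map :: "(3 \<Rightarrow> 'k::field poly3) \<Rightarrow> (3 \<Rightarrow> 'k poly3) \<Rightarrow> (3 \<Rightarrow> 'k poly3)" where
  "comp_map Q P = (\<lambda>i. subst3 (Q i) P)"

text \<open>The triple \<^const>\<open>Var3\<close> represents the identity map.\<close>

definition birational :: "(3 \<Rightarrow> 'k::field poly3) \<Rightarrow> bool" where
  "birational P \<longleftrightarrow> rational_map P \<and>
     (\<exists>Q. rational_map Q \<and>
        rational_map (comp_map Q P) \<and> same_rational_map (comp_map Q P) Var3 \<and>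
        rational_map (comp_map P Q) \<and> same_rational_map (comp_map P Q) Var3)"


section \<open>Homaloidal polynomials and curves\<close>

definition polar_map :: "'k::field poly3 \<Rightarrow> (3 \<Rightarrow> 'k poly3)" where
  "polar_map f = (\<lambda>i. partial_deriv i f)"

definition no_fixed_component :: "(3 \<Rightarrow> 'k::field poly3) \<Rightarrow> bool" where
  "no_fixed_component P \<longleftrightarrow> \<not> (\<exists>h. total_degree h > 0 \<and> (\<forall>i. h dvd P i))"

definition homaloidal :: "'k::field poly3 \<Rightarrow> bool" where
  "homaloidal f \<longleftrightarrow> (\<exists>d. homogeneous d f) \<and>
     no_fixed_component (polar_map f) \<and> birational (polar_map f)"

text \<open>
  Over an algebraically closed field the reduced equation of a curve is unique up to a nonzero
  scalar, so the existential quantifier in \<open>homaloidal_curve\<close> is immaterial.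
\<close>

definition reduced_equation :: "'k::field poly3 \<Rightarrow> ('k ^ 3) set set \<Rightarrow> bool" where
  "reduced_equation f F \<longleftrightarrow> (\<exists>d\<ge>1. homogeneous d f) \<and> squarefree f \<and> F = zero_locus f"

definition homaloidal_curve :: "('k::field ^ 3) set set \<Rightarrow> bool" where
  "homaloidal_curve F \<longleftrightarrow> (\<exists>f. reduced_equation f F \<and> homaloidal f)"

end

theory Submission
  imports Defs "HOL-Computational_Algebra.Field_as_Ring"
begin

text \<open>
  Let \<open>d\<close> lines be given whose polar map has an inverse. Blowing up a point of multiplicity \<open>m\<close>
  turns the polar map into a polar map of binary forms on the exceptional curve; for this to have
  degree at most one, \<open>m\<close> must be \<open>2\<close> or divisible by the characteristic \<open>p\<close>. If \<open>p\<close> does not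
  divide \<open>d - 1\<close>, every line of the arrangement is contracted, and the same argument on the line,
  with the multiple points weighted by \<open>m - 1\<close>, shows that it carries at most two multiple points;
  this leaves only triangles. If \<open>p\<close> divides \<open>d - 1\<close>, the components of the polar curve of a
  multiple point are contracted to points of the dual line, and counting them shows that the sum of
  \<open>s - 1\<close> over the lines through the point is \<open>d - 1\<close>, where a line carries \<open>s\<close> multiple points. The
  incidence structure is then a near-pencil or a projective plane of order \<open>m - 1\<close> with \<open>p\<close> dividing
  \<open>m\<close>; in the latter case the affine coordinates form a finite additive group of order \<open>m - 1\<close>,
  which \<open>p\<close> would have to divide as well. Conversely, the polar maps of triangles and of near-pencils
  have explicit inverses.
\<close>

text \<open>The inverse is used only through the identity saying that \<open>Q (gr A v)\<close> is
  proportional to \<open>v\<close>. This says nothing where \<open>gr A\<close> vanishes or where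
  all \<open>Q i\<close> vanish. Each local argument therefore strips \<open>Q\<close> of the
  largest power of a linear form and then passes to the limit along a curve. Limits and
  cancellations are identities valid off finitely many points, so polynomials are treated as
  functions. The obstacle is the case p | d - 1. The weights m - 1 on a line add up to d - 1, so
  Euler's relation no longer excludes common zeros of the logarithmic polar map, and the bound of
  two multiple points per line fails, as near-pencils show. The remedy: now d = 1 in the field,
  while each multiplicity m is 2 or vanishes there. Hence d, d - m and m - 1 are nonzero, and on the
  polar curve of a multiple point Euler's relation and the orders of derivatives behave as in
  characteristic zero. The resulting count puts the numbers s of multiple points on the lines under
  one quadratic equation. One value of s leads to a triangle or a projective plane, two values to a
  near-pencil.\<close>

no_notation fps_nth (infixl "$" 75)

section \<open>Polynomial functions\<close>

text \<open>In a finite field, 1 plus the product of all \<open>[:-a, 1:]\<close> would be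
  nonconstant and without roots.\<close>

lemma infinite_UNIV_alg_closed: "infinite (UNIV :: 'k::alg_closed_field set)"
proof
  assume fin: "finite (UNIV :: 'k set)"
  define p :: "'k poly" where "p = (\<Prod>a\<in>UNIV. [:-a, 1:]) + 1"
  have deg: "degree (\<Prod>a\<in>(UNIV::'k set). [:-a, 1:]) = card (UNIV :: 'k set)"
    by (subst degree_prod_sum_eq) auto
  have "card (UNIV :: 'k set) > 0" using fin by (simp add: card_gt_0_iff)
  then have "degree p = card (UNIV :: 'k set)"
    unfolding p_def using deg by (subst degree_add_eq_left) auto
  with \<open>card (UNIV :: 'k set) > 0\<close> obtain x where "poly p x = 0"
    using alg_closed_imp_poly_has_root[of p] by auto
  moreover have "poly p x = 1"
    unfolding p_def poly_add poly_prod using fin by (auto intro!: prod_zero)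
  ultimately show False by simp
qed

text \<open>Since the field is infinite, an identity between such functions that holds off a finite
  set holds everywhere. This is how division by a parameter \<open>t\<close> followed by setting
  \<open>t = 0\<close> is carried out below, without formal quotients or a topology.\<close>

definition upoly :: "('k::field \<Rightarrow> 'k) \<Rightarrow> bool" where
  "upoly \<phi> \<longleftrightarrow> (\<exists>p. \<forall>t. \<phi> t = poly p t)"

named_theorems upoly_intros

lemma upoly_const [upoly_intros]: "upoly (\<lambda>_. c)"
  unfolding upoly_def by (intro exI[of _ "[:c:]"]) simp

lemma upoly_ident [upoly_intros]: "upoly (\<lambda>t. t)"
  unfolding upoly_def by (intro exI[of _ "[:0, 1:]"]) simp

lemma upoly_add [upoly_intros]: "upoly \<phi> \<Longrightarrow> upoly \<psi> \<Longrightarrow> upoly (\<lambda>t. \<phi> t + \<psi> t)"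
  unfolding upoly_def by (metis poly_add)

lemma upoly_diff [upoly_intros]: "upoly \<phi> \<Longrightarrow> upoly \<psi> \<Longrightarrow> upoly (\<lambda>t. \<phi> t - \<psi> t)"
  unfolding upoly_def by (metis poly_diff)

lemma upoly_mult [upoly_intros]: "upoly \<phi> \<Longrightarrow> upoly \<psi> \<Longrightarrow> upoly (\<lambda>t. \<phi> t * \<psi> t)"
  unfolding upoly_def by (metis poly_mult)

lemma upoly_power [upoly_intros]: "upoly \<phi> \<Longrightarrow> upoly (\<lambda>t. \<phi> t ^ n)"
  by (induction n) (auto intro: upoly_intros)

lemma upoly_eq_zero:
  fixes \<phi> :: "'k::alg_closed_field \<Rightarrow> 'k"
  assumes "upoly \<phi>" "finite S" "\<And>t. t \<notin> S \<Longrightarrow> \<phi> t = 0"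
  shows "\<phi> t = 0"
proof -
  obtain p where p: "\<And>t. \<phi> t = poly p t" using assms(1) unfolding upoly_def by blast
  have "UNIV \<subseteq> S \<union> {t. poly p t = 0}" using assms(3) p by auto
  then have "infinite {t. poly p t = 0}"
    using infinite_UNIV_alg_closed assms(2) by (meson finite_UnI finite_subset)
  then have "p = 0" using poly_roots_finite by blast
  then show ?thesis using p by simp
qed

lemma upoly_eq:
  fixes \<phi> \<psi> :: "'k::alg_closed_field \<Rightarrow> 'k"
  assumes "upoly \<phi>" "upoly \<psi>" "finite S" "\<And>t. t \<notin> S \<Longrightarrow> \<phi> t = \<psi> t"
  shows "\<phi> t = \<psi> t"
  using upoly_eq_zero[OF upoly_diff[OF assms(1,2)] assms(3)] assms(4) by simp

lemma upoly_finite_zeros: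
  fixes \<phi> :: "'k::field \<Rightarrow> 'k"
  assumes "upoly \<phi>" "\<phi> t \<noteq> 0"
  shows "finite {t. \<phi> t = 0}"
proof -
  obtain p where p: "\<And>t. \<phi> t = poly p t" using assms(1) unfolding upoly_def by blast
  with assms(2) have "p \<noteq> 0" by auto
  then show ?thesis using p poly_roots_finite by simp
qed

text \<open>Closure under composition and an induction rule replace the bookkeeping with
  coefficients. Passing from polynomials to functions loses nothing over an algebraically closed
  field, by \<open>eval3_inject\<close>.\<close>

inductive polyfun :: "('k::field ^ 3 \<Rightarrow> 'k) \<Rightarrow> bool" where
  polyfun_const: "polyfun (\<lambda>_. c)"
| polyfun_coord: "polyfun (\<lambda>v. v $ i)"
| polyfun_add: "polyfun \<phi> \<Longrightarrow> polyfun \<psi> \<Longrightarrow> polyfun (\<lambda>v. \<phi> v + \<psi> v)"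
| polyfun_mult: "polyfun \<phi> \<Longrightarrow> polyfun \<psi> \<Longrightarrow> polyfun (\<lambda>v. \<phi> v * \<psi> v)"

named_theorems polyfun_intros
lemmas [polyfun_intros] = polyfun.intros

lemma polyfun_uminus [polyfun_intros]: "polyfun \<phi> \<Longrightarrow> polyfun (\<lambda>v. - \<phi> v)"
  using polyfun_mult[OF polyfun_const[of "-1"]] by simp

lemma polyfun_diff [polyfun_intros]: "polyfun \<phi> \<Longrightarrow> polyfun \<psi> \<Longrightarrow> polyfun (\<lambda>v. \<phi> v - \<psi> v)"
  using polyfun_add[of \<phi> "\<lambda>v. - \<psi> v"] polyfun_uminus by fastforce

lemma polyfun_power [polyfun_intros]: "polyfun \<phi> \<Longrightarrow> polyfun (\<lambda>v. \<phi> v ^ n)"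
  by (induction n) (auto intro: polyfun_intros)

lemma polyfun_sum [polyfun_intros]:
  "(\<And>i. i \<in> I \<Longrightarrow> polyfun (\<phi> i)) \<Longrightarrow> polyfun (\<lambda>v. \<Sum>i\<in>I. \<phi> i v)"
  by (induction I rule: infinite_finite_induct) (auto intro: polyfun_intros)

lemma polyfun_prod [polyfun_intros]:
  "(\<And>i. i \<in> I \<Longrightarrow> polyfun (\<phi> i)) \<Longrightarrow> polyfun (\<lambda>v. \<Prod>i\<in>I. \<phi> i v)"
  by (induction I rule: infinite_finite_induct) (auto intro: polyfun_intros)

lemma polyfun_prod_list [polyfun_intros]:
  "(\<And>i. i \<in> set I \<Longrightarrow> polyfun (\<phi> i)) \<Longrightarrow> polyfun (\<lambda>v. \<Prod>i\<leftarrow>I. \<phi> i v)"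
  by (induction I) (auto intro: polyfun_intros)

lemma polyfun_comp:
  "polyfun q \<Longrightarrow> (\<And>i. polyfun (\<lambda>v. G v $ i)) \<Longrightarrow> polyfun (\<lambda>v. q (G v))"
  by (induction rule: polyfun.induct) (auto intro: polyfun_intros)

lemma polyfun_upoly:
  "polyfun q \<Longrightarrow> (\<And>i. upoly (\<lambda>t. c t $ i)) \<Longrightarrow> upoly (\<lambda>t. q (c t))"
  by (induction rule: polyfun.induct) (auto intro: upoly_intros)

lemma polyfun_line: "polyfun q \<Longrightarrow> upoly (\<lambda>t. q (u + t *s v))"
  by (erule polyfun_upoly) (auto intro!: upoly_intros)

text \<open>On the line joining a point where the first factor is nonzero to one where the second is
  nonzero, each factor has only finitely many zeros, so the product cannot vanish identically
  there.\<close>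

lemma polyfun_zero_product:
  fixes \<phi> \<psi> :: "'k::alg_closed_field ^ 3 \<Rightarrow> 'k"
  assumes "polyfun \<phi>" "polyfun \<psi>" "\<And>v. \<phi> v * \<psi> v = 0"
  shows "(\<forall>v. \<phi> v = 0) \<or> (\<forall>v. \<psi> v = 0)"
proof (rule ccontr)
  assume "\<not> ?thesis"
  then obtain u v where u: "\<phi> u \<noteq> 0" and v: "\<psi> v \<noteq> 0" by blast
  let ?c = "\<lambda>t. u + t *s (v - u)"
  have "finite {t. \<phi> (?c t) = 0}"
    by (rule upoly_finite_zeros[where t = 0, OF polyfun_line[OF assms(1)]]) (use u in simp)
  moreover have "finite {t. \<psi> (?c t) = 0}"
    by (rule upoly_finite_zeros[where t = 1, OF polyfun_line[OF assms(2)]]) (use v in simp)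
  moreover have "UNIV = {t. \<phi> (?c t) = 0} \<union> {t. \<psi> (?c t) = 0}"
    using assms(3) by auto
  ultimately show False using infinite_UNIV_alg_closed by (metis finite_UnI)
qed

lemma polyfun_cancel:
  fixes \<phi> \<psi> \<theta> :: "'k::alg_closed_field ^ 3 \<Rightarrow> 'k"
  assumes "polyfun \<phi>" "polyfun \<psi>" "polyfun \<theta>" "\<phi> u \<noteq> 0" "\<And>v. \<phi> v * \<psi> v = \<phi> v * \<theta> v"
  shows "\<psi> v = \<theta> v"
  using polyfun_zero_product[OF assms(1) polyfun_diff[OF assms(2,3)]] assms(4,5)
  by (auto simp: right_diff_distrib)

text \<open>Existence of points in general position: finitely many nonzero polynomial functions have
  a nonzero product.\<close>

lemma polyfun_avoid:
  fixes \<phi> :: "'i \<Rightarrow> 'k::alg_closed_field ^ 3 \<Rightarrow> 'k"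
  assumes "finite I" "\<And>i. i \<in> I \<Longrightarrow> polyfun (\<phi> i)" "\<And>i. i \<in> I \<Longrightarrow> \<exists>v. \<phi> i v \<noteq> 0"
  shows "\<exists>v. \<forall>i\<in>I. \<phi> i v \<noteq> 0"
proof -
  have "\<exists>v. (\<Prod>i\<in>I. \<phi> i v) \<noteq> 0" using assms
  proof (induction I rule: finite_induct)
    case (insert i I)
    have "\<not> (\<forall>v. \<phi> i v * (\<Prod>i\<in>I. \<phi> i v) = 0)"
      using polyfun_zero_product[of "\<phi> i" "\<lambda>v. \<Prod>i\<in>I. \<phi> i v"] insert
      by (metis insert_iff polyfun_prod)
    then show ?case using insert by simp
  qed auto
  then show ?thesis using assms(1) by auto
qed

lemma polyfun_zero_prod_list:
  fixes \<phi> :: "'i \<Rightarrow> 'k::alg_closed_field ^ 3 \<Rightarrow> 'k"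
  assumes "\<And>i. i \<in> set I \<Longrightarrow> polyfun (\<phi> i)" "\<And>v. (\<Prod>i\<leftarrow>I. \<phi> i v) = 0"
  shows "\<exists>i\<in>set I. \<forall>v. \<phi> i v = 0"
proof (rule ccontr)
  assume "\<not> ?thesis"
  then have "\<exists>v. \<forall>i\<in>set I. \<phi> i v \<noteq> 0" using assms(1) by (intro polyfun_avoid) auto
  then obtain v where v: "\<forall>i\<in>set I. \<phi> i v \<noteq> 0" ..
  then have "(\<Prod>i\<leftarrow>I. \<phi> i v) \<noteq> 0" by (induction I) auto
  with assms(2) show False by simp
qed

section \<open>Vectors in three-space\<close>

definition dot :: "'k::field ^ 3 \<Rightarrow> 'k ^ 3 \<Rightarrow> 'k" where
  "dot a v = a $ 1 * v $ 1 + a $ 2 * v $ 2 + a $ 3 * v $ 3"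

definition crs :: "'k::field ^ 3 \<Rightarrow> 'k ^ 3 \<Rightarrow> 'k ^ 3" where
  "crs a b = vector [a $ 2 * b $ 3 - a $ 3 * b $ 2, a $ 3 * b $ 1 - a $ 1 * b $ 3,
     a $ 1 * b $ 2 - a $ 2 * b $ 1]"

lemma crs_nth [simp]:
  "crs a b $ 1 = a $ 2 * b $ 3 - a $ 3 * b $ 2"
  "crs a b $ 2 = a $ 3 * b $ 1 - a $ 1 * b $ 3"
  "crs a b $ 3 = a $ 1 * b $ 2 - a $ 2 * b $ 1"
  by (simp_all add: crs_def)

lemma vec3_eq_iff: "(u :: 'k ^ 3) = v \<longleftrightarrow> u $ 1 = v $ 1 \<and> u $ 2 = v $ 2 \<and> u $ 3 = v $ 3"
  by (simp add: vec_eq_iff forall_3)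

lemma dot_commute: "dot a v = dot v a"
  by (simp add: dot_def mult.commute)

lemma dot_simps [simp]:
  "dot (a + b) v = dot a v + dot b v" "dot a (u + v) = dot a u + dot a v"
  "dot (a - b) v = dot a v - dot b v" "dot a (u - v) = dot a u - dot a v"
  "dot (c *s a) v = c * dot a v" "dot a (c *s v) = c * dot a v"
  "dot 0 v = 0" "dot a 0 = 0" "dot (- a) v = - dot a v" "dot a (- v) = - dot a v"
  by (simp_all add: dot_def algebra_simps)

lemma dot_sum_right: "dot v (\<Sum>i\<in>I. a i) = (\<Sum>i\<in>I. dot v (a i))"
  by (induction I rule: infinite_finite_induct) auto

lemma dot_axis [simp]: "dot (axis i c) v = c * v $ i" "dot v (axis i c) = v $ i * c"
  using exhaust_3[of i] by (auto simp: dot_def axis_def)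

lemma polyfun_dot [polyfun_intros]: "polyfun (dot a)" "polyfun (\<lambda>v. dot v a)"
  unfolding dot_def by (auto intro!: polyfun_intros)

lemma upoly_dot [upoly_intros]: "(\<And>i. upoly (\<lambda>t. c t $ i)) \<Longrightarrow> upoly (\<lambda>t. dot a (c t))"
  unfolding dot_def by (auto intro!: upoly_intros)

lemma exists_dot_eq_1: "(z :: 'k::field ^ 3) \<noteq> 0 \<Longrightarrow> \<exists>b. dot z b = 1"
proof -
  assume "z \<noteq> 0"
  then obtain i where "z $ i \<noteq> 0" by (auto simp: vec_eq_iff)
  then show ?thesis by (intro exI[of _ "axis i (1 / z $ i)"]) simp
qed

lemma dot_crs [simp]: "dot a (crs a b) = 0" "dot b (crs a b) = 0"
  "dot (crs a b) a = 0" "dot (crs a b) b = 0" "crs a a = 0"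
  by (simp_all add: dot_def vec3_eq_iff algebra_simps)

lemma dot_crs_cyc: "dot a (crs b c) = dot b (crs c a)"
  by (simp add: dot_def algebra_simps)

lemma crs_crs: "crs a (crs b c) = dot a c *s b - dot a b *s c"
  by (simp add: dot_def vec3_eq_iff algebra_simps)

lemma crs_anticommute: "crs a b = - crs b a"
  by (simp add: vec3_eq_iff)

lemma crs_linear [simp]:
  "crs (a + b) c = crs a c + crs b c" "crs c (a + b) = crs c a + crs c b"
  "crs (a - b) c = crs a c - crs b c" "crs c (a - b) = crs c a - crs c b"
  "crs (r *s a) c = r *s crs a c" "crs c (r *s a) = r *s crs c a"
  "crs 0 c = 0" "crs c 0 = 0"
  by (simp_all add: vec3_eq_iff algebra_simps)

lemma crs_eq_0_imp: "crs a b = 0 \<Longrightarrow> a \<noteq> 0 \<Longrightarrow> \<exists>c. b = c *s (a :: 'k::field ^ 3)"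
proof -
  assume ab: "crs a b = 0" "a \<noteq> 0"
  obtain x where x: "dot a x = 1" using exists_dot_eq_1[OF ab(2)] by blast
  have "crs x (crs a b) = dot x b *s a - dot x a *s b" by (rule crs_crs)
  then have "b = dot x b *s a" using ab x by (simp add: dot_commute)
  then show ?thesis by blast
qed

lemma common_perp:
  fixes a b v :: "'k::field ^ 3"
  assumes "crs a b \<noteq> 0" "dot a v = 0" "dot b v = 0"
  shows "\<exists>c. v = c *s crs a b"
proof -
  have "crs v (crs a b) = 0" using assms by (simp add: crs_crs dot_commute)
  then show ?thesis using crs_eq_0_imp[OF _ assms(1)] by (metis crs_anticommute neg_equal_0_iff_equal)
qed

lemma perp_three_eq_0:
  fixes a b c v :: "'k::field ^ 3"
  assumes "dot a (crs b c) \<noteq> 0" "dot a v = 0" "dot b v = 0" "dot c v = 0"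
  shows "v = 0"
proof -
  have "crs b c \<noteq> 0" using assms(1) by auto
  from common_perp[OF this assms(3,4)] obtain r where "v = r *s crs b c" by blast
  with assms show ?thesis by auto
qed

lemma eq_zero_if_dot: "(\<And>a. dot a v = 0) \<Longrightarrow> v = 0"
  using dot_axis(1)[of _ 1 v] by (metis mult_1 vec_eq_iff zero_index)

lemma axis_nth: "axis i c $ j = (if j = i then c else 0)"
  by (simp add: axis_def)

text \<open>Some coordinate of \<open>z\<close> is nonzero, and the unit vectors at the two other
  coordinates complete \<open>z\<close> to a basis. The \<open>b\<close>s form the dual basis;
  \<open>b1\<close> and \<open>b2\<close> span the plane orthogonal to \<open>z\<close>, which is
  the dual line of the point \<open>z\<close>.\<close>

lemma dual_basis:
  fixes z :: "'k::field ^ 3"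
  assumes "z \<noteq> 0"
  obtains e1 e2 b0 b1 b2 where
    "\<And>v. v = dot b0 v *s z + dot b1 v *s e1 + dot b2 v *s e2"
    "\<And>y. y = dot z y *s b0 + dot e1 y *s b1 + dot e2 y *s b2"
    "dot b0 z = 1" "dot b0 e1 = 0" "dot b0 e2 = 0"
    "dot b1 z = 0" "dot b1 e1 = 1" "dot b1 e2 = 0"
    "dot b2 z = 0" "dot b2 e1 = 0" "dot b2 e2 = 1"
proof -
  obtain i where i: "z $ i \<noteq> 0" using assms by (auto simp: vec_eq_iff)
  have "\<exists>j k. (\<forall>x. x = i \<or> x = j \<or> x = k) \<and> j \<noteq> i \<and> k \<noteq> i \<and> j \<noteq> k"
    using exhaust_3[of i]
  proof (elim disjE)
    assume "i = 1" then show ?thesis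
      by (intro exI[of _ 2] exI[of _ 3]) (use exhaust_3 in auto)
  next
    assume "i = 2" then show ?thesis
      by (intro exI[of _ 1] exI[of _ 3]) (use exhaust_3 in auto)
  next
    assume "i = 3" then show ?thesis
      by (intro exI[of _ 1] exI[of _ 2]) (use exhaust_3 in auto)
  qed
  then obtain j k where all: "\<And>x. x = i \<or> x = j \<or> x = k" and jk: "j \<noteq> i" "k \<noteq> i" "j \<noteq> k"
    by blast
  have univ: "(UNIV :: 3 set) = {i, j, k}" using all by auto
  define b0 :: "'k ^ 3" where "b0 = axis i (1 / z $ i)"
  define b1 :: "'k ^ 3" where "b1 = axis j 1 - (z $ j) *s b0"
  define b2 :: "'k ^ 3" where "b2 = axis k 1 - (z $ k) *s b0"
  have dots: "dot b0 v = v $ i / z $ i" "dot b1 v = v $ j - z $ j * (v $ i / z $ i)"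
    "dot b2 v = v $ k - z $ k * (v $ i / z $ i)" for v
    by (simp_all add: b0_def b1_def b2_def)
  show ?thesis
  proof (rule that[of b0 b1 "axis j 1" b2 "axis k 1"])
    show "v = dot b0 v *s z + dot b1 v *s axis j 1 + dot b2 v *s axis k 1" for v
      unfolding vec_eq_iff
    proof
      fix x show "v $ x = (dot b0 v *s z + dot b1 v *s axis j 1 + dot b2 v *s axis k 1) $ x"
        using all[of x] i jk by (auto simp: dots axis_nth)
    qed
    show "y = dot z y *s b0 + dot (axis j 1) y *s b1 + dot (axis k 1) y *s b2" for y
      unfolding vec_eq_iff
    proof
      fix x
      have "dot z y = z $ i * y $ i + z $ j * y $ j + z $ k * y $ k"
      proof -
        have "dot z y = (\<Sum>l\<in>UNIV. z $ l * y $ l)" by (simp add: dot_def sum_3)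
        also have "\<dots> = (\<Sum>l\<in>{i, j, k}. z $ l * y $ l)" by (simp only: univ)
        also have "\<dots> = z $ i * y $ i + z $ j * y $ j + z $ k * y $ k"
          using jk by (auto simp: algebra_simps)
        finally show ?thesis .
      qed
      then show "y $ x = (dot z y *s b0 + dot (axis j 1) y *s b1 + dot (axis k 1) y *s b2) $ x"
        using all[of x] i jk by (auto simp: b0_def b1_def b2_def axis_nth field_simps)
    qed
  qed (use i jk in \<open>auto simp: dots axis_nth simp del: dot_axis\<close>)
qed

text \<open>A first-order expansion along \<open>b\<close>, proved like the product rule. If
  \<open>dot z b = 1\<close>, then \<open>Y - dot z Y *s b\<close> is the projection along
  \<open>b\<close> onto the plane \<open>dot z Y = 0\<close>, so a function vanishing on that plane
  is divisible by \<open>dot z\<close>.\<close>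

lemma polyfun_div:
  fixes z b :: "'k::field ^ 3"
  assumes "polyfun q"
  shows "\<exists>q'. polyfun q' \<and> (\<forall>Y. q Y = q (Y - dot z Y *s b) + dot z Y * q' Y)"
  using assms
proof (induction rule: polyfun.induct)
  case (polyfun_const c)
  then show ?case by (intro exI[of _ "\<lambda>_. 0"]) (auto intro: polyfun_intros)
next
  case (polyfun_coord i)
  then show ?case by (intro exI[of _ "\<lambda>_. b $ i"]) (auto intro: polyfun_intros)
next
  case (polyfun_add \<phi> \<psi>)
  then obtain \<phi>' \<psi>' where *: "polyfun \<phi>'" "polyfun \<psi>'"
    "\<And>Y. \<phi> Y = \<phi> (Y - dot z Y *s b) + dot z Y * \<phi>' Y"
    "\<And>Y. \<psi> Y = \<psi> (Y - dot z Y *s b) + dot z Y * \<psi>' Y" by blast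
  then have pf: "polyfun (\<lambda>Y. \<phi>' Y + \<psi>' Y)" by (intro polyfun.intros(3))
  have "\<phi> Y + \<psi> Y = \<phi> (Y - dot z Y *s b) + \<psi> (Y - dot z Y *s b) + dot z Y * (\<phi>' Y + \<psi>' Y)" for Y
    using *(3)[of Y] *(4)[of Y] by algebra
  with pf show ?case by (intro exI[of _ "\<lambda>Y. \<phi>' Y + \<psi>' Y"]) blast
next
  case (polyfun_mult \<phi> \<psi>)
  then obtain \<phi>' \<psi>' where *: "polyfun \<phi>'" "polyfun \<psi>'"
    "\<And>Y. \<phi> Y = \<phi> (Y - dot z Y *s b) + dot z Y * \<phi>' Y"
    "\<And>Y. \<psi> Y = \<psi> (Y - dot z Y *s b) + dot z Y * \<psi>' Y" by blast
  have "polyfun (\<lambda>Y. \<phi>' Y * \<psi> Y + \<phi> (Y - dot z Y *s b) * \<psi>' Y)"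
  proof (rule polyfun.intros(3); rule polyfun.intros(4))
    show "polyfun (\<lambda>Y. \<phi> (Y - dot z Y *s b))"
      by (rule polyfun_comp[OF polyfun_mult.hyps(1)]) (auto intro!: polyfun_intros)
  qed (use *(1,2) polyfun_mult.hyps in auto)
  moreover have "\<phi> Y * \<psi> Y = \<phi> (Y - dot z Y *s b) * \<psi> (Y - dot z Y *s b) +
      dot z Y * (\<phi>' Y * \<psi> Y + \<phi> (Y - dot z Y *s b) * \<psi>' Y)" for Y
    using *(3)[of Y] *(4)[of Y] by algebra
  ultimately show ?case by (intro exI[of _ "\<lambda>Y. \<phi>' Y * \<psi> Y + \<phi> (Y - dot z Y *s b) * \<psi>' Y"]) blast
qed

lemma polyfun_div_perp:
  fixes z :: "'k::field ^ 3"
  assumes "polyfun q" "z \<noteq> 0" "\<And>Y. dot z Y = 0 \<Longrightarrow> q Y = 0"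
  obtains q' where "polyfun q'" "\<And>Y. q Y = dot z Y * q' Y"
proof -
  obtain b where b: "dot z b = 1" using exists_dot_eq_1[OF assms(2)] by blast
  obtain q' where q': "polyfun q'" "\<And>Y. q Y = q (Y - dot z Y *s b) + dot z Y * q' Y"
    using polyfun_div[OF assms(1), of z b] by blast
  have "q (Y - dot z Y *s b) = 0" for Y by (rule assms(3)) (use b in simp)
  then have "q Y = dot z Y * q' Y" for Y using q'(2)[of Y] by simp
  with q'(1) show ?thesis by (rule that)
qed

section \<open>Binary forms\<close>

text \<open>Encoding a function of two variables through the first two of three coordinates makes
  all results on \<open>polyfun\<close> available.\<close>

definition bpf :: "('k::field \<Rightarrow> 'k \<Rightarrow> 'k) \<Rightarrow> bool" where
  "bpf \<phi> \<longleftrightarrow> polyfun (\<lambda>v. \<phi> (v $ 1) (v $ 2))"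

definition bform :: "nat \<Rightarrow> ('k::field \<Rightarrow> 'k \<Rightarrow> 'k) \<Rightarrow> bool" where
  "bform e \<phi> \<longleftrightarrow> bpf \<phi> \<and> (\<forall>c x t. \<phi> (c * x) (c * t) = c ^ e * \<phi> x t)"

lemma upoly_vector [upoly_intros]:
  "upoly c1 \<Longrightarrow> upoly c2 \<Longrightarrow> upoly c3 \<Longrightarrow> upoly (\<lambda>t. (vector [c1 t, c2 t, c3 t] :: 'k::field ^ 3) $ i)"
  using exhaust_3[of i] by auto

lemma polyfun_vector [polyfun_intros]:
  "polyfun c1 \<Longrightarrow> polyfun c2 \<Longrightarrow> polyfun c3 \<Longrightarrow> polyfun (\<lambda>t. (vector [c1 t, c2 t, c3 t] :: 'k::field ^ 3) $ i)"
  using exhaust_3[of i] by auto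

lemma bpf_upoly: "bpf \<phi> \<Longrightarrow> upoly c1 \<Longrightarrow> upoly c2 \<Longrightarrow> upoly (\<lambda>s. \<phi> (c1 s) (c2 s))"
  unfolding bpf_def
  by (drule polyfun_upoly[where c = "\<lambda>s. vector [c1 s, c2 s, 0]"])
    (auto intro: upoly_vector upoly_const)

lemma polyfun_bpf:
  assumes "polyfun q" "\<And>i. bpf (\<lambda>x t. V x t $ i)"
  shows "bpf (\<lambda>x t. q (V x t))"
  using polyfun_comp[OF assms(1), of "\<lambda>v. V (v $ 1) (v $ 2)"] assms(2) by (simp add: bpf_def)

lemma bpf_comp: "bpf \<phi> \<Longrightarrow> bpf \<gamma>1 \<Longrightarrow> bpf \<gamma>2 \<Longrightarrow> bpf (\<lambda>x t. \<phi> (\<gamma>1 x t) (\<gamma>2 x t))"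
  unfolding bpf_def
  by (drule polyfun_comp[where G = "\<lambda>v. vector [\<gamma>1 (v $ 1) (v $ 2), \<gamma>2 (v $ 1) (v $ 2), 0]"])
    (auto intro: polyfun_vector polyfun_const)

lemma bpf_zero_product:
  fixes \<phi> \<psi> :: "'k::alg_closed_field \<Rightarrow> 'k \<Rightarrow> 'k"
  assumes "bpf \<phi>" "bpf \<psi>" "\<And>x t. \<phi> x t * \<psi> x t = 0"
  shows "(\<forall>x t. \<phi> x t = 0) \<or> (\<forall>x t. \<psi> x t = 0)"
proof -
  have "(\<forall>v::'k^3. \<phi> (v $ 1) (v $ 2) = 0) \<or> (\<forall>v::'k^3. \<psi> (v $ 1) (v $ 2) = 0)"
    using polyfun_zero_product assms unfolding bpf_def by blast
  then show ?thesis by (metis vector_3)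
qed

lemma bpf_cancel:
  fixes \<phi> \<psi> \<theta> :: "'k::alg_closed_field \<Rightarrow> 'k \<Rightarrow> 'k"
  assumes "bpf \<phi>" "bpf \<psi>" "bpf \<theta>" "\<phi> x0 t0 \<noteq> 0" "\<And>x t. \<phi> x t * \<psi> x t = \<phi> x t * \<theta> x t"
  shows "\<psi> x t = \<theta> x t"
proof -
  have "bpf (\<lambda>x t. \<psi> x t - \<theta> x t)" using assms(2,3) unfolding bpf_def by (intro polyfun_intros)
  from bpf_zero_product[OF assms(1) this] assms(4,5) show ?thesis by (auto simp: right_diff_distrib)
qed

lemma bform_const: "bform 0 \<phi> \<Longrightarrow> \<phi> x t = \<phi> 0 0"
  unfolding bform_def by (metis mult_zero_left mult_1 power_0)

lemma bform_comp:
  assumes "bform e B" "bform n \<gamma>1" "bform n \<gamma>2"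
  shows "bform (e * n) (\<lambda>x t. B (\<gamma>1 x t) (\<gamma>2 x t))"
proof -
  have "bpf (\<lambda>x t. B (\<gamma>1 x t) (\<gamma>2 x t))" using assms unfolding bform_def by (intro bpf_comp[of B \<gamma>1 \<gamma>2]) auto
  then show ?thesis using assms unfolding bform_def by (simp add: power_mult mult.commute[of e])
qed

text \<open>Setting \<open>t = 1\<close> leaves a polynomial in one variable. If it is constant,
  homogeneity makes \<open>\<phi> 1 t\<close> a multiple of \<open>t ^ Suc e\<close>, and the zero
  is the point at infinity \<open>(1, 0)\<close>.\<close>

lemma bform_zero_exists:
  fixes \<phi> :: "'k::alg_closed_field \<Rightarrow> 'k \<Rightarrow> 'k"
  assumes "bform (Suc e) \<phi>"
  obtains x t where "(x, t) \<noteq> (0, 0)" "\<phi> x t = 0"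
proof -
  have "upoly (\<lambda>x. \<phi> x 1)"
    using assms unfolding bform_def by (intro bpf_upoly[of \<phi>] upoly_intros) auto
  then obtain p where p: "\<And>x. \<phi> x 1 = poly p x" unfolding upoly_def by blast
  show ?thesis
  proof (cases "degree p = 0")
    case False
    then obtain x where "poly p x = 0" using alg_closed_imp_poly_has_root[of p] by auto
    with p show ?thesis by (intro that[of x 1]) auto
  next
    case True
    then obtain c where c: "\<And>x. \<phi> x 1 = c" using p by (auto elim!: degree_eq_zeroE)
    have "\<phi> 1 t = t ^ Suc e * c" for t
    proof (rule upoly_eq[where S = "{0}" and \<phi> = "\<lambda>t. \<phi> 1 t"])
      fix t :: 'k assume "t \<notin> {0}"
      then show "\<phi> 1 t = t ^ Suc e * c"
        using assms c[of "1/t"] unfolding bform_def by (metis divide_self insertI1 mult.right_neutral singletonI times_divide_eq_right)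
    qed (use assms in \<open>auto simp: bform_def intro!: bpf_upoly[of \<phi>] upoly_intros\<close>)
    from this[of 0] show ?thesis by (intro that[of 1 0]) auto
  qed
qed

lemma bform_divide:
  fixes \<phi> :: "'k::alg_closed_field \<Rightarrow> 'k \<Rightarrow> 'k"
  assumes "bform (Suc e) \<phi>" "\<phi> x0 t0 = 0" "(x0, t0) \<noteq> (0, 0)"
  obtains \<psi> where "bform e \<psi>" "\<And>x t. \<phi> x t = (t0 * x - x0 * t) * \<psi> x t"
proof -
  define z :: "'k ^ 3" where "z = vector [t0, - x0, 0]"
  have "z \<noteq> 0" using assms(3) by (auto simp: z_def vec3_eq_iff)
  moreover have "\<phi> (Y $ 1) (Y $ 2) = 0" if "dot z Y = 0" for Y :: "'k ^ 3"
  proof -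
    have eq: "t0 * Y $ 1 = x0 * Y $ 2" using that by (simp add: dot_def z_def)
    have "\<exists>c. Y $ 1 = c * x0 \<and> Y $ 2 = c * t0"
    proof (cases "x0 = 0")
      case True
      then show ?thesis using eq assms(3) by (intro exI[of _ "Y $ 2 / t0"]) auto
    next
      case False
      then show ?thesis using eq by (intro exI[of _ "Y $ 1 / x0"]) (auto simp: field_simps)
    qed
    then show ?thesis using assms(1,2) unfolding bform_def by auto
  qed
  ultimately obtain q' where q': "polyfun q'" "\<And>Y::'k^3. \<phi> (Y $ 1) (Y $ 2) = dot z Y * q' Y"
    using polyfun_div_perp[of "\<lambda>Y. \<phi> (Y $ 1) (Y $ 2)" z] assms(1) unfolding bform_def bpf_def by metis
  define \<psi> where "\<psi> x t = q' (vector [x, t, 0])" for x t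
  have \<psi>: "bpf \<psi>"
  proof -
    have "polyfun (\<lambda>v::'k^3. q' (vector [v $ 1, v $ 2, 0]))"
      by (intro polyfun_comp[OF q'(1)] polyfun_intros)
    then show ?thesis by (simp add: bpf_def \<psi>_def)
  qed
  have eq: "\<phi> x t = (t0 * x - x0 * t) * \<psi> x t" for x t
    using q'(2)[of "vector [x, t, 0]"] by (simp add: \<psi>_def dot_def z_def)
  have "\<psi> (c * x) (c * t) = c ^ e * \<psi> x t" if "c \<noteq> 0" for c x t
  proof (rule bpf_cancel[of "\<lambda>x t. t0 * x - x0 * t" "\<lambda>x t. \<psi> (c * x) (c * t)" "\<lambda>x t. c ^ e * \<psi> x t"])
    have "bpf (\<lambda>x t. c * x)" "bpf (\<lambda>x t. c * t)" by (auto simp: bpf_def intro!: polyfun_intros)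
    then show "bpf (\<lambda>x t. \<psi> (c * x) (c * t))" by (rule bpf_comp[OF \<psi>])
    show "bpf (\<lambda>x t. t0 * x - x0 * t)" "bpf (\<lambda>x t. c ^ e * \<psi> x t)"
      using \<psi> unfolding bpf_def by (auto intro!: polyfun_intros)
    show "t0 * (if t0 = 0 then 0 else 1) - x0 * (if t0 = 0 then 1 else 0) \<noteq> 0" using assms(3) by auto
    fix x t
    have "c * ((t0 * x - x0 * t) * \<psi> (c * x) (c * t)) = \<phi> (c * x) (c * t)"
      unfolding eq[of "c * x" "c * t"] by (simp add: algebra_simps)
    also have "\<dots> = c * ((t0 * x - x0 * t) * (c ^ e * \<psi> x t))"
      using assms(1) eq[of x t] by (simp add: bform_def)
    finally show "(t0 * x - x0 * t) * \<psi> (c * x) (c * t) = (t0 * x - x0 * t) * (c ^ e * \<psi> x t)"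
      using that by simp
  qed
  then have "\<psi> (c * x) (c * t) = c ^ e * \<psi> x t" for c x t
    by (rule upoly_eq[where S = "{0}" and \<phi> = "\<lambda>c. \<psi> (c * x) (c * t)", rotated 3])
      (auto intro!: upoly_intros bpf_upoly[OF \<psi>])
  with \<psi> eq show ?thesis by (intro that[of \<psi>]) (auto simp: bform_def)
qed

lemma bform_split:
  fixes \<phi> :: "'k::alg_closed_field \<Rightarrow> 'k \<Rightarrow> 'k"
  assumes "bform e \<phi>" "\<phi> x1 t1 \<noteq> 0"
  shows "\<exists>\<kappa> L. \<kappa> \<noteq> 0 \<and> length L = e \<and> (0, 0) \<notin> set L \<and>
    (\<forall>x t. \<phi> x t = \<kappa> * (\<Prod>l\<leftarrow>L. fst l * x + snd l * t))"
  using assms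
proof (induction e arbitrary: \<phi>)
  case 0
  then obtain c where "\<And>x t. \<phi> x t = c" using bform_const by blast
  with 0 show ?case by (intro exI[of _ c] exI[of _ "[]"]) auto
next
  case (Suc e)
  obtain x0 t0 where 0: "(x0, t0) \<noteq> (0, 0)" "\<phi> x0 t0 = 0"
    using bform_zero_exists[OF Suc.prems(1)] by blast
  obtain \<psi> where \<psi>: "bform e \<psi>" "\<And>x t. \<phi> x t = (t0 * x - x0 * t) * \<psi> x t"
    using bform_divide[OF Suc.prems(1) 0(2,1)] by blast
  with Suc.IH[OF \<psi>(1)] Suc.prems(2) obtain \<kappa> L where
    "\<kappa> \<noteq> 0" "length L = e" "(0, 0) \<notin> set L" "\<And>x t. \<psi> x t = \<kappa> * (\<Prod>l\<leftarrow>L. fst l * x + snd l * t)"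
    by auto
  with \<psi>(2) 0(1) show ?case
    by (intro exI[of _ \<kappa>] exI[of _ "(t0, - x0) # L"]) (auto simp: algebra_simps)
qed

text \<open>If \<open>r\<close> exceeded \<open>e\<close>, cancelling \<open>c ^ e\<close> and then
  putting \<open>c = 0\<close> would make \<open>\<phi>\<close> vanish. Hence the truncated
  difference \<open>e - r\<close> is the true degree.\<close>

lemma bform_of_weighted:
  fixes \<phi> :: "'k::alg_closed_field \<Rightarrow> 'k \<Rightarrow> 'k"
  assumes "bpf \<phi>" "\<And>c x t. c ^ r * \<phi> (c * x) (c * t) = c ^ e * \<phi> x t" "\<phi> x0 t0 \<noteq> 0"
  shows "bform (e - r) \<phi>"
proof -
  have up: "upoly (\<lambda>c. \<phi> (c * x) (c * t))" for x t by (intro bpf_upoly[OF assms(1)] upoly_intros)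
  have le: "r \<le> e"
  proof (rule ccontr)
    assume "\<not> r \<le> e"
    then obtain d where d: "r = e + Suc d" using less_imp_Suc_add by force
    have "c ^ Suc d * \<phi> (c * x0) (c * t0) = \<phi> x0 t0" for c
    proof (rule upoly_eq[where S = "{0}" and \<psi> = "\<lambda>_. \<phi> x0 t0" and \<phi> = "\<lambda>c. c ^ Suc d * \<phi> (c * x0) (c * t0)"])
      fix c :: 'k assume c: "c \<notin> {0}"
      have "c ^ e * (c ^ Suc d * \<phi> (c * x0) (c * t0)) = c ^ e * \<phi> x0 t0"
        using assms(2)[of c x0 t0] unfolding d power_add by (simp only: mult.assoc)
      with c show "c ^ Suc d * \<phi> (c * x0) (c * t0) = \<phi> x0 t0" by simp
    qed (auto intro!: upoly_intros up simp del: power_Suc)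
    from this[of 0] assms(3) show False by simp
  qed
  have "\<phi> (c * x) (c * t) = c ^ (e - r) * \<phi> x t" for c x t
  proof (rule upoly_eq[where S = "{0}" and \<phi> = "\<lambda>c. \<phi> (c * x) (c * t)"])
    fix c :: 'k assume c: "c \<notin> {0}"
    have "c ^ r * \<phi> (c * x) (c * t) = c ^ r * (c ^ (e - r) * \<phi> x t)"
      using assms(2)[of c x t] le by (simp flip: power_add mult.assoc)
    with c show "\<phi> (c * x) (c * t) = c ^ (e - r) * \<phi> x t" by simp
  qed (auto intro!: upoly_intros up)
  with assms(1) show ?thesis by (simp add: bform_def)
qed

text \<open>
  A polynomial map of the projective line with a rational left inverse has degree at most one: after
  cancelling common zeros, the composite has no zeros and equals the identity times a binary form.
\<close>

lemma binary_left_inverse: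
  fixes \<gamma>1 \<gamma>2 B1 B2 :: "'k::alg_closed_field \<Rightarrow> 'k \<Rightarrow> 'k"
  assumes \<gamma>: "bform n \<gamma>1" "bform n \<gamma>2" "\<And>x t. (x, t) \<noteq> (0, 0) \<Longrightarrow> \<gamma>1 x t \<noteq> 0 \<or> \<gamma>2 x t \<noteq> 0"
    and B: "bform e B1" "bform e B2" "B1 y1 y2 \<noteq> 0 \<or> B2 y1 y2 \<noteq> 0"
    and inv: "\<And>x t. B1 (\<gamma>1 x t) (\<gamma>2 x t) * t = B2 (\<gamma>1 x t) (\<gamma>2 x t) * x"
  shows "n \<le> 1"
  using B inv
proof (induction e arbitrary: B1 B2)
  case 0
  have "B1 (\<gamma>1 0 1) (\<gamma>2 0 1) = 0" "B2 (\<gamma>1 1 0) (\<gamma>2 1 0) = 0"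
    using 0(4)[of 0 1] 0(4)[of 1 0] by auto
  then show ?case using 0(3) bform_const[OF 0(1)] bform_const[OF 0(2)] by metis
next
  case (Suc e)
  have bpf: "bpf \<gamma>1" "bpf \<gamma>2" using \<gamma> by (auto simp: bform_def)
  show ?case
  proof (cases "\<exists>h1 h2. (h1, h2) \<noteq> (0, 0) \<and> B1 h1 h2 = 0 \<and> B2 h1 h2 = 0")
    case True
    then obtain h1 h2 where h: "(h1, h2) \<noteq> (0, 0)" "B1 h1 h2 = 0" "B2 h1 h2 = 0" by blast
    obtain B1' where B1': "bform e B1'" "\<And>x t. B1 x t = (h2 * x - h1 * t) * B1' x t"
      using bform_divide[OF Suc.prems(1) h(2,1)] by blast
    obtain B2' where B2': "bform e B2'" "\<And>x t. B2 x t = (h2 * x - h1 * t) * B2' x t"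
      using bform_divide[OF Suc.prems(2) h(3,1)] by blast
    let ?h = "\<lambda>x t. h2 * \<gamma>1 x t - h1 * \<gamma>2 x t"
    show ?thesis
    proof (cases "n = 0")
      case False
      then obtain m where m: "n = Suc m" by (cases n) auto
      \<comment> \<open>A zero of one component of the map is not a zero of the other, so the two
        are not proportional and the common factor of \<open>B1\<close> and \<open>B2\<close> does
        not vanish identically along the map.\<close>
      have "\<exists>x t. ?h x t \<noteq> 0"
      proof (cases "h2 = 0")
        case True
        obtain x t where "(x, t) \<noteq> (0, 0)" "\<gamma>1 x t = 0" using bform_zero_exists \<gamma>(1) m by blast
        with \<gamma>(3)[of x t] True h(1) show ?thesis by (intro exI[of _ x] exI[of _ t]) auto
      next
        case False
        obtain x t where "(x, t) \<noteq> (0, 0)" "\<gamma>2 x t = 0" using bform_zero_exists \<gamma>(2) m by blast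
        with \<gamma>(3)[of x t] False show ?thesis by (intro exI[of _ x] exI[of _ t]) auto
      qed
      then obtain x0 t0 where ne: "?h x0 t0 \<noteq> 0" by blast
      have "B1' (\<gamma>1 x t) (\<gamma>2 x t) * t = B2' (\<gamma>1 x t) (\<gamma>2 x t) * x" for x t
      proof (rule bpf_cancel[of ?h "\<lambda>x t. B1' (\<gamma>1 x t) (\<gamma>2 x t) * t" "\<lambda>x t. B2' (\<gamma>1 x t) (\<gamma>2 x t) * x", OF _ _ _ ne])
        have "bpf (\<lambda>x t. B1' (\<gamma>1 x t) (\<gamma>2 x t))" "bpf (\<lambda>x t. B2' (\<gamma>1 x t) (\<gamma>2 x t))"
          using B1'(1) B2'(1) bpf by (auto simp: bform_def intro: bpf_comp[of B1'] bpf_comp[of B2'])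
        then show "bpf (\<lambda>x t. B1' (\<gamma>1 x t) (\<gamma>2 x t) * t)" "bpf (\<lambda>x t. B2' (\<gamma>1 x t) (\<gamma>2 x t) * x)" "bpf ?h"
          using bpf unfolding bpf_def by (auto intro!: polyfun_intros)
        show "?h x t * (B1' (\<gamma>1 x t) (\<gamma>2 x t) * t) = ?h x t * (B2' (\<gamma>1 x t) (\<gamma>2 x t) * x)" for x t
          using Suc.prems(4)[of x t] by (simp add: B1'(2) B2'(2) mult.assoc)
      qed
      then show ?thesis using Suc.IH[OF B1'(1) B2'(1)] Suc.prems(3) B1'(2) B2'(2) by auto
    qed simp
  next
    case False
    define F1 F2 where "F1 x t = B1 (\<gamma>1 x t) (\<gamma>2 x t)" and "F2 x t = B2 (\<gamma>1 x t) (\<gamma>2 x t)" for x t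
    have F: "bform (Suc e * n) F1" "bform (Suc e * n) F2"
      unfolding F1_def F2_def using Suc.prems \<gamma> by (auto intro: bform_comp simp del: mult_Suc)
    have F0: "F1 x t \<noteq> 0 \<or> F2 x t \<noteq> 0" if "(x, t) \<noteq> (0, 0)" for x t
      using False \<gamma>(3)[OF that] by (auto simp: F1_def F2_def)
    have F01: "F1 0 1 = 0" using Suc.prems(4)[of 0 1] by (simp add: F1_def)
    show ?thesis
    proof (rule ccontr)
      assume "\<not> n \<le> 1"
      then have "Suc e * n \<ge> 2" by simp
      then obtain m where m: "Suc e * n = Suc (Suc m)" by (cases "Suc e * n"; cases "Suc e * n - 1") auto
      \<comment> \<open>From \<open>F1 * t = F2 * x\<close> the pair \<open>(F1, F2)\<close> is
        \<open>S\<close> times \<open>(x, t)\<close>. In degree at least two \<open>S\<close> is not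
        constant, and any zero of \<open>S\<close> is a forbidden common zero.\<close>
      obtain S where S: "bform (Suc m) S" "\<And>x t. F1 x t = (1 * x - 0 * t) * S x t"
        using bform_divide[OF F(1)[unfolded m] F01] by auto
      have "F2 x t = S x t * t" for x t
      proof (rule bpf_cancel[of "\<lambda>x t. x" F2 "\<lambda>x t. S x t * t"])
        show "(1::'k) \<noteq> 0" by simp
        show "bpf F2" "bpf (\<lambda>x t. x)" "bpf (\<lambda>x t. S x t * t)"
          using F(2) S(1) unfolding bform_def bpf_def by (auto intro!: polyfun_intros)
        show "x * F2 x t = x * (S x t * t)" for x t
          using Suc.prems(4)[of x t] S(2)[of x t] unfolding F1_def F2_def by algebra
      qed
      moreover obtain x t where "(x, t) \<noteq> (0, 0)" "S x t = 0" using bform_zero_exists[OF S(1)] by blast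
      ultimately show False using F0[of x t] S(2)[of x t] by auto
    qed
  qed
qed

text \<open>The pair \<open>\<gamma> \<alpha>\<close>, \<open>\<gamma> \<beta>\<close> is the
  logarithmic gradient of the product of the linear forms raised to the powers \<open>w j\<close>,
  cleared of denominators. By Euler's relation a common zero is a zero of some form, because the
  weights have nonzero sum. At a zero of the \<open>j\<close>-th form only the \<open>j\<close>-th
  term survives, and it is nonzero. So there are no common zeros, and
  \<open>binary_left_inverse\<close> applies in degree \<open>card J - 1\<close>.\<close>

lemma weighted_binary_arrangement:
  fixes J :: "'i set" and w \<alpha> \<beta> :: "'i \<Rightarrow> 'k::alg_closed_field"
  defines "\<gamma> \<equiv> \<lambda>c x t. \<Sum>j\<in>J. w j * c j * (\<Prod>i\<in>J-{j}. \<alpha> i * x + \<beta> i * t)"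
  assumes J: "finite J" "\<And>i j. i \<in> J \<Longrightarrow> j \<in> J \<Longrightarrow> i \<noteq> j \<Longrightarrow> \<alpha> i * \<beta> j \<noteq> \<beta> i * \<alpha> j"
    and w: "\<And>j. j \<in> J \<Longrightarrow> w j \<noteq> 0" "sum w J \<noteq> 0"
    and B: "bform e B1" "bform e B2" "B1 y1 y2 \<noteq> 0 \<or> B2 y1 y2 \<noteq> 0"
    and inv: "\<And>x t. B1 (\<gamma> \<alpha> x t) (\<gamma> \<beta> x t) * t = B2 (\<gamma> \<alpha> x t) (\<gamma> \<beta> x t) * x"
  shows "card J \<le> 2"
proof (rule ccontr)
  assume card: "\<not> card J \<le> 2"
  let ?l = "\<lambda>i x t. \<alpha> i * x + \<beta> i * t"
  have form: "bform (card J - 1) (\<gamma> c)" for c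
  proof -
    have "\<gamma> c (s * x) (s * t) = s ^ (card J - 1) * \<gamma> c x t" for s x t
    proof -
      have "(\<Prod>i\<in>J-{j}. ?l i (s * x) (s * t)) = s ^ (card J - 1) * (\<Prod>i\<in>J-{j}. ?l i x t)" if "j \<in> J" for j
      proof -
        have "(\<Prod>i\<in>J-{j}. ?l i (s * x) (s * t)) = (\<Prod>i\<in>J-{j}. s * ?l i x t)"
          by (intro prod.cong) (auto simp: algebra_simps)
        then show ?thesis using that by (simp add: prod.distrib J(1))
      qed
      then show ?thesis by (simp add: \<gamma>_def sum_distrib_left mult_ac cong: sum.cong)
    qed
    moreover have "bpf (\<gamma> c)" unfolding \<gamma>_def bpf_def by (auto intro!: polyfun_intros)
    ultimately show ?thesis by (simp add: bform_def)
  qed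
  have "\<gamma> \<alpha> x t \<noteq> 0 \<or> \<gamma> \<beta> x t \<noteq> 0" if xt: "(x, t) \<noteq> (0, 0)" for x t
  proof (rule ccontr)
    assume "\<not> ?thesis"
    then have 0: "\<gamma> \<alpha> x t = 0" "\<gamma> \<beta> x t = 0" by auto
    have "x * \<gamma> \<alpha> x t + t * \<gamma> \<beta> x t = (\<Sum>j\<in>J. w j * (?l j x t * (\<Prod>i\<in>J-{j}. ?l i x t)))"
      by (simp add: \<gamma>_def sum_distrib_left algebra_simps flip: sum.distrib)
    also have "\<dots> = (\<Sum>j\<in>J. w j * (\<Prod>i\<in>J. ?l i x t))"
      using J(1) by (intro sum.cong) (auto simp: prod.remove)
    also have "\<dots> = sum w J * (\<Prod>i\<in>J. ?l i x t)" by (simp add: sum_distrib_right)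
    finally have "(\<Prod>i\<in>J. ?l i x t) = 0" using 0 w(2) by simp
    then obtain j where j: "j \<in> J" "?l j x t = 0" using J(1) by auto
    have other: "?l i x t \<noteq> 0" if "i \<in> J - {j}" for i
    proof
      assume "?l i x t = 0"
      with j(2) have "(\<alpha> i * \<beta> j - \<beta> i * \<alpha> j) * x = 0" "(\<alpha> i * \<beta> j - \<beta> i * \<alpha> j) * t = 0"
        by algebra+
      with J(2)[of i j] that j xt show False by auto
    qed
    have "\<gamma> c x t = w j * c j * (\<Prod>i\<in>J-{j}. ?l i x t)" for c
    proof -
      have "(\<Prod>i\<in>J-{i}. ?l i x t) = 0" if "i \<in> J - {j}" for i
        using j that J(1) by (intro prod_zero) auto
      then have "(\<Sum>i\<in>J-{j}. w i * c i * (\<Prod>i\<in>J-{i}. ?l i x t)) = 0" by (intro sum.neutral) simp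
      then show ?thesis unfolding \<gamma>_def using J(1) j(1) by (subst sum.remove[of _ j]) simp_all
    qed
    with 0 w(1)[OF j(1)] other J(1) have "\<alpha> j = 0" "\<beta> j = 0" by auto
    moreover have "J \<noteq> {j}" using card by auto
    with j(1) obtain i where "i \<in> J - {j}" by blast
    ultimately show False using J(2)[of i j] j(1) by auto
  qed
  from binary_left_inverse[OF form form this B inv] card show False by auto
qed

lemma card_ge_2_obtain:
  assumes "card T \<ge> 2"
  obtains a b where "a \<in> T" "b \<in> T" "a \<noteq> b"
proof -
  obtain a where "a \<in> T" using assms by fastforce
  moreover have "T \<noteq> {a}" using assms by auto
  ultimately show ?thesis using that by blast
qed

section \<open>Products of linear forms and their gradients\<close>

definition pr :: "('k::field ^ 3) set \<Rightarrow> 'k ^ 3 \<Rightarrow> 'k" where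
  "pr A v = (\<Prod>a\<in>A. dot a v)"

text \<open>The gradient of \<open>pr A\<close>, written out by the product rule. Consequently
  \<open>dot z (gr A v)\<close> is the derivative in the direction \<open>z\<close>, and its zero
  set is the polar curve of the point \<open>z\<close>.\<close>

definition gr :: "('k::field ^ 3) set \<Rightarrow> 'k ^ 3 \<Rightarrow> 'k ^ 3" where
  "gr A v = (\<Sum>a\<in>A. pr (A - {a}) v *s a)"

lemma polyfun_pr [polyfun_intros]: "polyfun (pr A)"
  unfolding pr_def by (intro polyfun_intros)

lemma gr_nth: "gr A v $ i = (\<Sum>a\<in>A. pr (A - {a}) v * a $ i)"
  by (simp add: gr_def)

lemma polyfun_gr [polyfun_intros]: "polyfun (\<lambda>v. gr A v $ i)"
  unfolding gr_nth by (intro polyfun_intros)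

lemma dot_gr: "dot z (gr A v) = (\<Sum>a\<in>A. pr (A - {a}) v * dot z a)"
  by (simp add: gr_def dot_sum_right)

lemma polyfun_dot_gr [polyfun_intros]: "polyfun (\<lambda>v. dot z (gr A v))"
  unfolding dot_gr by (intro polyfun_intros)

lemma polyfun_comp_gr: "polyfun q \<Longrightarrow> polyfun (\<lambda>v. q (gr A v))"
  by (erule polyfun_comp) (rule polyfun_gr)

lemma pr_remove: "finite A \<Longrightarrow> a \<in> A \<Longrightarrow> pr A v = dot a v * pr (A - {a}) v"
  unfolding pr_def by (rule prod.remove)

lemma pr_Un: "finite A \<Longrightarrow> finite B \<Longrightarrow> A \<inter> B = {} \<Longrightarrow> pr (A \<union> B) v = pr A v * pr B v"
  unfolding pr_def by (rule prod.union_disjoint)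

lemma gr_Un:
  assumes "finite A" "finite B" "A \<inter> B = {}"
  shows "gr (A \<union> B) v = pr B v *s gr A v + pr A v *s gr B v"
proof -
  have "pr (A \<union> B - {a}) v = pr B v * pr (A - {a}) v" if "a \<in> A" for a
    using that assms pr_Un[of "A - {a}" B v] by (auto simp: Un_Diff mult.commute Diff_triv disjoint_iff)
  moreover have "pr (A \<union> B - {a}) v = pr A v * pr (B - {a}) v" if "a \<in> B" for a
  proof -
    have "A \<union> B - {a} = A \<union> (B - {a})" using that assms(3) by auto
    then show ?thesis using that assms pr_Un[of A "B - {a}" v] by auto
  qed
  ultimately show ?thesis
    unfolding gr_def using assms
    by (simp add: sum.union_disjoint vec.scale_sum_right)
qed

lemma euler: "finite A \<Longrightarrow> dot v (gr A v) = of_nat (card A) * pr A v"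
proof -
  assume "finite A"
  then have "pr (A - {a}) v * dot v a = pr A v" if "a \<in> A" for a
    using pr_remove[of A a v] that by (simp add: dot_commute mult.commute)
  then show ?thesis unfolding dot_gr by simp
qed

lemma pr_scale: "pr A (c *s v) = c ^ card A * pr A v"
  by (simp add: pr_def prod.distrib)

lemma gr_scale:
  assumes "finite A"
  shows "gr A (c *s v) = c ^ (card A - 1) *s gr A v"
proof -
  have "pr (A - {a}) (c *s v) = c ^ (card A - 1) * pr (A - {a}) v" if "a \<in> A" for a
    using that assms by (simp add: pr_scale)
  then show ?thesis by (simp add: gr_def vec.scale_sum_right)
qed

lemma pr_cong: "(\<And>a. a \<in> A \<Longrightarrow> dot a u = dot a v) \<Longrightarrow> pr A u = pr A v"
  unfolding pr_def by (rule prod.cong) auto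

lemma gr_cong: "(\<And>a. a \<in> A \<Longrightarrow> dot a u = dot a v) \<Longrightarrow> gr A u = gr A v"
  unfolding gr_def by (intro sum.cong) (auto intro!: arg_cong2[where f = "(*s)"] pr_cong)

lemma pr_eq_0_iff: "finite A \<Longrightarrow> pr A v = 0 \<longleftrightarrow> (\<exists>a\<in>A. dot a v = 0)"
  by (simp add: pr_def)

lemma gr_on_line:
  assumes "finite A" "a \<in> A" "dot a v = 0"
  shows "gr A v = pr (A - {a}) v *s a"
proof -
  have "pr (A - {b}) v = 0" if "b \<in> A - {a}" for b
    using assms that by (auto simp: pr_eq_0_iff)
  then have "(\<Sum>b\<in>A-{a}. pr (A - {b}) v *s b) = 0" by (intro sum.neutral) simp
  then show ?thesis unfolding gr_def using assms by (subst sum.remove[of _ a]) auto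
qed

text \<open>Homogeneity of degree \<open>e - r\<close> in the form in which a quotient by an
  \<open>r\<close>-th power inherits it, before \<open>r \<le> e\<close> is known.\<close>

definition weighted :: "nat \<Rightarrow> nat \<Rightarrow> ('k::field ^ 3 \<Rightarrow> 'k) \<Rightarrow> bool" where
  "weighted r e q \<longleftrightarrow> (\<forall>c Y. c ^ r * q (c *s Y) = c ^ e * q Y)"

lemma poly_eqI_fun:
  fixes p q :: "'k::alg_closed_field poly"
  assumes "\<And>t. poly p t = poly q t"
  shows "p = q"
proof -
  have "{t. poly (p - q) t = 0} = UNIV" using assms by auto
  then show ?thesis using poly_roots_finite[of "p - q"] infinite_UNIV_alg_closed by auto
qed

text \<open>Only finitely many powers of \<open>dot z\<close> can divide a nonzero function: on a
  line in a direction \<open>b\<close> with \<open>dot z b = 1\<close>, the power has degree equal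
  to its exponent. One exponent serves the whole family, so ratios between its members are
  preserved.\<close>

lemma divide_out_family:
  fixes q :: "'i \<Rightarrow> 'k::alg_closed_field ^ 3 \<Rightarrow> 'k"
  assumes q: "\<And>i. polyfun (q i)" "q i0 Y0 \<noteq> 0" and z: "z \<noteq> 0"
  obtains r q' where "\<And>i. polyfun (q' i)" "\<And>i Y. q i Y = dot z Y ^ r * q' i Y"
    "\<exists>i Y. dot z Y = 0 \<and> q' i Y \<noteq> 0"
proof (rule ccontr)
  assume no: "\<not> thesis"
  have all: "\<exists>q'. (\<forall>i. polyfun (q' i)) \<and> (\<forall>i Y. q i Y = dot z Y ^ r * q' i Y)" for r
  proof (induction r)
    case 0
    then show ?case using q by (intro exI[of _ q]) auto
  next
    case (Suc r)
    then obtain q' where q': "\<And>i. polyfun (q' i)" "\<And>i Y. q i Y = dot z Y ^ r * q' i Y" by blast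
    have "\<exists>q''. polyfun q'' \<and> (\<forall>Y. q' i Y = dot z Y * q'' Y)" for i
      using polyfun_div_perp[OF q'(1)[of i] z] no that[OF q'] by metis
    then obtain q'' where "\<And>i. polyfun (q'' i)" "\<And>i Y. q' i Y = dot z Y * q'' i Y" by metis
    with q'(2) show ?case by (intro exI[of _ q'']) (simp add: mult_ac)
  qed
  obtain b where b: "dot z b = 1" using exists_dot_eq_1[OF z] by blast
  obtain p where p: "\<And>t. q i0 (Y0 + t *s b) = poly p t"
    using polyfun_line[OF q(1)] unfolding upoly_def by blast
  have "p \<noteq> 0" using p[of 0] q(2) by auto
  obtain q' where q': "\<And>i. polyfun (q' i)" "\<And>i Y. q i Y = dot z Y ^ Suc (degree p) * q' i Y"
    using all by blast
  obtain p' where p': "\<And>t. q' i0 (Y0 + t *s b) = poly p' t"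
    using polyfun_line[OF q'(1)] unfolding upoly_def by blast
  have eq: "p = [:dot z Y0, 1:] ^ Suc (degree p) * p'"
    by (rule poly_eqI_fun) (simp add: p[symmetric] p'[symmetric] q'(2) b algebra_simps)
  with \<open>p \<noteq> 0\<close> have "p' \<noteq> 0" by auto
  then have "degree ([:dot z Y0, 1:] ^ Suc (degree p) * p') = Suc (degree p) + degree p'"
    by (simp only: degree_mult_eq degree_linear_power power_not_zero pCons_eq_0_iff one_neq_zero
        simp_thms)
  with eq show False by simp
qed

lemma weighted_div:
  fixes q' :: "'k::alg_closed_field ^ 3 \<Rightarrow> 'k"
  assumes "\<And>c Y. q (c *s Y) = c ^ e * q Y" "polyfun q'" "\<And>Y. q Y = dot z Y ^ r * q' Y" "z \<noteq> 0"
  shows "weighted r e q'"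
  unfolding weighted_def
proof (intro allI)
  fix c Y
  obtain b where b: "dot z b = 1" using exists_dot_eq_1[OF assms(4)] by blast
  show "c ^ r * q' (c *s Y) = c ^ e * q' Y"
  proof (rule polyfun_cancel[of "\<lambda>Y. dot z Y ^ r" "\<lambda>Y. c ^ r * q' (c *s Y)" "\<lambda>Y. c ^ e * q' Y" b])
    have "polyfun (\<lambda>Y. q' (c *s Y))"
      by (rule polyfun_comp[OF assms(2)]) (auto intro!: polyfun_intros)
    then show "polyfun (\<lambda>Y. dot z Y ^ r)" "polyfun (\<lambda>Y. c ^ r * q' (c *s Y))" "polyfun (\<lambda>Y. c ^ e * q' Y)"
      using assms(2) by (auto intro!: polyfun_intros)
    show "dot z b ^ r \<noteq> 0" using b by simp
    fix Y
    show "dot z Y ^ r * (c ^ r * q' (c *s Y)) = dot z Y ^ r * (c ^ e * q' Y)"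
      using assms(1)[of c Y] unfolding assms(3) by (simp add: power_mult_distrib mult_ac)
  qed
qed

lemma bform_plane:
  fixes R :: "'k::alg_closed_field ^ 3 \<Rightarrow> 'k"
  assumes "polyfun R" "weighted r e R"
  shows "bform (e - r) (\<lambda>x t. R (x *s b1 + t *s b2))"
proof -
  let ?\<phi> = "\<lambda>x t. R (x *s b1 + t *s b2)"
  have bpf: "bpf ?\<phi>" by (rule polyfun_bpf[OF assms(1)]) (auto simp: bpf_def intro!: polyfun_intros)
  show ?thesis
  proof (cases "\<exists>x t. ?\<phi> x t \<noteq> 0")
    case True
    then obtain x0 t0 where 0: "?\<phi> x0 t0 \<noteq> 0" by blast
    show ?thesis
    proof (rule bform_of_weighted[where \<phi> = ?\<phi>, OF bpf _ 0])
      fix c x t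
      have "(c * x) *s b1 + (c * t) *s b2 = c *s (x *s b1 + t *s b2)" by (simp add: vec.scale_right_distrib)
      then show "c ^ r * ?\<phi> (c * x) (c * t) = c ^ e * ?\<phi> x t"
        using assms(2) unfolding weighted_def by metis
    qed
  next
    case False
    then show ?thesis using bpf by (auto simp: bform_def)
  qed
qed

text \<open>On the dual line of \<open>z\<close> the function is a nonzero binary form and splits.
  The vectors \<open>y\<close> matter only modulo \<open>z\<close>, and
  \<open>crs z y \<noteq> 0\<close> expresses that the factor is not identically zero on this
  line.\<close>

lemma split_perp:
  fixes R :: "'k::alg_closed_field ^ 3 \<Rightarrow> 'k"
  assumes R: "polyfun R" "weighted r e R" and z: "z \<noteq> 0" and Y0: "dot z Y0 = 0" "R Y0 \<noteq> 0"
  obtains \<kappa> ys where "\<kappa> \<noteq> 0" "\<And>y. y \<in> set ys \<Longrightarrow> crs z y \<noteq> 0"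
    "\<And>Y. dot z Y = 0 \<Longrightarrow> R Y = \<kappa> * (\<Prod>y\<leftarrow>ys. dot y Y)"
proof -
  obtain e1 e2 b0 b1 b2 where db:
    "\<And>v. v = dot b0 v *s z + dot b1 v *s e1 + dot b2 v *s e2"
    "\<And>y. y = dot z y *s b0 + dot e1 y *s b1 + dot e2 y *s b2"
    "dot b0 z = 1" "dot b0 e1 = 0" "dot b0 e2 = 0"
    "dot b1 z = 0" "dot b1 e1 = 1" "dot b1 e2 = 0"
    "dot b2 z = 0" "dot b2 e1 = 0" "dot b2 e2 = 1"
    by (rule dual_basis[OF z]) (rule that)
  have perp: "Y = dot e1 Y *s b1 + dot e2 Y *s b2" if "dot z Y = 0" for Y
  proof -
    have "Y = dot z Y *s b0 + dot e1 Y *s b1 + dot e2 Y *s b2" by (rule db(2))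
    also have "\<dots> = dot e1 Y *s b1 + dot e2 Y *s b2" by (simp add: that)
    finally show ?thesis .
  qed
  have ne: "R (dot e1 Y0 *s b1 + dot e2 Y0 *s b2) \<noteq> 0" using Y0(2) perp[OF Y0(1)] by metis
  obtain \<kappa> L where L: "\<kappa> \<noteq> 0" "(0, 0) \<notin> set L"
    "\<And>x t. R (x *s b1 + t *s b2) = \<kappa> * (\<Prod>l\<leftarrow>L. fst l * x + snd l * t)"
    using bform_split[OF bform_plane[OF R, of b1 b2] ne] by blast
  let ?y = "\<lambda>l. fst l *s e1 + snd l *s e2"
  show ?thesis
  proof (rule that[of \<kappa> "map ?y L"])
    fix y assume "y \<in> set (map ?y L)"
    then obtain l where l: "l \<in> set L" "y = ?y l" by auto
    show "crs z y \<noteq> 0"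
    proof
      assume "crs z y = 0"
      then obtain c where "y = c *s z" using crs_eq_0_imp[OF _ z] by blast
      then have "dot b1 (?y l) = 0" "dot b2 (?y l) = 0" using l db by auto
      then have "l = (0, 0)" using db by (simp add: prod_eq_iff)
      with L(2) l show False by simp
    qed
  next
    fix Y assume "dot z Y = 0"
    then have "R Y = \<kappa> * (\<Prod>l\<leftarrow>L. fst l * dot e1 Y + snd l * dot e2 Y)"
      using perp L(3) by metis
    then show "R Y = \<kappa> * (\<Prod>y\<leftarrow>map ?y L. dot y Y)" by (simp add: o_def)
  qed (rule L)
qed

section \<open>Line arrangements with a polar map that has a left inverse\<close>

locale arrangement =
  fixes A :: "('k::alg_closed_field ^ 3) set"
  assumes finite: "finite A" and nonzero: "0 \<notin> A"
    and nonparallel: "\<And>a b. a \<in> A \<Longrightarrow> b \<in> A \<Longrightarrow> a \<noteq> b \<Longrightarrow> crs a b \<noteq> 0"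
begin

definition inc :: "'k ^ 3 \<Rightarrow> ('k ^ 3) set" where
  "inc z = {a \<in> A. dot a z = 0}"

lemma finite_inc [simp]: "finite (inc z)" and inc_subset: "inc z \<subseteq> A"
  using finite by (auto simp: inc_def)

lemma generic_point:
  assumes "a \<in> A"
  obtains v where "dot a v = 0" "\<And>b. b \<in> A - {a} \<Longrightarrow> dot b v \<noteq> 0"
proof -
  have "\<exists>w. \<forall>b\<in>A-{a}. dot (crs b a) w \<noteq> 0"
  proof (rule polyfun_avoid)
    fix b assume "b \<in> A - {a}"
    then have "crs b a \<noteq> 0" using assms nonparallel by auto
    then show "\<exists>w. dot (crs b a) w \<noteq> 0" by (metis exists_dot_eq_1 zero_neq_one)
  qed (use finite in \<open>auto intro: polyfun_intros\<close>)
  then obtain w where w: "\<And>b. b \<in> A - {a} \<Longrightarrow> dot (crs b a) w \<noteq> 0" by blast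
  have "dot b (crs a w) = dot (crs b a) w" for b by (simp add: dot_def algebra_simps)
  with w show ?thesis by (intro that[of "crs a w"]) auto
qed

lemma gr_generic:
  assumes "T \<subseteq> A" "a \<in> T"
  obtains v where "dot a v = 0" "pr (T - {a}) v \<noteq> 0" "gr T v = pr (T - {a}) v *s a"
proof -
  obtain v where v: "dot a v = 0" "\<And>b. b \<in> A - {a} \<Longrightarrow> dot b v \<noteq> 0"
    using generic_point assms by blast
  have fin: "finite T" using assms finite finite_subset by blast
  show ?thesis
    by (rule that[OF v(1) _ gr_on_line[OF fin assms(2) v(1)]]) (use v(2) assms fin in \<open>auto simp: pr_eq_0_iff\<close>)
qed

text \<open>Lines through \<open>z\<close> see only the displacement \<open>t *s w\<close>, which
  produces the power of \<open>t\<close>. At \<open>t = 0\<close> the remaining bracket is a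
  multiple of \<open>gr (inc z) w\<close>: on the exceptional curve over \<open>z\<close>, the polar
  map is that of the lines through \<open>z\<close> alone.\<close>

lemma gr_near_point:
  assumes "inc z \<noteq> {}"
  shows "gr A (z + t *s w) = t ^ (card (inc z) - 1) *s (pr (A - inc z) (z + t *s w) *s gr (inc z) w +
    (t * pr (inc z) w) *s gr (A - inc z) (z + t *s w))"
proof -
  let ?T = "inc z" and ?V = "z + t *s w"
  have dots: "dot a ?V = dot a (t *s w)" if "a \<in> ?T" for a using that by (simp add: inc_def)
  have "gr ?T ?V = t ^ (card ?T - 1) *s gr ?T w"
    using gr_cong[OF dots] gr_scale[OF finite_inc] by metis
  moreover have "pr ?T ?V = t ^ (card ?T - 1) * (t * pr ?T w)"
  proof -
    have "pr ?T ?V = t ^ card ?T * pr ?T w" using pr_cong[OF dots] pr_scale by metis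
    moreover have "card ?T = Suc (card ?T - 1)" using assms by (simp add: card_gt_0_iff)
    ultimately show ?thesis by (metis power_Suc2 mult.assoc)
  qed
  moreover have "gr A ?V = pr (A - ?T) ?V *s gr ?T ?V + pr ?T ?V *s gr (A - ?T) ?V"
    using gr_Un[of ?T "A - ?T" ?V] finite inc_subset[of z]
    by (auto simp: Un_absorb1)
  ultimately show ?thesis by (simp add: vec.scale_right_distrib mult_ac)
qed

lemma pr_off_point: "pr (A - inc z) z \<noteq> 0"
  using finite by (auto simp: pr_eq_0_iff inc_def)

text \<open>Equal weights on both sides let the power of \<open>t\<close> cancel, after which
  \<open>t = 0\<close> is allowed. The factor \<open>pr (A - inc z) z\<close> left over is nonzero
  and cancels in the same way.\<close>

lemma limit_at_point:
  assumes "inc z \<noteq> {}"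
    and q: "polyfun q1" "polyfun q2" "weighted r e q1" "weighted r e q2"
    and L: "upoly L1" "upoly L2"
    and eq: "\<And>t. t \<noteq> 0 \<Longrightarrow> q1 (gr A (z + t *s w)) * L1 t = q2 (gr A (z + t *s w)) * L2 t"
  shows "q1 (gr (inc z) w) * L1 0 = q2 (gr (inc z) w) * L2 0"
proof -
  let ?T = "inc z"
  define W where "W t = pr (A - ?T) (z + t *s w) *s gr ?T w + (t * pr ?T w) *s gr (A - ?T) (z + t *s w)" for t
  have W: "gr A (z + t *s w) = t ^ (card ?T - 1) *s W t" for t
    unfolding W_def by (rule gr_near_point[OF assms(1)])
  have upW: "upoly (\<lambda>t. W t $ i)" for i
    unfolding W_def by (auto intro!: upoly_intros polyfun_line polyfun_intros)
  have "q1 (W t) * L1 t = q2 (W t) * L2 t" for t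
  proof (rule upoly_eq[where S = "{0}" and \<phi> = "\<lambda>t. q1 (W t) * L1 t" and \<psi> = "\<lambda>t. q2 (W t) * L2 t"])
    fix t :: 'k assume "t \<notin> {0}"
    then have t: "t \<noteq> 0" by simp
    let ?c = "t ^ (card ?T - 1)"
    have "?c ^ e * (q1 (W t) * L1 t) = ?c ^ r * (q1 (?c *s W t) * L1 t)"
      using q(3) unfolding weighted_def by (metis mult.assoc)
    also have "\<dots> = ?c ^ r * (q2 (?c *s W t) * L2 t)" using eq[OF t] W by simp
    also have "\<dots> = ?c ^ e * (q2 (W t) * L2 t)"
      using q(4) unfolding weighted_def by (metis mult.assoc)
    finally show "q1 (W t) * L1 t = q2 (W t) * L2 t" using t by simp
  qed (auto intro!: upoly_mult L polyfun_upoly[OF q(1)] polyfun_upoly[OF q(2)] upW)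
  from this[of 0] have 0: "q1 (W 0) * L1 0 = q2 (W 0) * L2 0" .
  let ?c = "pr (A - ?T) z"
  have W0: "W 0 = ?c *s gr ?T w" by (simp add: W_def)
  have "?c ^ e * (q1 (gr ?T w) * L1 0) = ?c ^ r * (q1 (?c *s gr ?T w) * L1 0)"
    using q(3) unfolding weighted_def by (metis mult.assoc)
  also have "\<dots> = ?c ^ r * (q2 (?c *s gr ?T w) * L2 0)" using 0 W0 by simp
  also have "\<dots> = ?c ^ e * (q2 (gr ?T w) * L2 0)"
    using q(4) unfolding weighted_def by (metis mult.assoc)
  finally show ?thesis using pr_off_point[of z] by simp
qed

end

text \<open>A left inverse of the polar map, as functions. The right inverse of a birational map is
  spent on \<open>not_concurrent\<close>.\<close>

locale polar_inverse = arrangement A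
  for A :: "('k::alg_closed_field ^ 3) set" +
  fixes Q :: "3 \<Rightarrow> 'k ^ 3 \<Rightarrow> 'k" and e :: nat
  assumes polyfun_Q: "\<And>i. polyfun (Q i)"
    and homogeneous_Q: "\<And>i c Y. Q i (c *s Y) = c ^ e * Q i Y"
    and inverse_Q: "\<And>i j v. Q i (gr A v) * v $ j = Q j (gr A v) * v $ i"
    and nonzero_Q: "\<exists>i v. Q i (gr A v) \<noteq> 0"
    and not_concurrent: "\<And>z. z \<noteq> 0 \<Longrightarrow> \<exists>a\<in>A. dot a z \<noteq> 0"
begin

lemma polar_derivative_nonzero:
  assumes "z \<noteq> 0"
  obtains v where "dot z (gr A v) \<noteq> 0"
proof -
  obtain a where a: "a \<in> A" "dot a z \<noteq> 0" using not_concurrent[OF assms] by blast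
  obtain v where "pr (A - {a}) v \<noteq> 0" "gr A v = pr (A - {a}) v *s a"
    using gr_generic[OF order_refl a(1)] by blast
  with a show ?thesis by (intro that[of v]) (simp add: dot_commute)
qed

text \<open>Near \<open>z\<close> the gradient tends to the dual line of \<open>z\<close>, where the
  components of the inverse may all vanish. Removing the largest common power of
  \<open>dot z\<close> makes their restriction to that line nontrivial. The vectors
  \<open>B i\<close> select the components that are needed.\<close>

lemma divide_Q:
  fixes B :: "'i \<Rightarrow> 'k ^ 3"
  assumes "z \<noteq> 0" "dot (B i0) (\<chi> i. Q i Y0) \<noteq> 0"
  obtains r q where "\<And>i. polyfun (q i)" "\<And>i. weighted r e (q i)"
    "\<And>i Y. dot (B i) (\<chi> i. Q i Y) = dot z Y ^ r * q i Y"
    "\<exists>i Y. dot z Y = 0 \<and> q i Y \<noteq> 0"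
proof -
  have pf: "polyfun (\<lambda>Y. dot (B i) (\<chi> i. Q i Y))" for i
    unfolding dot_def by (auto intro!: polyfun_intros polyfun_Q)
  obtain r q where rq: "\<And>i. polyfun (q i)" "\<And>i Y. dot (B i) (\<chi> i. Q i Y) = dot z Y ^ r * q i Y"
    "\<exists>i Y. dot z Y = 0 \<and> q i Y \<noteq> 0"
    by (rule divide_out_family[where q = "\<lambda>i Y. dot (B i) (\<chi> i. Q i Y)", OF pf assms(2,1)])
      (rule that)
  have "weighted r e (q i)" for i
  proof (rule weighted_div[OF _ rq(1) rq(2) assms(1)])
    show "dot (B i) (\<chi> i. Q i (c *s Y)) = c ^ e * dot (B i) (\<chi> i. Q i Y)" for c Y
      by (simp add: dot_def homogeneous_Q algebra_simps)
  qed
  with rq show ?thesis by (intro that)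
qed

lemma dot_inverse_Q:
  "dot b (\<chi> i. Q i (gr A v)) * dot c v = dot c (\<chi> i. Q i (gr A v)) * dot b v"
proof -
  have *: "Q i (gr A v) * v $ j = Q j (gr A v) * v $ i" for i j by (rule inverse_Q)
  show ?thesis unfolding dot_def using *[of 1 2] *[of 1 3] *[of 2 3] by (simp, algebra)
qed

text \<open>
  The exceptional curve over a multiple point \<open>z\<close> dominates the dual line \<open>z\<^sup>\<bottom>\<close>, so every
  component of the polar curve of \<open>z\<close> is contracted; \<open>crs z y\<close> for \<open>y\<close> in the list are the images.
\<close>

lemma contracted:
  assumes z: "z \<noteq> 0" and two: "card (inc z) \<ge> 2"
  obtains ys where "\<And>y. y \<in> set ys \<Longrightarrow> crs z y \<noteq> 0"
    "\<And>b. dot b z = 0 \<Longrightarrow> \<exists>X. polyfun X \<and>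
        (\<forall>v. dot z (gr A v) * X v = dot b v * (\<Prod>y\<leftarrow>ys. dot y (gr A v)))"
proof -
  let ?T = "inc z"
  have ne: "?T \<noteq> {}" using two by auto
  obtain i0 v0 where "Q i0 (gr A v0) \<noteq> 0" using nonzero_Q by blast
  then have "dot (axis i0 1) (\<chi> i. Q i (gr A v0)) \<noteq> 0" by simp
  then have ne0: "dot (axis i0 1) (\<chi> i. Q i (gr A v0)) \<noteq> 0" .
  obtain r q where q: "\<And>i. polyfun (q i)" "\<And>i. weighted r e (q i)"
    "\<And>i Y. dot (axis i 1) (\<chi> i. Q i Y) = dot z Y ^ r * q i Y" "\<exists>i Y. dot z Y = 0 \<and> q i Y \<noteq> 0"
    by (rule divide_Q[OF z, where B = "\<lambda>i. axis i 1", OF ne0]) (rule that)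
  then have Qq: "Q i Y = dot z Y ^ r * q i Y" for i Y
    by (metis dot_axis(1) mult_1 vec_lambda_beta)
  obtain v1 where v1: "dot z (gr A v1) \<noteq> 0" using polar_derivative_nonzero[OF z] by blast
  have inv: "q i (gr A v) * v $ j = q j (gr A v) * v $ i" for i j v
  proof (rule polyfun_cancel[of "\<lambda>v. dot z (gr A v) ^ r" "\<lambda>v. q i (gr A v) * v $ j" "\<lambda>v. q j (gr A v) * v $ i" v1])
    show "dot z (gr A v) ^ r * (q i (gr A v) * v $ j) = dot z (gr A v) ^ r * (q j (gr A v) * v $ i)" for v
      using inverse_Q[of i v j] unfolding Qq by (simp add: mult_ac)
  qed (use v1 in \<open>auto intro!: polyfun_intros polyfun_comp_gr[OF q(1)]\<close>)
  \<comment> \<open>In the limit the point \<open>z + t *s w\<close> becomes \<open>z\<close>, so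
    the reduced inverse sends every \<open>gr ?T w\<close> to a multiple of
    \<open>z\<close>.\<close>
  have lim: "q i (gr ?T w) * z $ j = q j (gr ?T w) * z $ i" for i j w
  proof -
    have "q i (gr ?T w) * (z + 0 *s w) $ j = q j (gr ?T w) * (z + 0 *s w) $ i"
      by (rule limit_at_point[where ?L1.0 = "\<lambda>t. (z + t *s w) $ j" and ?L2.0 = "\<lambda>t. (z + t *s w) $ i",
            OF ne q(1) q(1) q(2) q(2) _ _ inv]) (auto intro!: upoly_intros)
    then show ?thesis by simp
  qed
  have qb: "\<exists>S. polyfun S \<and> (\<forall>Y. dot b (\<chi> i. q i Y) = dot z Y * S Y)" if b: "dot b z = 0" for b
  proof -
    let ?R = "\<lambda>Y. dot b (\<chi> i. q i Y)"
    have pfR: "polyfun ?R" unfolding dot_def by (auto intro!: polyfun_intros q(1))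
    have wR: "weighted r e ?R"
      unfolding weighted_def
    proof (intro allI)
      fix c Y
      have "c ^ r * q i (c *s Y) = c ^ e * q i Y" for i using q(2) by (simp add: weighted_def)
      from this[of 1] this[of 2] this[of 3] show "c ^ r * ?R (c *s Y) = c ^ e * ?R Y"
        unfolding dot_def vec_lambda_beta distrib_left mult.left_commute[of "c ^ _"] by simp
    qed
    have R0: "?R (gr ?T w) = 0" for w
    proof -
      obtain j where j: "z $ j \<noteq> 0" using z by (auto simp: vec_eq_iff)
      have "?R (gr ?T w) * z $ j = q j (gr ?T w) * dot b z"
        using lim[of 1 w j] lim[of 2 w j] lim[of 3 w j] by (simp add: dot_def, algebra)
      with j b show ?thesis by simp
    qed
    \<comment> \<open>The vectors \<open>gr ?T w\<close> fill the dual line of \<open>z\<close>.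
      Otherwise one linear factor \<open>y\<close> would be orthogonal to all of them, hence to two
      lines through \<open>z\<close>, and so proportional to \<open>z\<close>.\<close>
    have Rz: "?R Y = 0" if "dot z Y = 0" for Y
    proof (rule ccontr)
      assume "?R Y \<noteq> 0"
      then obtain \<kappa> ys where
        ys: "\<kappa> \<noteq> 0" "\<And>y. y \<in> set ys \<Longrightarrow> crs z y \<noteq> 0"
        "\<And>Y. dot z Y = 0 \<Longrightarrow> ?R Y = \<kappa> * (\<Prod>y\<leftarrow>ys. dot y Y)"
        by (rule split_perp[OF pfR wR z \<open>dot z Y = 0\<close>]) (rule that)
      have "dot z (gr ?T w) = 0" for w
        unfolding dot_gr by (intro sum.neutral) (auto simp: inc_def dot_commute)
      then have "(\<Prod>y\<leftarrow>ys. dot y (gr ?T w)) = 0" for w using ys(1,3) R0 by (metis mult_eq_0_iff)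
      then obtain y where y: "y \<in> set ys" "\<And>w. dot y (gr ?T w) = 0"
        using polyfun_zero_prod_list[of ys "\<lambda>y w. dot y (gr ?T w)"] by (auto intro: polyfun_intros)
      have perp: "dot a y = 0" if aT: "a \<in> ?T" for a
      proof -
        obtain v where "pr (?T - {a}) v \<noteq> 0" "gr ?T v = pr (?T - {a}) v *s a"
          by (rule gr_generic[OF inc_subset aT])
        with y(2)[of v] show ?thesis by (simp add: dot_commute)
      qed
      obtain a a' where a: "a \<in> ?T" "a' \<in> ?T" "a \<noteq> a'"
        using two by (rule card_ge_2_obtain)
      then have ne': "crs a a' \<noteq> 0" using nonparallel inc_subset by blast
      have "dot a z = 0" "dot a' z = 0" using a by (auto simp: inc_def)
      from common_perp[OF ne' this] common_perp[OF ne' perp[OF a(1)] perp[OF a(2)]]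
      obtain c c' where "y = c *s crs a a'" "z = c' *s crs a a'" by blast
      then have "crs z y = 0" by simp
      with ys(2)[OF y(1)] show False by simp
    qed
    obtain S where "polyfun S" "\<And>Y. ?R Y = dot z Y * S Y"
      by (rule polyfun_div_perp[OF pfR z]) (erule Rz, rule that)
    then show ?thesis by blast
  qed
  \<comment> \<open>Some component of the reduced inverse survives on the dual line and splits
    there. Modulo \<open>dot z\<close> it may be replaced by this product, and the inverse relation
    then shows that the polar of \<open>z\<close> divides \<open>dot b v\<close> times the product
    of the polars of the \<open>y\<close>s.\<close>
  obtain i Y0 where Y0: "dot z Y0 = 0" "q i Y0 \<noteq> 0" using q(4) by blast
  obtain \<kappa> ys where ys: "\<kappa> \<noteq> 0" "\<And>y. y \<in> set ys \<Longrightarrow> crs z y \<noteq> 0"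
    "\<And>Y. dot z Y = 0 \<Longrightarrow> q i Y = \<kappa> * (\<Prod>y\<leftarrow>ys. dot y Y)"
    by (rule split_perp[OF q(1) q(2) z Y0]) (rule that)
  have pfd: "polyfun (\<lambda>Y. q i Y - \<kappa> * (\<Prod>y\<leftarrow>ys. dot y Y))" by (intro polyfun_intros q(1))
  have "q i Y - \<kappa> * (\<Prod>y\<leftarrow>ys. dot y Y) = 0" if "dot z Y = 0" for Y using ys(3)[OF that] by simp
  note zero = this
  obtain S where S: "polyfun S" "\<And>Y. q i Y - \<kappa> * (\<Prod>y\<leftarrow>ys. dot y Y) = dot z Y * S Y"
    by (rule polyfun_div_perp[OF pfd z]) (erule zero, rule that)
  show ?thesis
  proof (rule that[OF ys(2)])
    fix b assume "dot b z = 0"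
    from qb[OF this] obtain Sb where Sb: "polyfun Sb" "\<And>Y. dot b (\<chi> i. q i Y) = dot z Y * Sb Y" by blast
    let ?X = "\<lambda>v. inverse \<kappa> * (Sb (gr A v) * v $ i - S (gr A v) * dot b v)"
    have "dot z (gr A v) * ?X v = dot b v * (\<Prod>y\<leftarrow>ys. dot y (gr A v))" for v
    proof -
      have "dot b (\<chi> i. q i (gr A v)) * v $ i = q i (gr A v) * dot b v"
        using inv[of 1 v i] inv[of 2 v i] inv[of 3 v i] by (simp add: dot_def, algebra)
      then have "dot z (gr A v) * (Sb (gr A v) * v $ i - S (gr A v) * dot b v) =
          \<kappa> * (dot b v * (\<Prod>y\<leftarrow>ys. dot y (gr A v)))"
        using Sb(2)[of "gr A v"] S(2)[of "gr A v"] by algebra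
      with ys(1) show ?thesis by (simp add: field_simps)
    qed
    moreover have "polyfun ?X" by (intro polyfun_intros polyfun_comp_gr[OF Sb(1)] polyfun_comp_gr[OF S(1)])
    ultimately show "\<exists>X. polyfun X \<and> (\<forall>v. dot z (gr A v) * X v = dot b v * (\<Prod>y\<leftarrow>ys. dot y (gr A v)))"
      by blast
  qed
qed

end

section \<open>Multiple points and their incidences with the lines\<close>

context arrangement
begin

text \<open>A multiple point is represented by the set of lines through it. This does not depend on
  the choice of homogeneous coordinates and makes the collection finite. Any two lines lie in
  exactly one block.\<close>

definition blocks :: "('k ^ 3) set set" where
  "blocks = {inc z | z. z \<noteq> 0 \<and> card (inc z) \<ge> 2}"

lemma inc_scale: "c \<noteq> 0 \<Longrightarrow> inc (c *s z) = inc z"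
  by (auto simp: inc_def)

lemma finite_blocks: "finite blocks"
proof -
  have "blocks \<subseteq> Pow A" using inc_subset by (auto simp: blocks_def)
  then show ?thesis using finite by (simp add: finite_subset)
qed

lemma blockE:
  assumes "T \<in> blocks"
  obtains z where "z \<noteq> 0" "T = inc z" "card (inc z) \<ge> 2"
  using assms by (auto simp: blocks_def)

lemma block_subset: "T \<in> blocks \<Longrightarrow> T \<subseteq> A"
  using inc_subset by (auto simp: blocks_def)

lemma block_card: "T \<in> blocks \<Longrightarrow> card T \<ge> 2"
  by (auto simp: blocks_def)

lemma inc_eq_inc_crs:
  assumes "a \<in> inc z" "b \<in> inc z" "a \<noteq> b" "z \<noteq> 0"
  shows "inc z = inc (crs a b)"
proof -
  have "crs a b \<noteq> 0" "dot a z = 0" "dot b z = 0" using assms nonparallel by (auto simp: inc_def)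
  from common_perp[OF this] obtain c where c: "z = c *s crs a b" by blast
  with assms(4) have "c \<noteq> 0" by auto
  with c show ?thesis using inc_scale by simp
qed

lemma block_eqI:
  assumes "T \<in> blocks" "T' \<in> blocks" "a \<in> T" "b \<in> T" "a \<in> T'" "b \<in> T'" "a \<noteq> b"
  shows "T = T'"
proof -
  obtain z z' where z: "z \<noteq> 0" "T = inc z" and z': "z' \<noteq> 0" "T' = inc z'"
    using assms(1,2) by (auto simp: blocks_def)
  then show ?thesis using inc_eq_inc_crs[of a z b] inc_eq_inc_crs[of a z' b] assms by metis
qed

lemma inc_crs_block:
  assumes "a \<in> A" "b \<in> A" "a \<noteq> b"
  shows "inc (crs a b) \<in> blocks" "a \<in> inc (crs a b)" "b \<in> inc (crs a b)"
proof -
  show ab: "a \<in> inc (crs a b)" "b \<in> inc (crs a b)" using assms by (auto simp: inc_def)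
  have "card {a, b} \<le> card (inc (crs a b))" using ab by (intro card_mono) auto
  then show "inc (crs a b) \<in> blocks"
    using assms nonparallel by (auto simp: blocks_def)
qed

definition through :: "'k ^ 3 \<Rightarrow> ('k ^ 3) set set" where
  "through a = {T \<in> blocks. a \<in> T}"

lemma finite_through [simp]: "finite (through a)"
  using finite_blocks by (simp add: through_def)

text \<open>Every other line meets \<open>a\<close> in exactly one point, which is then
  multiple.\<close>

lemma line_partition:
  assumes "a \<in> A"
  shows "A - {a} = (\<Union>T\<in>through a. T - {a})"
    and "\<And>T T'. T \<in> through a \<Longrightarrow> T' \<in> through a \<Longrightarrow> T \<noteq> T' \<Longrightarrow> (T - {a}) \<inter> (T' - {a}) = {}"
proof -
  show "A - {a} = (\<Union>T\<in>through a. T - {a})"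
  proof (intro subset_antisym subsetI)
    fix b assume "b \<in> A - {a}"
    then show "b \<in> (\<Union>T\<in>through a. T - {a})"
      using inc_crs_block[of a b] assms by (auto simp: through_def)
  qed (use block_subset in \<open>auto simp: through_def\<close>)
  show "(T - {a}) \<inter> (T' - {a}) = {}" if "T \<in> through a" "T' \<in> through a" "T \<noteq> T'" for T T'
    using that block_eqI[of T T' a] by (auto simp: through_def)
qed

lemma sum_over_line:
  assumes "a \<in> A"
  shows "(\<Sum>b\<in>A-{a}. g b) = (\<Sum>T\<in>through a. \<Sum>b\<in>T-{a}. g b)"
  unfolding line_partition(1)[OF assms]
proof (rule sum.UNION_disjoint)
  show "\<forall>T\<in>through a. finite (T - {a})"
    using block_subset finite by (auto simp: through_def intro: finite_subset)
  show "\<forall>T\<in>through a. \<forall>T'\<in>through a. T \<noteq> T' \<longrightarrow> (T - {a}) \<inter> (T' - {a}) = {}"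
    using line_partition(2)[OF assms] by blast
qed simp

end

section \<open>Bounds from exceptional curves: multiplicities, and multiple points on a line\<close>

lemma upoly_rational_curve:
  fixes s :: "'k::field \<Rightarrow> 'k"
  assumes "polyfun T" "upoly s" "\<And>k. upoly (N k)"
  shows "\<exists>D \<phi>. upoly \<phi> \<and> (\<forall>\<tau>. s \<tau> \<noteq> 0 \<longrightarrow> T (\<chi> k. N k \<tau> / s \<tau>) * s \<tau> ^ D = \<phi> \<tau>)"
  using assms(1)
proof (induction rule: polyfun.induct)
  case (polyfun_const c)
  then show ?case by (intro exI[of _ 0] exI[of _ "\<lambda>_. c"]) (auto intro: upoly_intros)
next
  case (polyfun_coord i)
  then show ?case by (intro exI[of _ 1] exI[of _ "N i"]) (use assms(3) in auto)
next
  case (polyfun_add f g)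
  then obtain D1 D2 f' g' where *: "upoly f'" "upoly g'"
    "\<And>\<tau>. s \<tau> \<noteq> 0 \<Longrightarrow> f (\<chi> k. N k \<tau> / s \<tau>) * s \<tau> ^ D1 = f' \<tau>"
    "\<And>\<tau>. s \<tau> \<noteq> 0 \<Longrightarrow> g (\<chi> k. N k \<tau> / s \<tau>) * s \<tau> ^ D2 = g' \<tau>" by blast
  let ?h = "\<lambda>\<tau>. f' \<tau> * s \<tau> ^ D2 + g' \<tau> * s \<tau> ^ D1"
  have "upoly ?h" using * assms(2) by (auto intro!: upoly_intros)
  moreover have "(f (\<chi> k. N k \<tau> / s \<tau>) + g (\<chi> k. N k \<tau> / s \<tau>)) * s \<tau> ^ (D1 + D2) = ?h \<tau>"
    if "s \<tau> \<noteq> 0" for \<tau>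
    unfolding *(3)[OF that, symmetric] *(4)[OF that, symmetric] power_add by (simp add: algebra_simps)
  ultimately show ?case by blast
next
  case (polyfun_mult f g)
  then obtain D1 D2 f' g' where *: "upoly f'" "upoly g'"
    "\<And>\<tau>. s \<tau> \<noteq> 0 \<Longrightarrow> f (\<chi> k. N k \<tau> / s \<tau>) * s \<tau> ^ D1 = f' \<tau>"
    "\<And>\<tau>. s \<tau> \<noteq> 0 \<Longrightarrow> g (\<chi> k. N k \<tau> / s \<tau>) * s \<tau> ^ D2 = g' \<tau>" by blast
  let ?h = "\<lambda>\<tau>. f' \<tau> * g' \<tau>"
  have "upoly ?h" using * by (auto intro!: upoly_intros)
  moreover have "(f (\<chi> k. N k \<tau> / s \<tau>) * g (\<chi> k. N k \<tau> / s \<tau>)) * s \<tau> ^ (D1 + D2) = ?h \<tau>"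
    if "s \<tau> \<noteq> 0" for \<tau>
    unfolding *(3)[OF that, symmetric] *(4)[OF that, symmetric] power_add by (simp add: algebra_simps)
  ultimately show ?case by blast
qed

lemma bform_times_coords:
  assumes "bform r \<phi>"
  shows "bform (Suc r) (\<lambda>x t. \<phi> x t * x)" "bform (Suc r) (\<lambda>x t. \<phi> x t * t)"
  using assms unfolding bform_def bpf_def by (auto intro!: polyfun_intros)

lemma dot_cross_identity:
  fixes u v :: "'k::field ^ 3"
  assumes "\<And>i j. u $ i * v $ j = u $ j * v $ i"
  shows "dot b u * dot c v = dot c u * dot b v"
  unfolding dot_def using assms[of 1 2] assms[of 1 3] assms[of 2 3] by algebra

context polar_inverse
begin

text \<open>
  The exceptional curve over a point of multiplicity \<open>m\<close> maps to the dual line by the polar map of \<open>m\<close>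
  points on a projective line, which has degree \<open>m - 1\<close> unless the characteristic divides \<open>m\<close>.
\<close>

lemma multiplicity_le_2:
  assumes z: "z \<noteq> 0" and m: "of_nat (card (inc z)) \<noteq> (0::'k)"
  shows "card (inc z) \<le> 2"
proof -
  let ?T = "inc z"
  have ne: "?T \<noteq> {}" using m by auto
  obtain e1 e2 b0 b1 b2 where db:
    "\<And>v. v = dot b0 v *s z + dot b1 v *s e1 + dot b2 v *s e2"
    "\<And>y. y = dot z y *s b0 + dot e1 y *s b1 + dot e2 y *s b2"
    "dot b0 z = 1" "dot b0 e1 = 0" "dot b0 e2 = 0"
    "dot b1 z = 0" "dot b1 e1 = 1" "dot b1 e2 = 0"
    "dot b2 z = 0" "dot b2 e1 = 0" "dot b2 e2 = 1"
    by (rule dual_basis[OF z]) (rule that)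
  have perp: "Y = dot e1 Y *s b1 + dot e2 Y *s b2" if "dot z Y = 0" for Y
  proof -
    have "Y = dot z Y *s b0 + dot e1 Y *s b1 + dot e2 Y *s b2" by (rule db(2))
    also have "\<dots> = dot e1 Y *s b1 + dot e2 Y *s b2" by (simp add: that)
    finally show ?thesis .
  qed
  obtain i1 v1 where "Q i1 (gr A v1) \<noteq> 0" using nonzero_Q by blast
  then have "\<not> (\<forall>v. Q i1 (gr A v) = 0)" by blast
  moreover have "\<not> (\<forall>v. dot b1 v = 0)" using db(7) by (metis zero_neq_one)
  ultimately obtain v0 where v0: "Q i1 (gr A v0) \<noteq> 0" "dot b1 v0 \<noteq> 0"
    using polyfun_zero_product[OF polyfun_comp_gr[OF polyfun_Q[of i1], of A] polyfun_dot(1)[of b1]]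
    by (metis mult_eq_0_iff)
  define B where "B i = (if i then b1 else b2)" for i :: bool
  let ?Q = "\<lambda>Y. \<chi> i. Q i Y"
  \<comment> \<open>If both components vanished, the inverse at \<open>v0\<close> would be a nonzero
    multiple of \<open>z\<close>. But it is proportional to \<open>v0\<close>, and
    \<open>dot b1\<close> is nonzero on \<open>v0\<close> and zero on \<open>z\<close>.\<close>
  have "\<exists>i. dot (B i) (?Q (gr A v0)) \<noteq> 0"
  proof (rule ccontr)
    assume "\<not> ?thesis"
    then have 0: "dot b1 (?Q (gr A v0)) = 0" "dot b2 (?Q (gr A v0)) = 0"
      unfolding B_def by (metis (full_types))+
    with dot_inverse_Q[of b1 v0 b0] v0(2) have "dot b0 (?Q (gr A v0)) = 0" by simp
    with 0 db(1)[of "?Q (gr A v0)"] have "?Q (gr A v0) = 0" by (simp only: vec.scale_zero_left add_0)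
    with v0(1) show False by (metis vec_lambda_beta zero_index)
  qed
  then obtain i0 where i0: "dot (B i0) (?Q (gr A v0)) \<noteq> 0" by blast
  obtain r q where q: "\<And>i. polyfun (q i)" "\<And>i. weighted r e (q i)"
    "\<And>i Y. dot (B i) (?Q Y) = dot z Y ^ r * q i Y" "\<exists>i Y. dot z Y = 0 \<and> q i Y \<noteq> 0"
    by (rule divide_Q[OF z, where B = B, OF i0]) (rule that)
  obtain u0 where u0: "dot z (gr A u0) \<noteq> 0" by (rule polar_derivative_nonzero[OF z])
  have inv: "q True (gr A v) * dot b2 v = q False (gr A v) * dot b1 v" for v
  proof (rule polyfun_cancel[of "\<lambda>v. dot z (gr A v) ^ r" "\<lambda>v. q True (gr A v) * dot b2 v" "\<lambda>v. q False (gr A v) * dot b1 v" u0])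
    fix v
    have "dot b1 (?Q (gr A v)) * dot b2 v = dot b2 (?Q (gr A v)) * dot b1 v" by (rule dot_inverse_Q)
    then show "dot z (gr A v) ^ r * (q True (gr A v) * dot b2 v) = dot z (gr A v) ^ r * (q False (gr A v) * dot b1 v)"
      using q(3)[of True "gr A v"] q(3)[of False "gr A v"] by (simp add: B_def)
  qed (use u0 in \<open>auto intro!: polyfun_intros polyfun_comp_gr[OF q(1)]\<close>)
  \<comment> \<open>The \<open>b1\<close>- and \<open>b2\<close>-coordinates of
    \<open>z + t *s w\<close> are \<open>t\<close> times those of \<open>w\<close>. After cancelling
    \<open>t\<close> the limit recovers the direction \<open>w\<close>, hence a left inverse on the
    exceptional curve.\<close>
  have lim: "q True (gr ?T w) * dot b2 w = q False (gr ?T w) * dot b1 w" for w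
  proof (rule limit_at_point[where ?L1.0 = "\<lambda>_. dot b2 w" and ?L2.0 = "\<lambda>_. dot b1 w",
        OF ne q(1) q(1) q(2) q(2) upoly_const upoly_const])
    fix t :: 'k assume "t \<noteq> 0"
    then show "q True (gr A (z + t *s w)) * dot b2 w = q False (gr A (z + t *s w)) * dot b1 w"
      using inv[of "z + t *s w"] db by simp
  qed
  let ?B = "\<lambda>i x t. q i (x *s b1 + t *s b2)"
  let ?\<gamma> = "\<lambda>c x t. \<Sum>a\<in>?T. 1 * c a * (\<Prod>b\<in>?T-{a}. dot b e1 * x + dot b e2 * t)"
  obtain j Y where "dot z Y = 0" "q j Y \<noteq> 0" using q(4) by blast
  then have Bne: "?B True (dot e1 Y) (dot e2 Y) \<noteq> 0 \<or> ?B False (dot e1 Y) (dot e2 Y) \<noteq> 0"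
    using perp[of Y] by (cases j) auto
  have \<gamma>: "?\<gamma> (\<lambda>a. dot a c) x t = dot c (gr ?T (x *s e1 + t *s e2))" for c x t
    by (simp add: dot_gr pr_def dot_commute[of c] mult.commute)
  show ?thesis
  proof (rule weighted_binary_arrangement[where \<alpha> = "\<lambda>a. dot a e1" and \<beta> = "\<lambda>a. dot a e2" and w = "\<lambda>_. 1",
        OF finite_inc _ _ _ bform_plane[OF q(1) q(2)] bform_plane[OF q(1) q(2)] Bne])
    fix a b assume ab: "a \<in> ?T" "b \<in> ?T" "a \<noteq> b"
    then have a: "a = dot e1 a *s b1 + dot e2 a *s b2" and b: "b = dot e1 b *s b1 + dot e2 b *s b2"
      using perp by (auto simp: inc_def dot_commute[of z])
    have "crs a b = (dot e1 a * dot e2 b - dot e2 a * dot e1 b) *s crs b1 b2"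
      by (subst a, subst b) (simp add: vec3_eq_iff algebra_simps)
    moreover have "crs a b \<noteq> 0" using ab nonparallel by (auto simp: inc_def)
    ultimately show "dot a e1 * dot b e2 \<noteq> dot a e2 * dot b e1" by (auto simp: dot_commute)
  next
    show "(\<Sum>a\<in>?T. 1) \<noteq> (0::'k)" using m by simp
  next
    fix x t
    let ?w = "x *s e1 + t *s e2"
    have "dot z (gr ?T ?w) = 0"
      unfolding dot_gr by (intro sum.neutral) (auto simp: inc_def dot_commute)
    then have "gr ?T ?w = ?\<gamma> (\<lambda>a. dot a e1) x t *s b1 + ?\<gamma> (\<lambda>a. dot a e2) x t *s b2"
      unfolding \<gamma> by (rule perp)
    then show "?B True (?\<gamma> (\<lambda>a. dot a e1) x t) (?\<gamma> (\<lambda>a. dot a e2) x t) * t =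
        ?B False (?\<gamma> (\<lambda>a. dot a e1) x t) (?\<gamma> (\<lambda>a. dot a e2) x t) * x"
      using lim[of ?w] db(7-11) by simp
  qed auto
qed

text \<open>
  A line of the arrangement is contracted to a point, whose exceptional curve it dominates by the
  logarithmic polar map of the multiple points on the line, each counted with weight \<open>m - 1\<close>.
\<close>

lemma points_on_line_le_2:
  assumes a0: "a0 \<in> A" and d: "of_nat (card A - 1) \<noteq> (0::'k)"
    and m: "\<And>T. T \<in> through a0 \<Longrightarrow> of_nat (card T - 1) \<noteq> (0::'k)"
  shows "card (through a0) \<le> 2"
proof -
  have a0_nz: "a0 \<noteq> 0" using a0 nonzero by auto
  obtain E1 E2 B0 B1 B2 where db:
    "\<And>v. v = dot B0 v *s a0 + dot B1 v *s E1 + dot B2 v *s E2"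
    "\<And>y. y = dot a0 y *s B0 + dot E1 y *s B1 + dot E2 y *s B2"
    "dot B0 a0 = 1" "dot B0 E1 = 0" "dot B0 E2 = 0"
    "dot B1 a0 = 0" "dot B1 E1 = 1" "dot B1 E2 = 0"
    "dot B2 a0 = 0" "dot B2 E1 = 0" "dot B2 E2 = 1"
    by (rule dual_basis[OF a0_nz]) (rule that)
  have B0_nz: "B0 \<noteq> 0" using db(3) by auto
  have dot_dual: "dot a0 B0 = 1" "dot a0 B1 = 0" "dot a0 B2 = 0" "dot E1 B1 = 1" "dot E1 B2 = 0"
    "dot E2 B1 = 0" "dot E2 B2 = 1" using db by (simp_all add: dot_commute)
  let ?A = "A - {a0}"
  \<comment> \<open>A chart of the blow-up of the dual plane at \<open>a0\<close>: for
    \<open>Y = \<tau> *s a0 + \<eta>\<close> with \<open>dot B0 \<eta> = 0\<close> the image is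
    \<open>a0 + \<tau> *s \<eta>\<close>, and \<open>\<tau> = 0\<close> is the exceptional
    curve.\<close>
  define U' where "U' Y = a0 + dot B0 Y *s (Y - dot B0 Y *s a0)" for Y
  have pf: "polyfun (\<lambda>Y. Q i (U' Y))" for i
    by (rule polyfun_comp[OF polyfun_Q]) (auto simp: U'_def intro!: polyfun_intros)
  have "\<exists>i Y. Q i (U' Y) \<noteq> 0"
  proof -
    obtain i v where "Q i (gr A v) \<noteq> 0" using nonzero_Q by blast
    then have "\<not> (\<forall>Y. Q i Y = 0)" by blast
    moreover have "\<not> (\<forall>Y. dot B0 Y = 0)" using db(3) by (metis zero_neq_one)
    ultimately obtain Y where Y: "Q i Y \<noteq> 0" "dot B0 Y \<noteq> 0"
      using polyfun_zero_product[OF polyfun_Q[of i] polyfun_dot(1)[of B0]] by (metis mult_eq_0_iff)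
    let ?Z = "inverse (dot B0 Y) *s Y"
    have "Y = dot B0 Y *s ?Z" using Y(2) by simp
    then have "Q i ?Z \<noteq> 0" using Y(1) homogeneous_Q by (metis mult_zero_right)
    moreover have "U' ?Z = ?Z" using Y(2) by (simp add: U'_def)
    ultimately show ?thesis by metis
  qed
  then obtain i0 Y0 where ne: "Q i0 (U' Y0) \<noteq> 0" by blast
  obtain r T where T: "\<And>i. polyfun (T i)" "\<And>i Y. Q i (U' Y) = dot B0 Y ^ r * T i Y"
    "\<exists>i Y. dot B0 Y = 0 \<and> T i Y \<noteq> 0"
    by (rule divide_out_family[where q = "\<lambda>i Y. Q i (U' Y)", OF pf ne B0_nz]) (rule that)
  have QT: "Q i (a0 + \<tau> *s \<eta>) = \<tau> ^ r * T i (\<tau> *s a0 + \<eta>)" if "dot B0 \<eta> = 0" for i \<tau> \<eta>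
    using T(2)[of i "\<tau> *s a0 + \<eta>"] that db(3) by (simp add: U'_def)
  \<comment> \<open>The vector \<open>a0 + \<tau> *s (c *s \<eta>)\<close> is also
    \<open>a0 + (\<tau> * c) *s \<eta>\<close>. Comparing the powers of \<open>\<tau>\<close>
    removed in the two readings and then putting \<open>\<tau> = 0\<close> yields the degree
    \<open>r\<close> on the exceptional curve.\<close>
  have T_hom: "T i (c *s \<eta>) = c ^ r * T i \<eta>" if \<eta>: "dot B0 \<eta> = 0" for i c \<eta>
  proof -
    have "T i (\<tau> *s a0 + c *s \<eta>) = c ^ r * T i ((\<tau> * c) *s a0 + \<eta>)" for \<tau>
    proof (rule upoly_eq[where S = "{0}" and \<phi> = "\<lambda>\<tau>. T i (\<tau> *s a0 + c *s \<eta>)"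
          and \<psi> = "\<lambda>\<tau>. c ^ r * T i ((\<tau> * c) *s a0 + \<eta>)"])
      fix \<tau> :: 'k assume "\<tau> \<notin> {0}"
      moreover have "\<tau> ^ r * T i (\<tau> *s a0 + c *s \<eta>) = \<tau> ^ r * (c ^ r * T i ((\<tau> * c) *s a0 + \<eta>))"
        using QT[of "c *s \<eta>" i \<tau>] QT[of \<eta> i "\<tau> * c"] \<eta> by (auto simp: power_mult_distrib)
      ultimately show "T i (\<tau> *s a0 + c *s \<eta>) = c ^ r * T i ((\<tau> * c) *s a0 + \<eta>)" by simp
    qed (auto intro!: upoly_mult upoly_const polyfun_upoly[OF T(1)], (auto intro!: upoly_intros))
    from this[of 0] show ?thesis by simp
  qed
  \<comment> \<open>Moving off the line, the gradient at \<open>P + \<tau> *s B0\<close> is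
    \<open>s \<tau> *s a0 + \<tau> *s h \<tau>\<close> with \<open>s 0 \<noteq> 0\<close>. So the
    line is contracted to \<open>a0\<close>, but \<open>P\<close> leaves its trace
    \<open>\<eta> = h 0\<close> on the exceptional curve, and the reduced inverse \<open>T\<close>
    leads from \<open>\<eta>\<close> back to \<open>P\<close>.\<close>
  have main: "T i \<eta> * P $ j = T j \<eta> * P $ i"
    if P: "dot a0 P = 0" "pr ?A P \<noteq> 0" and \<eta>: "\<eta> = dot B1 (gr ?A P) *s E1 + dot B2 (gr ?A P) *s E2"
    for P \<eta> i j
  proof -
    define V where "V \<tau> = P + \<tau> *s B0" for \<tau>
    define s where "s \<tau> = pr ?A (V \<tau>) + \<tau> * dot B0 (gr ?A (V \<tau>))" for \<tau>
    define h where "h \<tau> = dot B1 (gr ?A (V \<tau>)) *s E1 + dot B2 (gr ?A (V \<tau>)) *s E2" for \<tau>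
    define N where "N k \<tau> = \<tau> * a0 $ k + s \<tau> * h \<tau> $ k" for k \<tau>
    have upV: "upoly (\<lambda>\<tau>. V \<tau> $ k)" for k unfolding V_def by (auto intro!: upoly_intros)
    have upg: "upoly (\<lambda>\<tau>. f (V \<tau>))" if "polyfun f" for f by (rule polyfun_upoly[OF that upV])
    have ups: "upoly s" unfolding s_def by (intro upoly_intros upg polyfun_intros)
    have upd: "upoly (\<lambda>\<tau>. dot c (gr ?A (V \<tau>)))" for c by (rule upg) (rule polyfun_intros)
    have upN: "upoly (N k)" for k
      unfolding N_def h_def by (auto intro!: upoly_intros ups upd)
    have grA: "gr A (V \<tau>) = s \<tau> *s a0 + \<tau> *s h \<tau>" for \<tau>
    proof -
      have "dot a0 (V \<tau>) = \<tau>" using P(1) dot_dual by (simp add: V_def)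
      then have "gr A (V \<tau>) = pr ?A (V \<tau>) *s a0 + \<tau> *s gr ?A (V \<tau>)"
        using gr_Un[of "{a0}" ?A "V \<tau>"] a0 finite by (simp add: insert_absorb gr_def pr_def)
      moreover have "gr ?A (V \<tau>) = dot B0 (gr ?A (V \<tau>)) *s a0 + h \<tau>"
        using db(1)[of "gr ?A (V \<tau>)"] unfolding h_def by (simp only: add.assoc)
      ultimately show ?thesis unfolding s_def
        by (metis (no_types, lifting) add.assoc vec.scale_left_distrib vec.scale_right_distrib vec.scale_scale)
    qed
    have s0: "s 0 \<noteq> 0" using P(2) by (simp add: s_def V_def)
    have Qs: "Q i (gr A (V \<tau>)) = s \<tau> ^ e * ((\<tau> / s \<tau>) ^ r * T i (\<chi> k. N k \<tau> / s \<tau>))"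
      if "s \<tau> \<noteq> 0" for i \<tau>
    proof -
      have "gr A (V \<tau>) = s \<tau> *s (a0 + (\<tau> / s \<tau>) *s h \<tau>)"
        using that by (simp add: grA vec.scale_right_distrib)
      moreover have "dot B0 (h \<tau>) = 0" using db(4,5) by (simp add: h_def)
      moreover have "(\<tau> / s \<tau>) *s a0 + h \<tau> = (\<chi> k. N k \<tau> / s \<tau>)"
        using that by (simp add: vec_eq_iff N_def add_divide_distrib)
      ultimately show ?thesis using QT homogeneous_Q by metis
    qed
    \<comment> \<open>The chart coordinates are rational in \<open>\<tau>\<close> with denominator
      \<open>s \<tau>\<close>. A power of it is cleared so that the identity becomes polynomial and
      can be evaluated at \<open>\<tau> = 0\<close>.\<close>
    obtain D1 \<phi>1 where 1: "upoly \<phi>1" "\<And>\<tau>. s \<tau> \<noteq> 0 \<Longrightarrow> T i (\<chi> k. N k \<tau> / s \<tau>) * s \<tau> ^ D1 = \<phi>1 \<tau>"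
      using upoly_rational_curve[where N = N, OF T(1)[of i] ups upN] by blast
    obtain D2 \<phi>2 where 2: "upoly \<phi>2" "\<And>\<tau>. s \<tau> \<noteq> 0 \<Longrightarrow> T j (\<chi> k. N k \<tau> / s \<tau>) * s \<tau> ^ D2 = \<phi>2 \<tau>"
      using upoly_rational_curve[where N = N, OF T(1)[of j] ups upN] by blast
    have "\<phi>1 \<tau> * s \<tau> ^ D2 * V \<tau> $ j = \<phi>2 \<tau> * s \<tau> ^ D1 * V \<tau> $ i" for \<tau>
    proof (rule upoly_eq[where S = "insert 0 {\<tau>. s \<tau> = 0}" and \<phi> = "\<lambda>\<tau>. \<phi>1 \<tau> * s \<tau> ^ D2 * V \<tau> $ j"
          and \<psi> = "\<lambda>\<tau>. \<phi>2 \<tau> * s \<tau> ^ D1 * V \<tau> $ i"])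
      show "finite (insert 0 {\<tau>. s \<tau> = 0})" using upoly_finite_zeros[OF ups s0] by simp
      fix \<tau> assume "\<tau> \<notin> insert 0 {\<tau>. s \<tau> = 0}"
      then have \<tau>: "\<tau> \<noteq> 0" "s \<tau> \<noteq> 0" by auto
      let ?t = "\<lambda>i. T i (\<chi> k. N k \<tau> / s \<tau>)" and ?c = "s \<tau> ^ e * (\<tau> / s \<tau>) ^ r"
      have "?c * (?t i * V \<tau> $ j) = ?c * (?t j * V \<tau> $ i)"
        using inverse_Q[of i "V \<tau>" j] Qs[OF \<tau>(2)] by (simp add: mult.assoc)
      moreover have "?c \<noteq> 0" using \<tau> by simp
      ultimately have "?t i * V \<tau> $ j = ?t j * V \<tau> $ i" by (metis mult_left_cancel)
      then show "\<phi>1 \<tau> * s \<tau> ^ D2 * V \<tau> $ j = \<phi>2 \<tau> * s \<tau> ^ D1 * V \<tau> $ i"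
        unfolding 1(2)[OF \<tau>(2), symmetric] 2(2)[OF \<tau>(2), symmetric] by (simp add: mult_ac)
    qed (intro upoly_intros 1(1) 2(1) ups upV)+
    from this[of 0] have "\<phi>1 0 * s 0 ^ D2 * P $ j = \<phi>2 0 * s 0 ^ D1 * P $ i" by (simp add: V_def)
    note eq0 = this
    have "(\<chi> k. N k 0 / s 0) = \<eta>" using s0 by (simp add: N_def h_def V_def \<eta> vec_eq_iff)
    then have f: "\<phi>1 0 = T i \<eta> * s 0 ^ D1" "\<phi>2 0 = T j \<eta> * s 0 ^ D2"
      using 1(2)[OF s0] 2(2)[OF s0] by simp_all
    have "s 0 ^ (D1 + D2) * (T i \<eta> * P $ j) = s 0 ^ (D1 + D2) * (T j \<eta> * P $ i)"
      using eq0 unfolding f power_add by (simp only: mult_ac)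
    with s0 show ?thesis by simp
  qed
  define c where "c T = (SOME b. b \<in> T - {a0})" for T
  have c: "c T \<in> T - {a0}" if "T \<in> through a0" for T
  proof -
    have "T \<noteq> {}" "T \<noteq> {a0}" using that block_card[of T] by (auto simp: through_def)
    then have "\<exists>b. b \<in> T - {a0}" by blast
    then show ?thesis unfolding c_def by (rule someI_ex)
  qed
  have cA: "c T \<in> ?A" if "T \<in> through a0" for T
    using c[OF that] block_subset[of T] that by (auto simp: through_def)
  \<comment> \<open>Lines other than \<open>a0\<close> in one block meet \<open>a0\<close> at the
    same point, so their restrictions to \<open>a0\<close> are proportional and the representative
    \<open>c T\<close> can stand for all of them.\<close>
  have restrict: "\<exists>l. l \<noteq> 0 \<and> dot b B1 = l * dot (c T) B1 \<and> dot b B2 = l * dot (c T) B2"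
    if T': "T \<in> through a0" and b: "b \<in> T - {a0}" for T b
  proof -
    obtain z where z: "z \<noteq> 0" "T = inc z" using T' by (auto simp: through_def elim: blockE)
    have 0: "dot a0 z = 0" "dot b z = 0" "dot (c T) z = 0"
      using T' b c[OF T'] z by (auto simp: inc_def through_def)
    define z1 z2 where "z1 = dot E1 z" and "z2 = dot E2 z"
    have zz: "z = z1 *s B1 + z2 *s B2" using db(2)[of z] 0(1) by (simp only: z1_def z2_def vec.scale_zero_left add_0)
    have zne: "z1 \<noteq> 0 \<or> z2 \<noteq> 0" using z(1) zz by auto
    have e: "z1 * dot b B1 + z2 * dot b B2 = 0" "z1 * dot (c T) B1 + z2 * dot (c T) B2 = 0"
      using 0(2,3) unfolding zz by simp_all
    have nz: "dot x B1 \<noteq> 0 \<or> dot x B2 \<noteq> 0" if "x \<in> ?A" for x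
    proof (rule ccontr)
      assume "\<not> ?thesis"
      then have "x = dot B0 x *s a0" using db(1)[of x] by (simp add: dot_commute)
      then have "crs a0 x = 0" by (metis crs_linear(6) dot_crs(5) vec.scale_zero_right)
      with nonparallel[of a0 x] a0 that show False by auto
    qed
    have bA: "b \<in> ?A" using b T' block_subset[of T] by (auto simp: through_def)
    show ?thesis
    proof (cases "z2 = 0")
      case True
      with zne e have "dot b B1 = 0" "dot (c T) B1 = 0" by auto
      then show ?thesis using nz[OF bA] nz[OF cA[OF T']]
        by (intro exI[of _ "dot b B2 / dot (c T) B2"]) auto
    next
      case False
      then have e': "dot b B2 = - z1 / z2 * dot b B1" "dot (c T) B2 = - z1 / z2 * dot (c T) B1"
        using e by (simp_all add: field_simps eq_neg_iff_add_eq_0 add.commute)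
      then have "dot b B1 \<noteq> 0" "dot (c T) B1 \<noteq> 0" using nz[OF bA] nz[OF cA[OF T']] by auto
      with e' show ?thesis by (intro exI[of _ "dot b B1 / dot (c T) B1"]) simp
    qed
  qed
  let ?J = "through a0"
  let ?P = "\<lambda>x t. x *s B1 + t *s B2"
  let ?\<alpha> = "\<lambda>T. dot (c T) B1" and ?\<beta> = "\<lambda>T. dot (c T) B2" and ?w = "\<lambda>T. of_nat (card T - 1) :: 'k"
  let ?\<gamma> = "\<lambda>\<alpha> x t. \<Sum>j\<in>?J. ?w j * \<alpha> j * (\<Prod>i\<in>?J-{j}. ?\<alpha> i * x + ?\<beta> i * t)"
  \<comment> \<open>The quotient \<open>dot b B / dot b ?p\<close> is the same for all
    \<open>b\<close> in one block, so each multiple point is counted \<open>card T - 1\<close>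
    times. The product over the blocks clears the denominators.\<close>
  have logder: "dot B (gr ?A (?P x t)) * (\<Prod>T\<in>?J. ?\<alpha> T * x + ?\<beta> T * t) =
      pr ?A (?P x t) * ?\<gamma> (\<lambda>T. dot (c T) B) x t"
    if nz: "pr ?A (?P x t) \<noteq> 0" and B: "B = B1 \<or> B = B2" for x t B
  proof -
    let ?p = "?P x t"
    have nzb: "dot b ?p \<noteq> 0" if "b \<in> ?A" for b using nz that finite by (simp add: pr_eq_0_iff)
    have dc: "dot (c T) ?p = ?\<alpha> T * x + ?\<beta> T * t" for T by (simp add: mult.commute)
    have nzc: "?\<alpha> T * x + ?\<beta> T * t \<noteq> 0" if "T \<in> ?J" for T using nzb[OF cA[OF that]] unfolding dc .
    have "dot B (gr ?A ?p) = (\<Sum>b\<in>?A. pr ?A ?p * (dot b B / dot b ?p))"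
      unfolding dot_gr
    proof (rule sum.cong)
      fix b assume b: "b \<in> ?A"
      show "pr (?A - {b}) ?p * dot B b = pr ?A ?p * (dot b B / dot b ?p)"
        using pr_remove[of ?A b ?p] b nzb[OF b] finite by (simp add: dot_commute)
    qed simp
    also have "\<dots> = pr ?A ?p * (\<Sum>T\<in>?J. \<Sum>b\<in>T-{a0}. dot b B / dot b ?p)"
      by (simp only: sum_distrib_left[symmetric] sum_over_line[OF a0])
    also have "(\<Sum>T\<in>?J. \<Sum>b\<in>T-{a0}. dot b B / dot b ?p) =
        (\<Sum>T\<in>?J. ?w T * (dot (c T) B / (?\<alpha> T * x + ?\<beta> T * t)))"
    proof (rule sum.cong)
      fix T assume T': "T \<in> ?J"
      have "dot b B / dot b ?p = dot (c T) B / (?\<alpha> T * x + ?\<beta> T * t)" if b: "b \<in> T - {a0}" for b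
      proof -
        obtain l where l: "l \<noteq> 0" "dot b B1 = l * ?\<alpha> T" "dot b B2 = l * ?\<beta> T"
          using restrict[OF T' b] by blast
        then have "dot b ?p = l * (?\<alpha> T * x + ?\<beta> T * t)" by (simp add: algebra_simps)
        with l B show ?thesis by auto
      qed
      moreover have "card (T - {a0}) = card T - 1" using T' by (simp add: through_def)
      ultimately show "(\<Sum>b\<in>T-{a0}. dot b B / dot b ?p) = ?w T * (dot (c T) B / (?\<alpha> T * x + ?\<beta> T * t))"
        by simp
    qed simp
    finally have "dot B (gr ?A ?p) * (\<Prod>T\<in>?J. ?\<alpha> T * x + ?\<beta> T * t) = pr ?A ?p *
        (\<Sum>T\<in>?J. ?w T * (dot (c T) B / (?\<alpha> T * x + ?\<beta> T * t)) * (\<Prod>T\<in>?J. ?\<alpha> T * x + ?\<beta> T * t))"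
      by (simp add: mult.assoc sum_distrib_right)
    also have "(\<Sum>T\<in>?J. ?w T * (dot (c T) B / (?\<alpha> T * x + ?\<beta> T * t)) * (\<Prod>T\<in>?J. ?\<alpha> T * x + ?\<beta> T * t)) =
        ?\<gamma> (\<lambda>T. dot (c T) B) x t"
    proof (rule sum.cong)
      fix T assume T': "T \<in> ?J"
      then show "?w T * (dot (c T) B / (?\<alpha> T * x + ?\<beta> T * t)) * (\<Prod>T\<in>?J. ?\<alpha> T * x + ?\<beta> T * t) =
          ?w T * dot (c T) B * (\<Prod>i\<in>?J-{T}. ?\<alpha> i * x + ?\<beta> i * t)"
        using nzc[OF T'] by (subst prod.remove[of _ T]) auto
    qed simp
    finally show ?thesis .
  qed
  let ?h = "\<lambda>x t. ?\<gamma> ?\<alpha> x t *s E1 + ?\<gamma> ?\<beta> x t *s E2"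
  have B0E: "dot B0 (x *s E1 + t *s E2) = 0" for x t using db(4,5) by simp
  have bpfT: "bpf (\<lambda>x t. T i (x *s E1 + t *s E2))" for i
    by (rule polyfun_bpf[OF T(1)]) (auto simp: bpf_def intro!: polyfun_intros)
  have inv: "T i (?h x t) * ?P x t $ j = T j (?h x t) * ?P x t $ i" for i j x t
  proof -
    obtain P0 where P0: "dot a0 P0 = 0" "\<And>b. b \<in> ?A \<Longrightarrow> dot b P0 \<noteq> 0"
      by (rule generic_point[OF a0]) (rule that)
    define x0 t0 where "x0 = dot E1 P0" and "t0 = dot E2 P0"
    have "P0 = ?P x0 t0" using db(2)[of P0] P0(1) by (simp only: x0_def t0_def vec.scale_zero_left add_0)
    then have nz0: "pr ?A (?P x0 t0) \<noteq> 0" using P0(2) finite by (simp add: pr_eq_0_iff)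
    have bpf\<gamma>: "bpf (?\<gamma> \<alpha>)" for \<alpha> unfolding bpf_def by (intro polyfun_intros)
    have bpfTh: "bpf (\<lambda>x t. T i (?h x t))" for i by (rule bpf_comp[OF bpfT bpf\<gamma> bpf\<gamma>])
    show ?thesis
    proof (rule bpf_cancel[of "\<lambda>x t. pr ?A (?P x t)" "\<lambda>x t. T i (?h x t) * ?P x t $ j" "\<lambda>x t. T j (?h x t) * ?P x t $ i", OF _ _ _ nz0])
      show "bpf (\<lambda>x t. pr ?A (?P x t))"
        by (rule polyfun_bpf) (auto simp: bpf_def intro!: polyfun_intros)
      show "bpf (\<lambda>x t. T i (?h x t) * ?P x t $ j)" for i j
        using bpfTh unfolding bpf_def by (auto intro!: polyfun_intros)
      then show "bpf (\<lambda>x t. T j (?h x t) * ?P x t $ i)" .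
      fix x t
      show "pr ?A (?P x t) * (T i (?h x t) * ?P x t $ j) = pr ?A (?P x t) * (T j (?h x t) * ?P x t $ i)"
      proof (cases "pr ?A (?P x t) = 0")
        case False
        define \<eta> where "\<eta> = dot B1 (gr ?A (?P x t)) *s E1 + dot B2 (gr ?A (?P x t)) *s E2"
        have m': "T i \<eta> * ?P x t $ j = T j \<eta> * ?P x t $ i"
          by (rule main[OF _ False \<eta>_def]) (simp add: dot_dual)
        let ?\<pi> = "\<Prod>T\<in>?J. ?\<alpha> T * x + ?\<beta> T * t" and ?p = "pr ?A (?P x t)"
        have eq: "?\<pi> *s \<eta> = ?p *s ?h x t"
          using logder[OF False, of B1] logder[OF False, of B2]
          by (simp add: \<eta>_def vec.scale_right_distrib mult.commute[of ?\<pi>])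
        have TT: "?p ^ r * T i (?h x t) = ?\<pi> ^ r * T i \<eta>" for i
        proof -
          have "dot B0 \<eta> = 0" unfolding \<eta>_def by (rule B0E)
          then have "?\<pi> ^ r * T i \<eta> = T i (?\<pi> *s \<eta>)" by (rule T_hom[symmetric])
          also have "\<dots> = T i (?p *s ?h x t)" unfolding eq ..
          also have "\<dots> = ?p ^ r * T i (?h x t)" by (rule T_hom[OF B0E])
          finally show ?thesis ..
        qed
        have "?p ^ r * (T i (?h x t) * ?P x t $ j) = ?\<pi> ^ r * (T i \<eta> * ?P x t $ j)"
          by (simp only: mult.assoc[symmetric] TT)
        also have "\<dots> = ?\<pi> ^ r * (T j \<eta> * ?P x t $ i)" by (simp only: m')
        also have "\<dots> = ?p ^ r * (T j (?h x t) * ?P x t $ i)"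
          by (simp only: mult.assoc[symmetric] TT)
        finally have "?p ^ r * (T i (?h x t) * ?P x t $ j) = ?p ^ r * (T j (?h x t) * ?P x t $ i)" .
        with False show ?thesis by simp
      qed simp
    qed
  qed
  have bfT: "bform r (\<lambda>x t. dot B (\<chi> i. T i (x *s E1 + t *s E2)))" for B
  proof -
    have "T i (s *s (x *s E1 + t *s E2)) = s ^ r * T i (x *s E1 + t *s E2)" for i s x t
      by (rule T_hom[OF B0E])
    then have Th: "T i ((s * x) *s E1 + (s * t) *s E2) = s ^ r * T i (x *s E1 + t *s E2)" for i s x t
      by (simp add: vec.scale_right_distrib)
    have "dot B (\<chi> i. T i ((s * x) *s E1 + (s * t) *s E2)) =
        s ^ r * dot B (\<chi> i. T i (x *s E1 + t *s E2))" for s x t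
      unfolding dot_def vec_lambda_beta Th by (simp only: distrib_left mult_ac)
    moreover have "bpf (\<lambda>x t. dot B (\<chi> i. T i (x *s E1 + t *s E2)))"
      using bpfT unfolding bpf_def dot_def by (auto intro!: polyfun_intros)
    ultimately show ?thesis by (simp add: bform_def)
  qed
  let ?F = "\<lambda>B x t. dot B (\<chi> i. T i (x *s E1 + t *s E2))"
  have invF: "?F B (?\<gamma> ?\<alpha> x t) (?\<gamma> ?\<beta> x t) * dot B' (?P x t) = ?F B' (?\<gamma> ?\<alpha> x t) (?\<gamma> ?\<beta> x t) * dot B (?P x t)" for B B' x t
    by (rule dot_cross_identity) (simp only: vec_lambda_beta inv)
  obtain i1 Y1 where Y1: "dot B0 Y1 = 0" "T i1 Y1 \<noteq> 0" using T(3) by blast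
  define y1 y2 where "y1 = dot B1 Y1" and "y2 = dot B2 Y1"
  have Y1': "Y1 = y1 *s E1 + y2 *s E2" using db(1)[of Y1] Y1(1) by (simp only: y1_def y2_def vec.scale_zero_left add_0)
  have nonpar: "?\<alpha> i * ?\<beta> j \<noteq> ?\<beta> i * ?\<alpha> j" if ij: "i \<in> ?J" "j \<in> ?J" "i \<noteq> j" for i j
  proof
    assume eq: "?\<alpha> i * ?\<beta> j = ?\<beta> i * ?\<alpha> j"
    let ?z = "?\<beta> i *s B1 - ?\<alpha> i *s B2"
    have "dot (c i) ?z = 0" "dot (c j) ?z = 0" "dot a0 ?z = 0"
      using eq dot_dual by (simp_all add: mult.commute)
    moreover have "?z \<noteq> 0"
    proof
      assume "?z = 0"
      then have "dot E1 ?z = 0" "dot E2 ?z = 0" by simp_all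
      then have "dot B1 (c i) = 0" "dot B2 (c i) = 0" using dot_dual by (simp_all add: dot_commute)
      then have "c i = dot B0 (c i) *s a0" using db(1)[of "c i"] by (simp only: vec.scale_zero_left add_0_right)
      then have "crs a0 (c i) = 0" by (metis crs_linear(6) dot_crs(5) vec.scale_zero_right)
      with nonparallel[of a0 "c i"] a0 cA[OF ij(1)] show False by auto
    qed
    moreover have "c i \<noteq> c j"
      using line_partition(2)[OF a0 ij] c[OF ij(1)] c[OF ij(2)] by auto
    ultimately have "{a0, c i, c j} \<subseteq> inc ?z" using a0 cA[OF ij(1)] cA[OF ij(2)] by (auto simp: inc_def)
    moreover have "card {a0, c i} = 2" using cA[OF ij(1)] by auto
    ultimately have "inc ?z \<in> blocks" using \<open>?z \<noteq> 0\<close> card_mono[of "inc ?z" "{a0, c i}"]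
      by (auto simp: blocks_def)
    then have "i = inc ?z" "j = inc ?z"
      using block_eqI[of i "inc ?z" a0 "c i"] block_eqI[of j "inc ?z" a0 "c j"] ij c[OF ij(1)] c[OF ij(2)]
        \<open>{a0, c i, c j} \<subseteq> inc ?z\<close> by (auto simp: through_def)
    with ij(3) show False by simp
  qed
  have sumw: "(\<Sum>T\<in>?J. ?w T) \<noteq> 0"
  proof -
    have "card ?A = (\<Sum>T\<in>?J. card (T - {a0}))"
      using sum_over_line[OF a0, of "\<lambda>_. 1::nat"] by simp
    also have "\<dots> = (\<Sum>T\<in>?J. card T - 1)" by (intro sum.cong) (auto simp: through_def)
    finally have "card A - 1 = (\<Sum>T\<in>?J. card T - 1)" using a0 by simp
    with d show ?thesis by (metis of_nat_sum)
  qed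
  have weighted_arr: "card ?J \<le> 2"
    if "bform n F1" "bform n F2" "F1 u1 u2 \<noteq> 0 \<or> F2 u1 u2 \<noteq> 0"
      and inv12: "\<And>x t. F1 (?\<gamma> ?\<alpha> x t) (?\<gamma> ?\<beta> x t) * t = F2 (?\<gamma> ?\<alpha> x t) (?\<gamma> ?\<beta> x t) * x"
    for n F1 F2 u1 u2
  proof (rule weighted_binary_arrangement[where J = ?J and \<alpha> = ?\<alpha> and \<beta> = ?\<beta> and w = ?w
        and e = n and ?B1.0 = F1 and ?B2.0 = F2 and ?y1.0 = u1 and ?y2.0 = u2])
    show "?\<alpha> i * ?\<beta> j \<noteq> ?\<beta> i * ?\<alpha> j" if "i \<in> ?J" "j \<in> ?J" "i \<noteq> j" for i j
      by (rule nonpar[OF that])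
    show "?w T \<noteq> 0" if "T \<in> ?J" for T by (rule m[OF that])
    show "finite ?J" by simp
  qed (fact sumw that)+
  have dotP: "dot E1 (?P x t) = x" "dot E2 (?P x t) = t" "dot a0 (?P x t) = 0" for x t
    using dot_dual by simp_all
  show ?thesis
  proof (cases "\<exists>x t. ?F E1 x t \<noteq> 0 \<or> ?F E2 x t \<noteq> 0")
    case True
    then obtain x0 t0 where ne: "?F E1 x0 t0 \<noteq> 0 \<or> ?F E2 x0 t0 \<noteq> 0" by blast
    show ?thesis
      by (rule weighted_arr[OF bfT bfT ne]) (rule invF[of E1 _ _ E2, unfolded dotP])
  next
    \<comment> \<open>Only the \<open>a0\<close>-component of \<open>T\<close> is left. Points of
      the line satisfy \<open>dot a0 P = 0\<close>, so \<open>invF\<close> makes this component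
      vanish along the map unless \<open>x = t = 0\<close>. Multiplying it by the two coordinates
      gives a nonzero pair of forms for which both sides of the inverse identity are zero.\<close>
    case False
    then have F0: "?F E1 x t = 0" "?F E2 x t = 0" for x t by auto
    have "?F a0 y1 y2 \<noteq> 0"
    proof
      assume "?F a0 y1 y2 = 0"
      with F0 db(2)[of "\<chi> i. T i (y1 *s E1 + y2 *s E2)"]
      have "(\<chi> i. T i (y1 *s E1 + y2 *s E2)) = 0" by (simp only: vec.scale_zero_left add_0)
      then have "T i1 Y1 = 0" unfolding Y1' by (metis vec_lambda_beta zero_index)
      with Y1(2) show False by simp
    qed
    note Fne = this
    define G where "G = ?F a0"
    have G: "bpf G" "G y1 y2 \<noteq> 0" using bfT[of a0] Fne by (simp_all add: G_def bform_def)
    have "\<exists>x t. G x t * x \<noteq> 0"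
    proof (rule ccontr)
      assume "\<nexists>x t. G x t * x \<noteq> 0"
      then have G0: "G x t * x = 0" for x t by blast
      have "bpf (\<lambda>x t::'k. x)" unfolding bpf_def by (intro polyfun_intros)
      from bpf_zero_product[OF G(1) this G0] show False using G(2) zero_neq_one by metis
    qed
    then obtain x0 t0 where ne: "?F a0 x0 t0 * x0 \<noteq> 0" unfolding G_def by blast
    have 0: "?F a0 (?\<gamma> ?\<alpha> x t) (?\<gamma> ?\<beta> x t) * x = 0" "?F a0 (?\<gamma> ?\<alpha> x t) (?\<gamma> ?\<beta> x t) * t = 0" for x t
      using invF[of a0 x t E1] invF[of a0 x t E2] by (simp_all only: dotP mult_zero_right)
    have bf: "bform (Suc r) (\<lambda>x t. ?F a0 x t * x)" "bform (Suc r) (\<lambda>x t. ?F a0 x t * t)"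
      by (rule bform_times_coords[OF bfT[of a0]])+
    from ne have "?F a0 x0 t0 * x0 \<noteq> 0 \<or> ?F a0 x0 t0 * t0 \<noteq> 0" by blast
    show ?thesis
    proof (rule weighted_arr[OF bf \<open>?F a0 x0 t0 * x0 \<noteq> 0 \<or> ?F a0 x0 t0 * t0 \<noteq> 0\<close>])
      fix x t
      let ?f = "?F a0 (?\<gamma> ?\<alpha> x t) (?\<gamma> ?\<beta> x t)"
      have "?f = 0 \<or> x = 0 \<and> t = 0" using 0[of x t] by (simp only: mult_eq_0_iff) blast
      then show "?f * ?\<gamma> ?\<alpha> x t * t = ?f * ?\<gamma> ?\<beta> x t * x" by (elim disjE conjE) simp_all
    qed
  qed
qed

end

section \<open>Prime factorization of bivariate polynomials\<close>

text \<open>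
  Unique factorization in iterated polynomial rings is available for coefficients of class
  \<^class>\<open>field_gcd\<close>, which a field only becomes through a copy carrying the trivial Euclidean structure.
\<close>

typedef 'a fld = "UNIV :: 'a set" by simp

setup_lifting type_definition_fld

instantiation fld :: (field) field
begin
lift_definition zero_fld :: "'a fld" is 0 .
lift_definition one_fld :: "'a fld" is 1 .
lift_definition plus_fld :: "'a fld \<Rightarrow> 'a fld \<Rightarrow> 'a fld" is "(+)" .
lift_definition minus_fld :: "'a fld \<Rightarrow> 'a fld \<Rightarrow> 'a fld" is "(-)" .
lift_definition uminus_fld :: "'a fld \<Rightarrow> 'a fld" is "uminus" .
lift_definition times_fld :: "'a fld \<Rightarrow> 'a fld \<Rightarrow> 'a fld" is "(*)" .
lift_definition divide_fld :: "'a fld \<Rightarrow> 'a fld \<Rightarrow> 'a fld" is "(/)" .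
lift_definition inverse_fld :: "'a fld \<Rightarrow> 'a fld" is "inverse" .
instance by standard (transfer; simp add: algebra_simps divide_inverse)+
end

instantiation fld ::
  (field) "{unique_euclidean_ring, normalization_euclidean_semiring, normalization_semidom_multiplicative}"
begin
definition [simp]: "normalize_fld = (normalize_field :: 'a fld \<Rightarrow> _)"
definition [simp]: "unit_factor_fld = (unit_factor_field :: 'a fld \<Rightarrow> _)"
definition [simp]: "modulo_fld = (mod_field :: 'a fld \<Rightarrow> _)"
definition [simp]: "euclidean_size_fld = (euclidean_size_field :: 'a fld \<Rightarrow> _)"
definition [simp]: "division_segment (x :: 'a fld) = 1"
instance
  by standard (simp_all add: dvd_field_iff field_split_simps split: if_splits)
end

instantiation fld :: (field) euclidean_ring_gcd
begin
definition gcd_fld :: "'a fld \<Rightarrow> 'a fld \<Rightarrow> 'a fld" where "gcd_fld = Euclidean_Algorithm.gcd"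
definition lcm_fld :: "'a fld \<Rightarrow> 'a fld \<Rightarrow> 'a fld" where "lcm_fld = Euclidean_Algorithm.lcm"
definition Gcd_fld :: "'a fld set \<Rightarrow> 'a fld" where "Gcd_fld = Euclidean_Algorithm.Gcd"
definition Lcm_fld :: "'a fld set \<Rightarrow> 'a fld" where "Lcm_fld = Euclidean_Algorithm.Lcm"
instance by standard (simp_all add: gcd_fld_def lcm_fld_def Gcd_fld_def Lcm_fld_def)
end

instance fld :: (field) field_gcd ..

definition ring_iso_map :: "('a::comm_ring_1 \<Rightarrow> 'b::comm_ring_1) \<Rightarrow> bool" where
  "ring_iso_map h \<longleftrightarrow> bij h \<and> (\<forall>x y. h (x + y) = h x + h y) \<and> (\<forall>x y. h (x * y) = h x * h y) \<and> h 1 = 1"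

lemma ring_iso_map_simps:
  assumes "ring_iso_map h"
  shows "h (x + y) = h x + h y" "h (x * y) = h x * h y" "h 1 = 1" "h 0 = 0"
proof -
  show *: "h (x + y) = h x + h y" "h (x * y) = h x * h y" "h 1 = 1" for x y
    using assms by (auto simp: ring_iso_map_def)
  show "h 0 = 0" using *(1)[of 0 0] by simp
qed

lemma ring_iso_map_sum: "ring_iso_map h \<Longrightarrow> h (sum f I) = (\<Sum>i\<in>I. h (f i))"
  by (induction I rule: infinite_finite_induct) (auto simp: ring_iso_map_simps)

lemma ring_iso_map_prod: "ring_iso_map h \<Longrightarrow> h (prod f I) = (\<Prod>i\<in>I. h (f i))"
  by (induction I rule: infinite_finite_induct) (auto simp: ring_iso_map_simps)

lemma ring_iso_map_map_poly:
  assumes h: "ring_iso_map h"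
  shows "ring_iso_map (map_poly h)"
proof -
  have "bij h" using h by (simp add: ring_iso_map_def)
  then obtain g where g: "\<And>x. g (h x) = x" "\<And>y. h (g y) = y"
    by (metis bij_inv_eq_iff)
  have h0: "h 0 = 0" and g0: "g 0 = 0" using ring_iso_map_simps[OF h] g by metis+
  have "map_poly g (map_poly h p) = p" "map_poly h (map_poly g q) = q" for p q
    by (simp_all add: poly_eq_iff coeff_map_poly h0 g0 g)
  then have "bij (map_poly h)" by (metis bijI')
  moreover have "map_poly h (p + q) = map_poly h p + map_poly h q" for p q
    by (simp add: poly_eq_iff coeff_map_poly h0 ring_iso_map_simps[OF h])
  moreover have "map_poly h (p * q) = map_poly h p * map_poly h q" for p q
    by (simp add: poly_eq_iff coeff_map_poly h0 coeff_mult ring_iso_map_sum[OF h] ring_iso_map_simps[OF h])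
  moreover have "map_poly h 1 = 1"
    by (simp add: poly_eq_iff coeff_map_poly h0 ring_iso_map_simps[OF h])
  ultimately show ?thesis by (simp add: ring_iso_map_def)
qed

lemma ring_iso_map_dvd:
  assumes "ring_iso_map h"
  shows "h x dvd h y \<longleftrightarrow> x dvd y"
proof
  assume "h x dvd h y"
  then obtain k where "h y = h x * k" by (elim dvdE)
  moreover obtain l where "k = h l" using assms by (metis bij_pointE ring_iso_map_def)
  ultimately have "h y = h (x * l)" using ring_iso_map_simps[OF assms] by simp
  moreover have "inj h" using assms by (simp add: ring_iso_map_def bij_def)
  ultimately have "y = x * l" by (simp add: inj_eq)
  then show "x dvd y" by simp
qed (use ring_iso_map_simps[OF assms] in auto)

lemma ring_iso_map_prime:
  assumes h: "ring_iso_map h" and p: "prime_elem (h x)"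
  shows "prime_elem x"
proof (rule prime_elemI)
  show "x \<noteq> 0" using p ring_iso_map_simps[OF h] by auto
  show "\<not> x dvd 1" using p ring_iso_map_simps(3)[OF h] ring_iso_map_dvd[OF h, of x 1]
    by (auto dest: prime_elem_not_unit)
  fix a b assume "x dvd a * b"
  then have "h x dvd h a * h b" using ring_iso_map_dvd[OF h, of x "a * b"] ring_iso_map_simps[OF h] by simp
  then show "x dvd a \<or> x dvd b" using p ring_iso_map_dvd[OF h] by (metis prime_elem_dvd_mult_iff)
qed

text \<open>The factorization is found over the copy of the field and pulled back; a ring
  isomorphism respects divisibility, hence primes and units.\<close>

lemma prime_factors_bivariate:
  fixes P :: "'k::field poly poly"
  assumes "P \<noteq> 0"
  obtains n :: nat and C u where "\<And>i. i < n \<Longrightarrow> prime_elem (C i)" "is_unit u" "P = u * (\<Prod>i<n. C i)"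
proof -
  define h :: "'k poly poly \<Rightarrow> 'k fld poly poly" where "h = map_poly (map_poly Abs_fld)"
  have "ring_iso_map (Abs_fld :: 'k \<Rightarrow> 'k fld)"
  proof -
    have "bij (Abs_fld :: 'k \<Rightarrow> 'k fld)"
      by (metis Abs_fld_inverse Rep_fld_inverse UNIV_I bijI')
    then show ?thesis
      by (simp add: ring_iso_map_def plus_fld.abs_eq times_fld.abs_eq one_fld_def eq_onp_def)
  qed
  then have h: "ring_iso_map h" unfolding h_def by (intro ring_iso_map_map_poly)
  have "h P \<noteq> 0" using assms h ring_iso_map_simps(4)[OF h] by (metis bij_def inj_eq ring_iso_map_def)
  then obtain M where M: "\<And>x. x \<in># M \<Longrightarrow> prime_elem x" "normalize (prod_mset M) = normalize (h P)"
    using prime_factorization_exists by blast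
  obtain u' where u': "is_unit u'" "h P = u' * prod_mset M"
    using M(2) by (metis associatedE1)
  obtain xs where xs: "mset xs = M" using ex_mset by blast
  have "\<forall>x. \<exists>y. h y = x" using h by (metis bij_pointE ring_iso_map_def)
  then obtain g where g: "\<And>x. h (g x) = x" by metis
  define C where "C i = g (xs ! i)" for i
  have "prod_mset M = (\<Prod>i<length xs. xs ! i)"
    unfolding xs[symmetric] prod_mset_prod_list by (simp add: prod.list_conv_set_nth atLeast0LessThan)
  then have "h P = h (g u' * (\<Prod>i<length xs. C i))"
    using u'(2) by (simp add: C_def g ring_iso_map_simps[OF h] ring_iso_map_prod[OF h])
  then have "P = g u' * (\<Prod>i<length xs. C i)" using h by (metis bij_def inj_eq ring_iso_map_def)
  moreover have "is_unit (g u')"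
    using u'(1) ring_iso_map_dvd[OF h, of "g u'" 1] by (simp add: g ring_iso_map_simps[OF h])
  moreover have "prime_elem (C i)" if "i < length xs" for i
    by (rule ring_iso_map_prime[OF h]) (use that M(1) xs in \<open>auto simp: C_def g\<close>)
  ultimately show ?thesis by (intro that)
qed

section \<open>Specialization of bivariate polynomials\<close>

text \<open>In a bivariate polynomial the outer variable is \<open>t\<close>, and the coefficients are polynomials in \<open>x\<close>.\<close>

definition ev2 :: "'k::comm_ring_1 poly poly \<Rightarrow> 'k \<Rightarrow> 'k \<Rightarrow> 'k" where
  "ev2 P x t = poly (poly P [:t:]) x"

definition spec :: "'k::comm_ring_1 \<Rightarrow> 'k poly poly \<Rightarrow> 'k poly" where
  "spec x P = map_poly (\<lambda>c. poly c x) P"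

lemma ev2_simps [simp]:
  "ev2 (P + R) x t = ev2 P x t + ev2 R x t" "ev2 (P * R) x t = ev2 P x t * ev2 R x t"
  "ev2 (P - R) x t = ev2 P x t - ev2 R x t"
  "ev2 [:c:] x t = poly c x" "ev2 0 x t = 0" "ev2 1 x t = 1" "ev2 [:a, b:] x t = poly a x + t * poly b x"
  by (simp_all add: ev2_def)

lemma ev2_sum [simp]: "ev2 (\<Sum>i\<in>I. P i) x t = (\<Sum>i\<in>I. ev2 (P i) x t)"
  by (induction I rule: infinite_finite_induct) auto

lemma ev2_prod [simp]: "ev2 (\<Prod>i\<in>I. P i) x t = (\<Prod>i\<in>I. ev2 (P i) x t)"
  by (induction I rule: infinite_finite_induct) auto

lemma ev2_prod_list: "ev2 (\<Prod>i\<leftarrow>I. P i) x t = (\<Prod>i\<leftarrow>I. ev2 (P i) x t)"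
  by (induction I) auto

lemma ev2_dvd: "P dvd R \<Longrightarrow> ev2 P x t = 0 \<Longrightarrow> ev2 R x t = 0"
  by (auto elim!: dvdE)

lemma poly_spec: "poly (spec x P) t = ev2 P x t"
  unfolding spec_def ev2_def by (induction P) (simp_all add: map_poly_pCons)

lemma ev2_inject:
  fixes P R :: "'k::alg_closed_field poly poly"
  assumes "\<And>x t. ev2 P x t = ev2 R x t"
  shows "P = R"
proof -
  have "poly P [:t:] = poly R [:t:]" for t by (rule poly_eqI_fun) (use assms in \<open>simp add: ev2_def\<close>)
  then have "range (\<lambda>t. [:t:]) \<subseteq> {y. poly (P - R) y = 0}" by auto
  moreover have "infinite (range (\<lambda>t::'k. [:t:]))"
    using infinite_UNIV_alg_closed by (subst finite_image_iff) (auto simp: inj_on_def)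
  ultimately have "infinite {y. poly (P - R) y = 0}" using finite_subset by blast
  then have "P - R = 0" using poly_roots_finite by blast
  then show ?thesis by simp
qed

lemma spec_simps:
  fixes P R :: "'k::alg_closed_field poly poly"
  shows "spec x (P * R) = spec x P * spec x R" "spec x (\<Prod>i\<in>I. F i) = (\<Prod>i\<in>I. spec x (F i))"
    "spec x (pderiv P) = pderiv (spec x P)"
proof -
  show mult: "spec x (P * R) = spec x P * spec x R" for P R
    by (rule poly_eqI_fun) (simp add: poly_spec)
  have one: "spec x 1 = 1" by (rule poly_eqI_fun) (simp add: poly_spec)
  show "spec x (\<Prod>i\<in>I. F i) = (\<Prod>i\<in>I. spec x (F i))"
    by (induction I rule: infinite_finite_induct) (simp_all add: one mult)
  show "spec x (pderiv P) = pderiv (spec x P)"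
    by (rule poly_eqI) (simp add: spec_def coeff_map_poly coeff_pderiv of_nat_poly poly_smult)
qed

lemma degree_spec:
  assumes "poly (lead_coeff P) x \<noteq> 0"
  shows "degree (spec x P) = degree P"
proof (rule antisym)
  show "degree (spec x P) \<le> degree P" unfolding spec_def by (rule map_poly_degree_leq)
  show "degree P \<le> degree (spec x P)"
    by (rule le_degree) (use assms in \<open>simp add: spec_def coeff_map_poly\<close>)
qed

lemma polyfun_ev2:
  fixes V :: "'k::field \<Rightarrow> 'k \<Rightarrow> 'k ^ 3"
  assumes "polyfun q" "\<And>i. \<exists>P. \<forall>x t. ev2 P x t = V x t $ i"
  shows "\<exists>P. \<forall>x t. ev2 P x t = q (V x t)"
  using assms(1)
proof (induction rule: polyfun.induct)
  case (polyfun_const c)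
  show ?case by (intro exI[of _ "[:[:c:]:]"]) simp
next
  case (polyfun_add f g)
  then show ?case by (metis ev2_simps(1))
next
  case (polyfun_mult f g)
  then show ?case by (metis ev2_simps(2))
qed (use assms(2) in auto)

section \<open>Orders of roots\<close>

lemma order_linear_factor:
  fixes a b :: "'k::field"
  assumes "b \<noteq> 0"
  shows "order t [:a, b:] = (if a + b * t = 0 then 1 else 0)"
proof (cases "a + b * t = 0")
  case True
  then have "[:a, b:] = smult b [:- t, 1:]" using assms by (simp add: eq_neg_iff_add_eq_0 mult.commute)
  then have "order t [:a, b:] = order t [:- t, 1:]" using assms by (simp only: order_smult not_False_eq_True)
  also have "\<dots> = 1" using order_power_n_n[of t 1] by simp
  finally show ?thesis using True by simp
next
  case False
  then show ?thesis by (simp add: order_0I mult.commute)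
qed

lemma order_prod:
  fixes p :: "'i \<Rightarrow> 'k::field poly"
  assumes "finite I" "\<And>i. i \<in> I \<Longrightarrow> p i \<noteq> 0"
  shows "order t (\<Prod>i\<in>I. p i) = (\<Sum>i\<in>I. order t (p i))"
  using assms
proof (induction I rule: finite_induct)
  case (insert i I)
  have "(\<Prod>i\<in>I. p i) \<noteq> 0" using insert by (auto simp: prod_zero_iff)
  then show ?case using insert by (simp add: order_mult)
qed (simp add: order_0I)

lemma order_prod_linear:
  fixes \<alpha> \<beta> :: "'i \<Rightarrow> 'k::field"
  assumes "finite S" "\<And>b. b \<in> S \<Longrightarrow> \<beta> b \<noteq> 0"
  shows "order t (\<Prod>b\<in>S. [:\<alpha> b, \<beta> b:]) = card {b \<in> S. \<alpha> b + \<beta> b * t = 0}"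
proof -
  have "order t (\<Prod>b\<in>S. [:\<alpha> b, \<beta> b:]) = (\<Sum>b\<in>S. order t [:\<alpha> b, \<beta> b:])"
    using assms by (intro order_prod) auto
  also have "\<dots> = (\<Sum>b\<in>S. if \<alpha> b + \<beta> b * t = 0 then 1 else 0)"
    using assms(2) by (intro sum.cong) (simp_all add: order_linear_factor)
  also have "\<dots> = card {b \<in> S. \<alpha> b + \<beta> b * t = 0}"
    using assms(1) by (simp only: card_eq_sum sum.inter_filter)
  finally show ?thesis .
qed

text \<open>For \<open>p = l ^ Suc m * q\<close> the derivative is \<open>l ^ m\<close> times the
  sum of \<open>Suc m\<close> copies of \<open>q\<close> and a multiple of \<open>l\<close>. As
  \<open>Suc m\<close> is nonzero in the field, \<open>l\<close> does not divide this
  cofactor.\<close>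

lemma order_pderiv_char:
  fixes p :: "'k::field poly"
  assumes p0: "p \<noteq> 0" and n0: "of_nat (order t p) \<noteq> (0::'k)"
  shows "order t (pderiv p) = order t p - 1"
proof -
  define l where "l = [:- t, 1:]"
  have l': "pderiv l = 1" by (simp add: l_def pderiv_pCons)
  obtain m where m: "order t p = Suc m" using n0 by (cases "order t p") auto
  obtain q where q: "p = l ^ Suc m * q" "\<not> l dvd q"
    using order_decomp[OF p0, of t] unfolding m l_def by blast
  have eq: "pderiv p = l ^ m * (smult (of_nat (Suc m)) q + l * pderiv q)"
    unfolding q(1) pderiv_mult pderiv_power_Suc l'
    by (simp add: distrib_left mult_ac del: of_nat_Suc)
  have "of_nat (Suc m) \<noteq> (0::'k)" using n0 unfolding m .
  then have "\<not> l dvd smult (of_nat (Suc m)) q"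
    using q(2) by (simp add: dvd_smult_iff del: of_nat_Suc)
  then have nd: "\<not> l dvd smult (of_nat (Suc m)) q + l * pderiv q"
    by (metis dvd_add_left_iff dvd_triv_left)
  have "\<not> l * l ^ m dvd (smult (of_nat (Suc m)) q + l * pderiv q) * l ^ m"
  proof -
    have "l ^ m \<noteq> 0" by (simp add: l_def)
    then show ?thesis using nd by (metis dvd_mult_cancel_right)
  qed
  then have "\<not> l ^ Suc m dvd pderiv p" unfolding eq power_Suc mult.commute[of "l ^ m"] .
  moreover have "l ^ m dvd pderiv p" unfolding eq by simp
  ultimately have "order t (pderiv p) = m"
    unfolding l_def by (intro order_unique_lemma)
  then show ?thesis unfolding m by simp
qed

lemma sum_order_roots:
  fixes p :: "'k::alg_closed_field poly"
  assumes "p \<noteq> 0" "finite Z" "\<And>t. poly p t = 0 \<Longrightarrow> t \<in> Z"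
  shows "(\<Sum>t\<in>Z. order t p) = degree p"
  using assms
proof (induction "degree p" arbitrary: p)
  case 0
  then obtain c where "p = [:c:]" "c \<noteq> 0" by (metis degree_eq_zeroE pCons_eq_0_iff)
  then show ?case by (simp add: order_0I)
next
  case (Suc n)
  obtain x where x: "poly p x = 0" using alg_closed_imp_poly_has_root[of p] Suc.hyps(2) by auto
  define l where "l = [:- x, 1:]"
  obtain q where q: "p = l * q" using x unfolding l_def by (metis dvdE poly_eq_0_iff_dvd)
  have q0: "q \<noteq> 0" "l \<noteq> 0" "degree l = 1" using q Suc.prems(1) by (auto simp: l_def)
  have deg: "degree p = Suc (degree q)" unfolding q using q0 by (subst degree_mult_eq) auto
  have "(\<Sum>t\<in>Z. order t q) = degree q"
  proof (rule Suc.hyps(1))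
    show "t \<in> Z" if "poly q t = 0" for t using that Suc.prems(3)[of t] by (simp add: q)
  qed (use Suc.hyps(2) deg q0 Suc.prems in auto)
  moreover have "order t p = (if t = x then 1 else 0) + order t q" for t
  proof -
    have "order t p = order t l + order t q" unfolding q by (rule order_mult) (use q0 in simp)
    moreover have "order t l = (if t = x then 1 else 0)"
      unfolding l_def using order_linear_factor[of 1 t "- x"] by (auto simp: neg_eq_iff_add_eq_0)
    ultimately show ?thesis by simp
  qed
  moreover have "x \<in> Z" using Suc.prems(3) x by blast
  ultimately show ?case using deg Suc.prems(2) by (simp add: sum.distrib sum.delta)
qed

section \<open>The pencil of lines through a multiple point\<close>

lemma cramer:
  "dot (crs u v) p *s y = dot (crs v p) y *s u + dot (crs p u) y *s v + dot (crs u v) y *s p"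
  for u v p y :: "'k::field ^ 3"
  by (simp add: dot_def vec3_eq_iff algebra_simps)

lemma in_span_if_perp_crs:
  fixes u v y :: "'k::field ^ 3"
  assumes "crs u v \<noteq> 0" "dot (crs u v) y = 0"
  obtains c d where "y = c *s u + d *s v"
proof -
  obtain p where "dot (crs u v) p = 1" using exists_dot_eq_1[OF assms(1)] by blast
  then have "y = dot (crs v p) y *s u + dot (crs p u) y *s v"
    using cramer[of u v p y] assms(2) by simp
  then show ?thesis by (rule that)
qed

lemma const_poly_prod: "(\<Prod>i\<in>I. [:f i:]) = [:\<Prod>i\<in>I. f i:]"
  for f :: "'i \<Rightarrow> 'a::comm_ring_1"
  by (induction I rule: infinite_finite_induct) (simp_all add: one_pCons)

lemma ev2_smult [simp]: "ev2 (smult c P) x t = poly c x * ev2 P x t"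
  by (simp add: ev2_def)

text \<open>Affine coordinates on the chart \<open>dot (crs z w1) v = 1\<close>: \<open>x\<close>
  selects a line through \<open>z\<close>, and \<open>t\<close> moves along it. The line spanned by
  \<open>z\<close> and \<open>w1\<close> is at infinity, and \<open>transversal\<close> keeps it out
  of the arrangement, so a line \<open>a\<close> through \<open>z\<close> has the equation
  \<open>x = slope a\<close>.\<close>

locale pencil = arrangement A
  for A :: "('k::alg_closed_field ^ 3) set" +
  fixes z w0 w1 :: "'k ^ 3"
  assumes z_nonzero: "z \<noteq> 0" and z_multiple: "card (inc z) \<ge> 2"
    and transversal: "\<And>a. a \<in> inc z \<Longrightarrow> dot a w1 \<noteq> 0"
    and unimodular: "dot (crs z w1) w0 = 1"
begin

definition W :: "'k \<Rightarrow> 'k ^ 3" where "W x = w0 + x *s w1"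

definition V :: "'k \<Rightarrow> 'k \<Rightarrow> 'k ^ 3" where "V x t = W x + t *s z"

definition lf :: "'k ^ 3 \<Rightarrow> 'k poly poly" where
  "lf a = [:[:dot a w0, dot a w1:], [:dot a z:]:]"

definition slope :: "'k ^ 3 \<Rightarrow> 'k" where "slope a = - dot a w0 / dot a w1"

lemma ev2_lf: "ev2 (lf a) x t = dot a (V x t)"
  by (simp add: lf_def V_def W_def algebra_simps)

lemma dot_normal_V: "dot (crs z w1) (V x t) = 1" "dot (crs z w1) (W x) = 1"
  using unimodular by (simp_all add: V_def W_def)

lemma V_nonzero: "V x t \<noteq> 0"
  using dot_normal_V(1)[of x t] by auto

lemma crs_z_W: "crs z (W x) \<noteq> 0"
proof
  assume "crs z (W x) = 0"
  then obtain c where "W x = c *s z" using crs_eq_0_imp[OF _ z_nonzero] by blast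
  then show False using dot_normal_V(2)[of x] by simp
qed

lemma dot_slope:
  assumes "a \<in> inc z"
  shows "dot a (W x) = 0 \<longleftrightarrow> x = slope a" "dot a (V x t) = 0 \<longleftrightarrow> x = slope a"
proof -
  show *: "dot a (W x) = 0 \<longleftrightarrow> x = slope a"
    using transversal[OF assms] by (auto simp: W_def slope_def field_simps eq_neg_iff_add_eq_0)
  show "dot a (V x t) = 0 \<longleftrightarrow> x = slope a"
    using assms * by (simp add: V_def inc_def)
qed

lemma slope_inj:
  assumes "a \<in> inc z" "b \<in> inc z" "slope a = slope b"
  shows "a = b"
proof (rule ccontr)
  assume "a \<noteq> b"
  then have "crs a b \<noteq> 0" using assms nonparallel by (auto simp: inc_def)
  moreover have "dot a (W (slope a)) = 0" "dot b (W (slope a)) = 0" using dot_slope assms by auto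
  ultimately obtain c where c: "W (slope a) = c *s crs a b" using common_perp by blast
  have "dot a z = 0" "dot b z = 0" using assms by (auto simp: inc_def)
  then obtain d where "z = d *s crs a b" using common_perp[OF \<open>crs a b \<noteq> 0\<close>] by blast
  with c crs_z_W[of "slope a"] show False by simp
qed

lemma inc_V_inter:
  assumes "a \<in> inc z"
  shows "inc (V (slope a) t) \<inter> inc z = {a}"
  using assms dot_slope slope_inj by (auto simp: inc_def)

text \<open>The point \<open>z\<close> lies at infinity of the chart, so these parameters stand for
  the other multiple points of \<open>a\<close>.\<close>

definition multiples :: "'k ^ 3 \<Rightarrow> 'k set" where
  "multiples a = {t. card (inc (V (slope a) t)) \<ge> 2}"

lemma block_z: "inc z \<in> blocks"
  using z_nonzero z_multiple by (auto simp: blocks_def)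

lemma multiples_bij:
  assumes a: "a \<in> inc z"
  shows "bij_betw (\<lambda>t. inc (V (slope a) t)) (multiples a) (through a - {inc z})"
proof -
  let ?f = "\<lambda>t. inc (V (slope a) t)"
  have aV: "a \<in> ?f t" for t using inc_V_inter[OF a] by blast
  have aA: "a \<in> A" using a by (simp add: inc_def)
  show ?thesis
    unfolding bij_betw_def
  proof
    show "inj_on ?f (multiples a)"
    proof (rule inj_onI)
      fix t t' assume t: "t \<in> multiples a" "t' \<in> multiples a" "?f t = ?f t'"
      obtain b where b: "b \<in> ?f t" "b \<noteq> a"
        using t(1) by (metis (no_types, lifting) card_ge_2_obtain mem_Collect_eq multiples_def)
      then have "crs a b \<noteq> 0" using nonparallel[of a b] aA by (auto simp: inc_def)
      moreover have "dot a (V (slope a) t) = 0" "dot b (V (slope a) t) = 0"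
        "dot a (V (slope a) t') = 0" "dot b (V (slope a) t') = 0"
        using aV[of t] aV[of t'] b t(3) by (auto simp: inc_def)
      ultimately obtain c c' where c: "V (slope a) t = c *s crs a b" "V (slope a) t' = c' *s crs a b"
        using common_perp by metis
      have "c * dot (crs z w1) (crs a b) = 1" "c' * dot (crs z w1) (crs a b) = 1"
        using dot_normal_V(1)[of "slope a" t] dot_normal_V(1)[of "slope a" t'] unfolding c by simp_all
      then have "c = c'" by (metis mult_cancel_right mult_zero_right zero_neq_one)
      then have "W (slope a) + t *s z = W (slope a) + t' *s z" using c by (simp add: V_def)
      then have "t *s z = t' *s z" by (rule add_left_imp_eq)
      then have "(t - t') *s z = 0" by (simp add: vec.scale_left_diff_distrib)
      then show "t = t'" using z_nonzero by simp
    qed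
    show "?f ` multiples a = through a - {inc z}"
    proof (intro subset_antisym subsetI)
      fix T assume "T \<in> ?f ` multiples a"
      then obtain t where t: "T = ?f t" "card (?f t) \<ge> 2" by (auto simp: multiples_def)
      then have "T \<noteq> inc z" using inc_V_inter[OF a, of t] by auto
      with t aV V_nonzero show "T \<in> through a - {inc z}" by (auto simp: through_def blocks_def)
    next
      fix T assume T: "T \<in> through a - {inc z}"
      then obtain z' where z': "z' \<noteq> 0" "T = inc z'" "card (inc z') \<ge> 2"
        by (auto simp: through_def elim: blockE)
      have a0: "dot a z = 0" "dot a (W (slope a)) = 0" "dot a z' = 0"
        using a dot_slope(1)[OF a] T z' by (auto simp: inc_def through_def)
      obtain c where c: "a = c *s crs z (W (slope a))"
        using common_perp[OF crs_z_W, of a "slope a"] a0 by (auto simp: dot_commute)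
      have "c \<noteq> 0" using c aA nonzero by auto
      then have "dot (crs z (W (slope a))) z' = 0" using a0(3) by (subst (asm) c) simp
      then obtain r s where rs: "z' = r *s z + s *s W (slope a)"
        by (rule in_span_if_perp_crs[OF crs_z_W])
      have "s \<noteq> 0"
      proof
        assume "s = 0"
        then have "z' = r *s z" "r \<noteq> 0" using rs z'(1) by auto
        then show False using T z'(2) inc_scale by simp
      qed
      then have "z' = s *s V (slope a) (r / s)" using rs by (simp add: V_def vec.scale_right_distrib add.commute)
      then have "T = ?f (r / s)" using inc_scale[OF \<open>s \<noteq> 0\<close>] z'(2) by simp
      then show "T \<in> ?f ` multiples a" using z' by (auto simp: multiples_def)
    qed
  qed
qed

lemma finite_multiples: "a \<in> inc z \<Longrightarrow> finite (multiples a)"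
  using bij_betw_finite[OF multiples_bij] by simp

lemma card_multiples:
  assumes "a \<in> inc z"
  shows "card (multiples a) = card (through a) - 1"
proof -
  have "inc z \<in> through a" using assms block_z by (simp add: through_def)
  then show ?thesis using bij_betw_same_card[OF multiples_bij[OF assms]] by simp
qed

text \<open>Each line off \<open>z\<close> meets \<open>a\<close> in exactly one point, which is
  different from \<open>z\<close>.\<close>

lemma sum_multiples:
  assumes a: "a \<in> inc z"
  shows "(\<Sum>t\<in>multiples a. card (inc (V (slope a) t)) - 1) = card (A - inc z)"
proof -
  have aA: "a \<in> A" using a by (simp add: inc_def)
  have T: "inc z \<in> through a" using a block_z by (simp add: through_def)
  have "card (A - {a}) = (\<Sum>T\<in>through a. card (T - {a}))"
    using sum_over_line[OF aA, of "\<lambda>_. 1::nat"] by simp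
  also have "\<dots> = (\<Sum>T\<in>through a. card T - 1)" by (intro sum.cong) (auto simp: through_def)
  also have "\<dots> = (card (inc z) - 1) + (\<Sum>T\<in>through a - {inc z}. card T - 1)"
    using T by (simp add: sum.remove)
  also have "(\<Sum>T\<in>through a - {inc z}. card T - 1) = (\<Sum>t\<in>multiples a. card (inc (V (slope a) t)) - 1)"
    by (rule sum.reindex_bij_betw[OF multiples_bij[OF a], symmetric])
  finally have "card A - 1 = (card (inc z) - 1) + (\<Sum>t\<in>multiples a. card (inc (V (slope a) t)) - 1)"
    using aA finite by simp
  moreover have "card (A - inc z) = card A - card (inc z)" using inc_subset by (simp add: card_Diff_subset)
  ultimately show ?thesis using z_multiple by linarith
qed

text \<open>Lines through \<open>z\<close> do not involve \<open>t\<close>. Hence the polar curve of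
  \<open>z\<close> consists of these lines and the curve \<open>pderiv G = 0\<close>, whose
  components are the ones to be counted.\<close>

definition G :: "'k poly poly" where "G = (\<Prod>a\<in>A - inc z. lf a)"

lemma lf_off: "a \<in> A - inc z \<Longrightarrow> dot a z \<noteq> 0"
  by (auto simp: inc_def)

lemma degree_lf: "dot a z \<noteq> 0 \<Longrightarrow> degree (lf a) = 1" "dot a z \<noteq> 0 \<Longrightarrow> lead_coeff (lf a) = [:dot a z:]"
  by (simp_all add: lf_def)

lemma degree_G: "degree G = card (A - inc z)"
proof -
  have "degree G = (\<Sum>a\<in>A - inc z. degree (lf a))"
    unfolding G_def by (rule degree_prod_sum_eq) (use lf_off in \<open>auto simp: lf_def\<close>)
  also have "\<dots> = card (A - inc z)" using lf_off by (simp add: degree_lf)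
  finally show ?thesis .
qed

lemma lead_coeff_G: "lead_coeff G = [:\<Prod>a\<in>A - inc z. dot a z:]"
proof -
  have "lead_coeff G = (\<Prod>a\<in>A - inc z. [:dot a z:])"
    unfolding G_def lead_coeff_prod by (rule prod.cong) (use lf_off degree_lf in auto)
  also have "\<dots> = [:\<Prod>a\<in>A - inc z. dot a z:]" by (rule const_poly_prod)
  finally show ?thesis .
qed

lemma pderiv_prod_lf: "ev2 (pderiv (\<Prod>a\<in>S. lf a)) x t = dot z (gr S (V x t))"
proof -
  have "pderiv (lf a) = [:[:dot a z:]:]" for a by (simp add: lf_def pderiv_pCons)
  then show ?thesis
    unfolding pderiv_prod dot_gr by (simp add: ev2_lf pr_def dot_commute[of z] mult.commute)
qed

text \<open>Differentiation in the direction \<open>P\<close> annihilates the linear forms vanishing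
  at \<open>P\<close>, which therefore split off as factors.\<close>

lemma dot_gr_point:
  assumes "P \<noteq> 0"
  shows "dot P (gr A v) = pr (inc P) v * dot P (gr (A - inc P) v)"
proof -
  have "dot P (gr (inc P) v) = 0"
    unfolding dot_gr by (intro sum.neutral) (auto simp: inc_def dot_commute)
  moreover have "A = inc P \<union> (A - inc P)" using inc_subset by auto
  ultimately show ?thesis using gr_Un[of "inc P" "A - inc P" v] finite by simp
qed

lemma ev2_polyfun_V:
  assumes "polyfun q"
  shows "\<exists>P. \<forall>x t. ev2 P x t = q (V x t)"
proof (rule polyfun_ev2[OF assms])
  fix i :: 3
  show "\<exists>P. \<forall>x t. ev2 P x t = V x t $ i"
    by (rule exI[of _ "[:[:w0 $ i, w1 $ i:], [:z $ i:]:]"]) (simp add: V_def W_def)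
qed

text \<open>If the leading coefficient in \<open>t\<close> is a nonzero constant, that of every
  factor is a unit. So no prime factor is free of \<open>t\<close>, and specializing
  \<open>x\<close> never lowers its degree.\<close>

lemma prime_degree_pos:
  fixes C P :: "'k poly poly"
  assumes "prime_elem C" "C dvd P" "lead_coeff P = [:c:]" "c \<noteq> 0"
  shows "degree C > 0" "poly (lead_coeff C) x \<noteq> 0"
proof -
  obtain D where D: "P = C * D" using assms(2) by (elim dvdE)
  have "[:c:] = lead_coeff C * lead_coeff D" using assms(3) unfolding D lead_coeff_mult by simp
  then have "lead_coeff C dvd [:c:]" by simp
  moreover have "[:c:] dvd 1" using assms(4) by (simp add: is_unit_poly_iff dvd_field_iff)
  ultimately have u: "lead_coeff C dvd 1" by (rule dvd_trans)
  then obtain d where d: "lead_coeff C = [:d:]" "d dvd 1" by (auto simp: is_unit_poly_iff)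
  then show "poly (lead_coeff C) x \<noteq> 0" by auto
  show "degree C > 0"
  proof (rule ccontr)
    assume "\<not> degree C > 0"
    then obtain k where k: "C = [:k:]" by (auto elim: degree_eq_zeroE)
    then have "C dvd 1" using u by (simp add: is_unit_poly_iff)
    then show False using assms(1) by (auto dest: prime_elem_not_unit)
  qed
qed

lemma not_dvd_degree_0:
  fixes C :: "'k poly poly"
  assumes "degree C > 0" "C dvd [:p:]"
  shows "p = 0"
proof (rule ccontr)
  assume "p \<noteq> 0"
  then have "degree C \<le> degree [:p:]" by (intro dvd_imp_degree_le[OF assms(2)]) simp
  with assms(1) show False by simp
qed

lemma eq_zero_if_dots:
  assumes "dot c z = 0" "dot c w0 = 0" "dot c w1 = 0"
  shows "c = 0"
proof (rule perp_three_eq_0[of w0 z w1])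
  show "dot w0 (crs z w1) \<noteq> 0" using unimodular by (simp add: dot_commute)
qed (use assms in \<open>simp_all add: dot_commute\<close>)

end

section \<open>Components of the polar curve of a multiple point\<close>

lemma prime_elem_dvd_prod:
  assumes "prime_elem C" "finite S" "C dvd (\<Prod>s\<in>S. f s)"
  shows "\<exists>s\<in>S. C dvd f s"
  using assms(2,3)
proof (induction S rule: finite_induct)
  case empty
  then show ?case using assms(1) by (auto dest: prime_elem_not_unit)
next
  case (insert s S)
  then show ?case using assms(1) by (auto simp: prime_elem_dvd_mult_iff)
qed

lemma prime_elem_dvd_prod_list_map:
  assumes "prime_elem C" "C dvd (\<Prod>s\<leftarrow>S. f s)"
  shows "\<exists>s\<in>set S. C dvd f s"
  using assms(2)
proof (induction S)
  case Nil
  then show ?case using assms(1) by (auto dest: prime_elem_not_unit)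
next
  case (Cons s S)
  then show ?case using assms(1) by (auto simp: prime_elem_dvd_mult_iff)
qed

text \<open>The form \<open>crs z w1\<close> is 1 on the chart, so \<open>contraction\<close> says
  that the polar of \<open>z\<close> divides a product of polars of the \<open>y\<close>s. By
  \<open>ys_off\<close> the lines \<open>crs z y\<close> have finite slope. The numerical conditions
  make Euler's relation effective for the whole arrangement and for the lines off a multiple point,
  and fix the orders of the derivative.\<close>

locale polar_pencil = polar_inverse A Q e + pencil A z w0 w1
  for A :: "('k::alg_closed_field ^ 3) set" and Q e z w0 w1 +
  fixes ys :: "('k ^ 3) list"
  assumes ys_off: "\<And>y. y \<in> set ys \<Longrightarrow> dot (crs z y) w1 \<noteq> 0"
    and contraction: "\<exists>X. polyfun X \<and>
      (\<forall>v. dot z (gr A v) * X v = dot (crs z w1) v * (\<Prod>y\<leftarrow>ys. dot y (gr A v)))"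
    and card_nz: "of_nat (card A) \<noteq> (0::'k)"
    and card_off_nz: "\<And>T. T \<in> blocks \<Longrightarrow> of_nat (card (A - T)) \<noteq> (0::'k)"
    and card_block_nz: "\<And>T. T \<in> blocks \<Longrightarrow> of_nat (card T - 1) \<noteq> (0::'k)"
begin

lemma lead_coeff_pderiv_G:
  obtains c where "lead_coeff (pderiv G) = [:c:]" "c \<noteq> 0" "degree (pderiv G) = card (A - inc z) - 1"
proof -
  have nz: "of_nat (card (A - inc z)) \<noteq> (0::'k)" using card_off_nz block_z by blast
  then obtain m where m: "card (A - inc z) = Suc m" by (cases "card (A - inc z)") auto
  let ?c = "of_nat (Suc m) * (\<Prod>a\<in>A - inc z. dot a z)"
  have "coeff (pderiv G) m = of_nat (Suc m) * lead_coeff G"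
    by (simp add: coeff_pderiv degree_G m)
  also have "\<dots> = [:?c:]" unfolding lead_coeff_G by (simp add: of_nat_poly)
  finally have c: "coeff (pderiv G) m = [:?c:]" .
  have c0: "?c \<noteq> 0" using nz lf_off finite unfolding m by simp
  have "degree (pderiv G) \<le> m"
    by (rule degree_le) (simp add: coeff_pderiv coeff_eq_0 degree_G m del: of_nat_Suc)
  moreover have "m \<le> degree (pderiv G)" using c c0 by (intro le_degree) simp
  ultimately have "degree (pderiv G) = m" by simp
  with c c0 m show ?thesis by (intro that[of ?c]) auto
qed

text \<open>The component \<open>C\<close> is contracted to a line N through \<open>z\<close>, a
  point of the dual plane. By Euler's relation \<open>C\<close> meets N only in simple points of the
  arrangement. At a simple point the gradient is a nonzero multiple of the unique line there, so
  that line is N; this produces \<open>a\<close>. A simple point of \<open>C\<close> on another line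
  through \<open>z\<close> would make that line equal to N as well.\<close>

lemma prime_factor_line:
  fixes C :: "'k poly poly"
  assumes C: "prime_elem C" "C dvd pderiv G"
  obtains a where "a \<in> inc z" "\<And>t. ev2 C (slope a) t = 0 \<Longrightarrow> t \<notin> multiples a"
    "\<And>a' t. a' \<in> inc z \<Longrightarrow> a' \<noteq> a \<Longrightarrow> ev2 C (slope a') t = 0 \<Longrightarrow> t \<in> multiples a'"
proof -
  obtain c where c: "lead_coeff (pderiv G) = [:c:]" "c \<noteq> 0" by (rule lead_coeff_pderiv_G)
  have deg: "degree C > 0" and lead: "\<And>x. poly (lead_coeff C) x \<noteq> 0"
    using prime_degree_pos[OF C c] by auto
  have "\<forall>y. \<exists>D. \<forall>x t. ev2 D x t = dot y (gr A (V x t))"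
    by (intro allI ev2_polyfun_V) (rule polyfun_dot_gr)
  then obtain D where D: "\<And>y x t. ev2 (D y) x t = dot y (gr A (V x t))" by metis
  have D_lin: "D (r *s u + s *s v) = [:[:r:]:] * D u + [:[:s:]:] * D v" for r s u v
    by (rule ev2_inject) (simp add: D)
  have D_point: "D P = (\<Prod>a\<in>inc P. lf a) * E" if "P \<noteq> 0" "\<And>x t. ev2 E x t = dot P (gr (A - inc P) (V x t))" for P E
    by (rule ev2_inject) (simp add: D dot_gr_point[OF that(1)] that(2) ev2_lf pr_def)
  have "D z = (\<Prod>a\<in>inc z. lf a) * pderiv G"
    by (rule D_point[OF z_nonzero]) (simp add: G_def pderiv_prod_lf)
  then have CDz: "C dvd D z" using C(2) by simp
  obtain X where X: "polyfun X"
    "\<And>v. dot z (gr A v) * X v = dot (crs z w1) v * (\<Prod>y\<leftarrow>ys. dot y (gr A v))"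
    using contraction by blast
  obtain X' where X': "\<And>x t. ev2 X' x t = X (V x t)" using ev2_polyfun_V[OF X(1)] by blast
  have "D z * X' = (\<Prod>y\<leftarrow>ys. D y)"
    by (rule ev2_inject) (simp add: D X' X(2) ev2_prod_list dot_normal_V)
  then have "C dvd (\<Prod>y\<leftarrow>ys. D y)" using CDz by (metis dvd_mult2)
  then obtain y where y: "y \<in> set ys" "C dvd D y" using prime_elem_dvd_prod_list_map[OF C(1)] by blast
  \<comment> \<open>The slope of the line \<open>crs z y\<close>. Along \<open>C\<close> the
    gradient is orthogonal to both \<open>z\<close> and \<open>y\<close>, hence a multiple of
    \<open>crs z y\<close>.\<close>
  define xN where "xN = - dot (crs z y) w0 / dot (crs z y) w1"
  have zy: "crs z y \<noteq> 0" using ys_off[OF y(1)] by auto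
  have "dot (crs z y) (W xN) = 0" using ys_off[OF y(1)] by (simp add: W_def xN_def)
  then obtain r s where "W xN = r *s z + s *s y" by (rule in_span_if_perp_crs[OF zy])
  then have CDW: "C dvd D (W xN)" using CDz y(2) by (simp only: D_lin dvd_add dvd_mult)
  have CD: "C dvd D (V xN t)" for t
  proof -
    have "V xN t = 1 *s W xN + t *s z" by (simp add: V_def)
    then show ?thesis using CDz CDW by (simp only: D_lin dvd_add dvd_mult)
  qed
  have zero: "dot z (gr A (V x t)) = 0" "dot (W xN) (gr A (V x t)) = 0" if "ev2 C x t = 0" for x t
    using ev2_dvd[OF CDz that] ev2_dvd[OF CDW that] by (simp_all add: D)
  \<comment> \<open>If \<open>C\<close> divided a line off \<open>z\<close>, the product rule for
    \<open>D z\<close> would make it divide a second line. Eliminating \<open>t\<close> between the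
    two leaves a polynomial in \<open>x\<close> alone, which must vanish and would make the lines
    proportional.\<close>
  have not_lf: "\<not> C dvd lf a" if a: "a \<in> A" for a
  proof (cases "a \<in> inc z")
    case True
    have "lf a = [:[:dot a w0, dot a w1:]:]" using True by (simp add: lf_def inc_def)
    moreover have "[:dot a w0, dot a w1:] \<noteq> 0" using transversal[OF True] by simp
    ultimately show ?thesis using not_dvd_degree_0[OF deg] by metis
  next
    case False
    then have az: "dot a z \<noteq> 0" using a by (simp add: inc_def)
    show ?thesis
    proof
      assume Ca: "C dvd lf a"
      have "\<exists>E. \<forall>x t. ev2 E x t = dot z (gr (A - {a}) (V x t))"
        by (rule ev2_polyfun_V) (rule polyfun_dot_gr)
      then obtain E where E: "\<And>x t. ev2 E x t = dot z (gr (A - {a}) (V x t))" by blast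
      have "D z = [:[:dot a z:]:] * (\<Prod>b\<in>A-{a}. lf b) + lf a * E"
      proof (rule ev2_inject)
        fix x t
        have "gr A (V x t) = pr (A - {a}) (V x t) *s a + dot a (V x t) *s gr (A - {a}) (V x t)"
          using gr_Un[of "{a}" "A - {a}" "V x t"] a finite by (simp add: insert_absorb gr_def pr_def)
        then show "ev2 (D z) x t = ev2 ([:[:dot a z:]:] * (\<Prod>b\<in>A-{a}. lf b) + lf a * E) x t"
          by (simp add: D E ev2_lf pr_def dot_commute[of z] mult.commute)
      qed
      then have "C dvd [:[:dot a z:]:] * (\<Prod>b\<in>A-{a}. lf b)"
        using CDz Ca by (simp add: dvd_add_left_iff)
      moreover have "\<not> C dvd [:[:dot a z:]:]"
        using not_dvd_degree_0[OF deg, of "[:dot a z:]"] az by auto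
      ultimately have "C dvd (\<Prod>b\<in>A-{a}. lf b)" using prime_elem_dvd_mult_iff[OF C(1)] by blast
      then obtain b where b: "b \<in> A" "b \<noteq> a" "C dvd lf b"
        using prime_elem_dvd_prod[OF C(1)] finite by blast
      define g where "g = dot b z *s a - dot a z *s b"
      have "C dvd [:[:dot b z:]:] * lf a - [:[:dot a z:]:] * lf b"
        using Ca b(3) by (intro dvd_diff dvd_mult)
      also have "[:[:dot b z:]:] * lf a - [:[:dot a z:]:] * lf b = [:[:dot g w0, dot g w1:]:]"
        by (rule ev2_inject) (simp add: ev2_lf g_def V_def W_def algebra_simps)
      finally have "[:dot g w0, dot g w1:] = 0" by (rule not_dvd_degree_0[OF deg])
      then have "dot g w0 = 0" "dot g w1 = 0" by simp_all
      moreover have "dot g z = 0" by (simp add: g_def)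
      ultimately have "g = 0" by (intro eq_zero_if_dots)
      then have "crs a g = 0" by simp
      then have "dot a z *s crs a b = 0" by (simp add: g_def)
      with az nonparallel[of a b] a b show False by simp
    qed
  qed
  \<comment> \<open>Euler's relation is used twice. In degree \<open>card A\<close> it puts the
    point on the arrangement. If the point were multiple, the lines through it could be cancelled
    from \<open>D ?P\<close>, and Euler's relation in degree \<open>card (A - inc ?P)\<close> would
    contradict the vanishing of the remaining factor.\<close>
  have simple: "inc (V xN t) \<noteq> {} \<and> card (inc (V xN t)) < 2" if Ct: "ev2 C xN t = 0" for t
  proof
    let ?P = "V xN t"
    have "dot ?P (gr A ?P) = 0" using ev2_dvd[OF CD Ct] by (simp add: D)
    then have "pr A ?P = 0" using euler[OF finite] card_nz by simp
    then show "inc ?P \<noteq> {}" using finite by (auto simp: pr_eq_0_iff inc_def)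
    show "card (inc ?P) < 2"
    proof (rule ccontr)
      assume "\<not> card (inc ?P) < 2"
      then have block: "inc ?P \<in> blocks" using V_nonzero by (auto simp: blocks_def)
      have "\<exists>E. \<forall>x t. ev2 E x t = dot ?P (gr (A - inc ?P) (V x t))"
        by (rule ev2_polyfun_V) (rule polyfun_dot_gr)
      then obtain E where E: "\<And>x t. ev2 E x t = dot ?P (gr (A - inc ?P) (V x t))" by blast
      have "C dvd (\<Prod>a\<in>inc ?P. lf a) * E" using CD[of t] unfolding D_point[OF V_nonzero E] .
      moreover have "\<not> C dvd (\<Prod>a\<in>inc ?P. lf a)"
        using prime_elem_dvd_prod[OF C(1), of "inc ?P" lf] not_lf inc_subset by auto
      ultimately have "C dvd E" using prime_elem_dvd_mult_iff[OF C(1)] by blast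
      from ev2_dvd[OF this Ct] have "dot ?P (gr (A - inc ?P) ?P) = 0" unfolding E .
      then show False
        using euler[of "A - inc ?P" ?P] finite card_off_nz[OF block] pr_off_point by simp
    qed
  qed
  have singleton: "pr (A - {a}) (V x t) \<noteq> 0 \<and> gr A (V x t) = pr (A - {a}) (V x t) *s a"
    if "inc (V x t) = {a}" for a x t
  proof
    have a: "a \<in> A" "dot a (V x t) = 0" using that by (auto simp: inc_def)
    show "pr (A - {a}) (V x t) \<noteq> 0" using that finite by (auto simp: pr_eq_0_iff inc_def)
    show "gr A (V x t) = pr (A - {a}) (V x t) *s a" by (rule gr_on_line[OF finite a])
  qed
  have perp: "dot a z = 0 \<and> dot a (W xN) = 0" if "inc (V x t) = {a}" "ev2 C x t = 0" for a x t
    using zero[OF that(2)] singleton[OF that(1)] by (auto simp: dot_commute)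
  have single: "\<exists>a. inc P = {a}" if "inc P \<noteq> {}" "card (inc P) < 2" for P
  proof -
    have "card (inc P) = 1" using that by (metis One_nat_def card_gt_0_iff finite_inc less_2_cases_iff nat_neq_iff)
    then show ?thesis by (simp add: card_1_singleton_iff)
  qed
  have "degree (spec xN C) > 0" using degree_spec[OF lead] deg by simp
  then obtain t0 where t0: "ev2 C xN t0 = 0"
    using alg_closed_imp_poly_has_root[of "spec xN C"] by (auto simp: poly_spec)
  obtain a where a: "inc (V xN t0) = {a}" using single simple[OF t0] by blast
  have az: "a \<in> inc z" using perp[OF a t0] a by (auto simp: inc_def)
  have slope: "slope a = xN" using dot_slope(1)[OF az] perp[OF a t0] by simp
  show ?thesis
  proof (rule that[OF az])
    fix t assume "ev2 C (slope a) t = 0"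
    then show "t \<notin> multiples a" using simple[of t] slope by (auto simp: multiples_def)
  next
    fix a' t assume a': "a' \<in> inc z" "a' \<noteq> a" "ev2 C (slope a') t = 0"
    show "t \<in> multiples a'"
    proof (rule ccontr)
      assume "t \<notin> multiples a'"
      moreover have mem: "a' \<in> inc (V (slope a') t)" using inc_V_inter[OF a'(1)] by blast
      ultimately obtain x where "inc (V (slope a') t) = {x}"
        using single[of "V (slope a') t"] by (auto simp: multiples_def not_le)
      with mem have "inc (V (slope a') t) = {a'}" by (metis singletonD)
      from perp[OF this a'(3)] have "slope a' = xN" using dot_slope(1)[OF a'(1)] by simp
      then show False using slope_inj[OF a'(1) az] slope a'(2) by simp
    qed
  qed
qed

text \<open>On \<open>a\<close>, the polynomial \<open>G\<close> has a root of order m - 1 at a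
  point of multiplicity m, since \<open>a\<close> itself is no factor of \<open>G\<close>. As m - 1
  is nonzero in the field, differentiation lowers the order by exactly one.\<close>

lemma order_spec_pderiv_G:
  assumes a: "a \<in> inc z" and t: "t \<in> multiples a"
  shows "order t (spec (slope a) (pderiv G)) = card (inc (V (slope a) t)) - 2"
proof -
  let ?P = "V (slope a) t"
  have eq: "spec (slope a) G = (\<Prod>b\<in>A - inc z. [:dot b (W (slope a)), dot b z:])"
    by (rule poly_eqI_fun) (simp add: poly_spec G_def ev2_lf poly_prod V_def mult.commute)
  have nz: "spec (slope a) G \<noteq> 0" unfolding eq using finite lf_off by (auto simp: prod_zero_iff)
  have "order t (spec (slope a) G) = card {b \<in> A - inc z. dot b (W (slope a)) + dot b z * t = 0}"
    unfolding eq by (rule order_prod_linear) (use finite lf_off in auto)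
  also have "{b \<in> A - inc z. dot b (W (slope a)) + dot b z * t = 0} = inc ?P - {a}"
    using inc_V_inter[OF a, of t] by (auto simp: inc_def V_def mult.commute)
  also have "card (inc ?P - {a}) = card (inc ?P) - 1"
    using inc_V_inter[OF a, of t] by (intro card_Diff_singleton) auto
  finally have ord: "order t (spec (slope a) G) = card (inc ?P) - 1" .
  have "inc ?P \<in> blocks" using t V_nonzero by (auto simp: multiples_def blocks_def)
  then have "of_nat (order t (spec (slope a) G)) \<noteq> (0::'k)" unfolding ord by (rule card_block_nz)
  then show ?thesis
    using order_pderiv_char[OF nz] ord by (simp add: spec_simps)
qed

text \<open>Each component is assigned to one line through \<open>z\<close> by
  \<open>prime_factor_line\<close>. Counting zeros on a line \<open>a\<close> gives the number of
  its multiple points other than \<open>z\<close> as one more than the total degree of the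
  components assigned to \<open>a\<close>. Summing over the lines through \<open>z\<close> uses each
  component once.\<close>

lemma count_pencil: "(\<Sum>a\<in>inc z. card (through a) - 1) = card A - 1"
proof -
  obtain c where c: "lead_coeff (pderiv G) = [:c:]" "c \<noteq> 0"
    and deg: "degree (pderiv G) = card (A - inc z) - 1" by (rule lead_coeff_pderiv_G)
  have G0: "pderiv G \<noteq> 0" using c by auto
  obtain n :: nat and C u where C: "\<And>i. i < n \<Longrightarrow> prime_elem (C i)" and u: "u dvd 1"
    and eq: "pderiv G = u * (\<Prod>i<n. C i)"
    by (rule prime_factors_bivariate[OF G0]) (rule that)
  have dvd: "C i dvd pderiv G" if "i < n" for i
    unfolding eq using that by (intro dvd_mult dvd_prodI) auto
  have lead: "poly (lead_coeff (C i)) x \<noteq> 0" if "i < n" for i x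
    by (rule prime_degree_pos(2)[OF C[OF that] dvd[OF that] c])
  have spec_nz: "spec x (C i) \<noteq> 0" if "i < n" for i x
    using degree_spec[OF lead[OF that, of x]] prime_degree_pos(1)[OF C[OF that] dvd[OF that] c] by auto
  have "\<exists>a. a \<in> inc z \<and> (\<forall>t. ev2 (C i) (slope a) t = 0 \<longrightarrow> t \<notin> multiples a) \<and>
      (\<forall>a' t. a' \<in> inc z \<longrightarrow> a' \<noteq> a \<longrightarrow> ev2 (C i) (slope a') t = 0 \<longrightarrow> t \<in> multiples a')" if i: "i < n" for i
    by (rule prime_factor_line[OF C[OF i] dvd[OF i]]) blast
  then obtain \<alpha> where \<alpha>: "\<And>i. i < n \<Longrightarrow> \<alpha> i \<in> inc z"
    "\<And>i t. i < n \<Longrightarrow> ev2 (C i) (slope (\<alpha> i)) t = 0 \<Longrightarrow> t \<notin> multiples (\<alpha> i)"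
    "\<And>i a' t. i < n \<Longrightarrow> a' \<in> inc z \<Longrightarrow> a' \<noteq> \<alpha> i \<Longrightarrow> ev2 (C i) (slope a') t = 0 \<Longrightarrow> t \<in> multiples a'"
    by metis
  obtain d where d: "u = [:[:d:]:]" "d dvd 1" using u by (auto simp: is_unit_poly_iff)
  then have d0: "d \<noteq> 0" by auto
  have degC: "(\<Sum>i<n. degree (C i)) = card (A - inc z) - 1"
  proof -
    have "C i \<noteq> 0" if "i < n" for i using C[OF that] by auto
    then have "degree (pderiv G) = degree (\<Prod>i<n. C i)"
      unfolding eq d(1) using d0 by simp
    also have "\<dots> = (\<Sum>i<n. degree (C i))"
      using \<open>\<And>i. i < n \<Longrightarrow> C i \<noteq> 0\<close> by (intro degree_prod_sum_eq) auto
    finally show ?thesis using deg by simp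
  qed
  \<comment> \<open>At the multiple points of \<open>a\<close> the orders m - 2 of
    \<open>pderiv G\<close> add up to the degrees of the components not assigned to
    \<open>a\<close>: these meet \<open>a\<close> only there, while the others avoid those points.
    Subtracting this from the sum of the m - 1, which is \<open>card (A - inc z)\<close>, leaves the
    number of points.\<close>
  have key: "(\<Sum>i\<in>{i. i < n \<and> \<alpha> i = a}. degree (C i)) + 1 = card (multiples a)" if a: "a \<in> inc z" for a
  proof -
    let ?Z = "multiples a" and ?x = "slope a"
    have fin: "finite ?Z" by (rule finite_multiples[OF a])
    have "spec ?x (pderiv G) = smult d (\<Prod>i<n. spec ?x (C i))"
      unfolding eq d(1) spec_simps by (rule poly_eqI_fun) (simp add: poly_spec poly_prod)
    then have ord: "order t (spec ?x (pderiv G)) = (\<Sum>i<n. order t (spec ?x (C i)))" for t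
      using d0 spec_nz order_prod[of "{..<n}" "\<lambda>i. spec ?x (C i)" t] by (simp add: order_smult)
    have "(\<Sum>t\<in>?Z. card (inc (V ?x t)) - 2) = (\<Sum>t\<in>?Z. \<Sum>i<n. order t (spec ?x (C i)))"
      using order_spec_pderiv_G[OF a] by (simp add: ord)
    also have "\<dots> = (\<Sum>i<n. \<Sum>t\<in>?Z. order t (spec ?x (C i)))" by (rule sum.swap)
    also have "\<dots> = (\<Sum>i<n. if \<alpha> i = a then 0 else degree (C i))"
    proof (rule sum.cong)
      fix i assume "i \<in> {..<n}"
      then have i: "i < n" by simp
      show "(\<Sum>t\<in>?Z. order t (spec ?x (C i))) = (if \<alpha> i = a then 0 else degree (C i))"
      proof (cases "\<alpha> i = a")
        case True
        have "order t (spec ?x (C i)) = 0" if "t \<in> ?Z" for t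
          by (rule order_0I) (use \<alpha>(2)[OF i, of t] that True in \<open>auto simp: poly_spec\<close>)
        then show ?thesis using True by simp
      next
        case False
        have "(\<Sum>t\<in>?Z. order t (spec ?x (C i))) = degree (spec ?x (C i))"
          by (rule sum_order_roots[OF spec_nz[OF i] fin])
            (use \<alpha>(3)[OF i a] False in \<open>auto simp: poly_spec\<close>)
        with False show ?thesis using degree_spec[OF lead[OF i]] by simp
      qed
    qed simp
    finally have 1: "(\<Sum>t\<in>?Z. card (inc (V ?x t)) - 2) = (\<Sum>i<n. if \<alpha> i = a then 0 else degree (C i))" .
    have "(\<Sum>t\<in>?Z. card (inc (V ?x t)) - 1) = (\<Sum>t\<in>?Z. (card (inc (V ?x t)) - 2) + 1)"
      by (rule sum.cong) (auto simp: multiples_def)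
    also have "\<dots> = (\<Sum>t\<in>?Z. card (inc (V ?x t)) - 2) + card ?Z" by (simp only: sum.distrib card_eq_sum)
    finally have 2: "(\<Sum>t\<in>?Z. card (inc (V ?x t)) - 2) + card ?Z = card (A - inc z)"
      using sum_multiples[OF a] by simp
    have "(\<Sum>i<n. degree (C i)) = (\<Sum>i<n. if \<alpha> i = a then degree (C i) else 0) + (\<Sum>i<n. if \<alpha> i = a then 0 else degree (C i))"
      unfolding sum.distrib[symmetric] by (rule sum.cong) auto
    moreover have "(\<Sum>i<n. if \<alpha> i = a then degree (C i) else 0) = (\<Sum>i\<in>{i. i < n \<and> \<alpha> i = a}. degree (C i))"
      using sum.inter_filter[of "{..<n}" "\<lambda>i. degree (C i)" "\<lambda>i. \<alpha> i = a"] by simp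
    moreover have "card (A - inc z) > 0" using card_off_nz[OF block_z] by (cases "card (A - inc z)") auto
    ultimately show ?thesis using 1 2 degC by linarith
  qed
  have "(\<Sum>a\<in>inc z. card (through a) - 1) = (\<Sum>a\<in>inc z. (\<Sum>i\<in>{i. i < n \<and> \<alpha> i = a}. degree (C i)) + 1)"
  proof (rule sum.cong)
    fix a assume a: "a \<in> inc z"
    show "card (through a) - 1 = (\<Sum>i\<in>{i. i < n \<and> \<alpha> i = a}. degree (C i)) + 1"
      unfolding key[OF a] card_multiples[OF a] ..
  qed simp
  also have "\<dots> = (\<Sum>a\<in>inc z. \<Sum>i\<in>{i \<in> {..<n}. \<alpha> i = a}. degree (C i)) + card (inc z)"
    by (simp only: sum.distrib card_eq_sum lessThan_iff)
  also have "(\<Sum>a\<in>inc z. \<Sum>i\<in>{i \<in> {..<n}. \<alpha> i = a}. degree (C i)) = (\<Sum>i<n. degree (C i))"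
    by (rule sum.group) (use \<alpha>(1) in auto)
  finally have "(\<Sum>a\<in>inc z. card (through a) - 1) = card (A - inc z) - 1 + card (inc z)"
    using degC by simp
  moreover have "card (A - inc z) > 0" using card_off_nz[OF block_z] by (cases "card (A - inc z)") auto
  moreover have "card (A - inc z) = card A - card (inc z)" using inc_subset by (simp add: card_Diff_subset)
  ultimately show ?thesis by linarith
qed

end

context polar_inverse
begin

lemma block_count:
  assumes H: "of_nat (card A) \<noteq> (0::'k)"
    "\<And>T. T \<in> blocks \<Longrightarrow> of_nat (card (A - T)) \<noteq> (0::'k)"
    "\<And>T. T \<in> blocks \<Longrightarrow> of_nat (card T - 1) \<noteq> (0::'k)"
    and T: "T \<in> blocks"
  shows "(\<Sum>a\<in>T. card (through a) - 1) = card A - 1"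
proof -
  obtain z where z: "z \<noteq> 0" "T = inc z" "card (inc z) \<ge> 2" using T by (rule blockE)
  obtain ys where ys: "\<And>y. y \<in> set ys \<Longrightarrow> crs z y \<noteq> 0"
    "\<And>b. dot b z = 0 \<Longrightarrow> \<exists>X. polyfun X \<and>
        (\<forall>v. dot z (gr A v) * X v = dot b v * (\<Prod>y\<leftarrow>ys. dot y (gr A v)))"
    by (rule contracted[OF z(1,3)]) (rule that)
  \<comment> \<open>The line at infinity must differ from the lines of the arrangement through
    \<open>z\<close> and from the images of the contracted components.\<close>
  have "\<exists>w. \<forall>c\<in>inc z \<union> crs z ` set ys. dot c w \<noteq> 0"
  proof (rule polyfun_avoid)
    fix c assume "c \<in> inc z \<union> crs z ` set ys"
    then have "c \<noteq> 0" using ys(1) nonzero inc_subset by auto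
    then show "\<exists>w. dot c w \<noteq> 0" by (metis exists_dot_eq_1 zero_neq_one)
  qed (auto intro: polyfun_intros)
  then obtain w1 where w1: "\<And>c. c \<in> inc z \<union> crs z ` set ys \<Longrightarrow> dot c w1 \<noteq> 0" by blast
  have "crs z w1 \<noteq> 0"
  proof
    assume "crs z w1 = 0"
    then obtain c where "w1 = c *s z" using crs_eq_0_imp z(1) by blast
    moreover obtain a where "a \<in> inc z" using z(3) by fastforce
    ultimately show False using w1[of a] by (auto simp: inc_def)
  qed
  then obtain w0 where w0: "dot (crs z w1) w0 = 1" using exists_dot_eq_1 by blast
  interpret polar_pencil A Q e z w0 w1 ys
    by unfold_locales (use z w0 w1 ys H in auto)
  show ?thesis using count_pencil z(2) by simp
qed

end

section \<open>Combinatorics of the multiple points\<close>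

context arrangement
begin

lemma inc_block_of_two:
  assumes "a \<in> inc P" "b \<in> inc P" "a \<noteq> b" "P \<noteq> 0"
  shows "inc P \<in> blocks"
proof -
  have "card {a, b} \<le> card (inc P)" using assms by (intro card_mono) auto
  then show ?thesis using assms by (auto simp: blocks_def)
qed

lemma card_line:
  assumes "a \<in> A"
  shows "(\<Sum>T\<in>through a. card T - 1) = card A - 1"
proof -
  have "card (A - {a}) = (\<Sum>T\<in>through a. card (T - {a}))"
    using sum_over_line[OF assms, of "\<lambda>_. 1::nat"] by simp
  also have "\<dots> = (\<Sum>T\<in>through a. card T - 1)" by (intro sum.cong) (auto simp: through_def)
  finally show ?thesis using assms by simp
qed

text \<open>Distinct lines of \<open>T\<close> meet \<open>a\<close> in distinct points, since
  \<open>a\<close> does not belong to \<open>T\<close>. With equal cardinalities they reach every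
  multiple point of \<open>a\<close>.\<close>

lemma block_meets:
  assumes T: "T \<in> blocks" "a \<notin> T" "a \<in> A" and T': "T' \<in> through a"
    and card: "card T = card (through a)"
  obtains t where "t \<in> T" "t \<in> T'" "t \<noteq> a"
proof -
  let ?f = "\<lambda>t. inc (crs t a)"
  have ne: "t \<in> A" "t \<noteq> a" if "t \<in> T" for t using that T block_subset by auto
  have f: "?f t \<in> blocks" "t \<in> ?f t" "a \<in> ?f t" if "t \<in> T" for t
    using inc_crs_block[OF ne(1)[OF that] T(3) ne(2)[OF that]] by auto
  have "inj_on ?f T"
  proof (rule inj_onI, rule ccontr)
    fix t t' assume t: "t \<in> T" "t' \<in> T" "?f t = ?f t'" "t \<noteq> t'"
    then have "?f t = T" using block_eqI[of "?f t" T t t'] f[OF t(1)] f[OF t(2)] T(1) by auto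
    then show False using f(3)[OF t(1)] T(2) by simp
  qed
  then have "card (?f ` T) = card (through a)" using card by (simp add: card_image)
  moreover have "?f ` T \<subseteq> through a" using f by (auto simp: through_def)
  ultimately have "?f ` T = through a" by (intro card_subset_eq) auto
  then obtain t where "t \<in> T" "T' = ?f t" using T' by auto
  then show ?thesis using f(2) ne(2) by (intro that[of t]) auto
qed

text \<open>
  If the multiple points and lines form a projective plane of order \<open>m - 1\<close>, then in suitable affine
  coordinates the vertical lines are indexed by a subgroup of the additive group of order \<open>m - 1\<close>,
  so the characteristic divides \<open>m - 1\<close>.
\<close>

lemma no_projective_plane:
  assumes m: "m \<ge> 3" "of_nat m = (0::'k)"
    and block: "\<And>T. T \<in> blocks \<Longrightarrow> card T = m"
    and line: "\<And>a. a \<in> A \<Longrightarrow> card (through a) = m" and "A \<noteq> {}"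
  shows False
proof -
  obtain l where l: "l \<in> A" using \<open>A \<noteq> {}\<close> by blast
  obtain TA TB TD where T: "TA \<in> through l" "TB \<in> through l" "TD \<in> through l"
    "TA \<noteq> TB" "TA \<noteq> TD" "TB \<noteq> TD"
  proof -
    have "2 \<le> card (through l)" using line[OF l] m by simp
    then obtain TA TB where TAB: "TA \<in> through l" "TB \<in> through l" "TA \<noteq> TB"
      by (rule card_ge_2_obtain)
    have "\<not> through l \<subseteq> {TA, TB}"
    proof
      assume "through l \<subseteq> {TA, TB}"
      then have "card (through l) \<le> card {TA, TB}" by (intro card_mono) auto
      with line[OF l] m TAB(3) show False by simp
    qed
    then obtain TD where "TD \<in> through l" "TD \<noteq> TA" "TD \<noteq> TB" by blast
    with TAB show ?thesis by (intro that[of TA TB TD]) auto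
  qed
  have thr: "T' \<in> blocks" "l \<in> T'" if "T' \<in> through l" for T' using that by (auto simp: through_def)
  obtain zA where zA: "zA \<noteq> 0" "TA = inc zA" by (rule blockE[OF thr(1)[OF T(1)]])
  obtain zB where zB: "zB \<noteq> 0" "TB = inc zB" by (rule blockE[OF thr(1)[OF T(2)]])
  obtain zD where zD: "zD \<noteq> 0" "TD = inc zD" by (rule blockE[OF thr(1)[OF T(3)]])
  have lz: "dot l zA = 0" "dot l zB = 0" "dot l zD = 0"
    using thr(2)[OF T(1)] thr(2)[OF T(2)] thr(2)[OF T(3)] zA zB zD by (auto simp: inc_def)
  have crsAB: "crs zA zB \<noteq> 0"
  proof
    assume "crs zA zB = 0"
    then obtain c where c: "zB = c *s zA" using crs_eq_0_imp zA(1) by blast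
    then have "c \<noteq> 0" using zB(1) by auto
    then show False using c T(4) zA(2) zB(2) inc_scale by simp
  qed
  obtain c where c: "l = c *s crs zA zB"
    using common_perp[OF crsAB, of l] lz by (auto simp: dot_commute)
  have "c \<noteq> 0" using c l nonzero by auto
  then have "dot (crs zA zB) zD = 0" using lz(3) by (subst (asm) c) simp
  then obtain r s where rs: "zD = r *s zA + s *s zB" by (rule in_span_if_perp_crs[OF crsAB])
  have "r \<noteq> 0"
  proof
    assume "r = 0"
    then have "zD = s *s zB" "s \<noteq> 0" using rs zD(1) by auto
    then show False using T(6) zB(2) zD(2) inc_scale by simp
  qed
  have "s \<noteq> 0"
  proof
    assume "s = 0"
    then have "zD = r *s zA" using rs by simp
    then show False using T(5) zA(2) zD(2) inc_scale[OF \<open>r \<noteq> 0\<close>] by simp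
  qed
  \<comment> \<open>Rescaling turns the third point into \<open>a + b\<close>. With \<open>l\<close>
    as the line at infinity, lines through \<open>a\<close>, \<open>b\<close> and
    \<open>a + b\<close> are horizontal, vertical and diagonal, the latter with constant
    \<open>y - x\<close>.\<close>
  define a b where "a = r *s zA" and "b = s *s zB"
  have TA: "TA = inc a" and TB: "TB = inc b" and TD: "TD = inc (a + b)"
    using zA zB zD rs inc_scale \<open>r \<noteq> 0\<close> \<open>s \<noteq> 0\<close> by (simp_all add: a_def b_def)
  have crsab: "crs a b \<noteq> 0" using crsAB \<open>r \<noteq> 0\<close> \<open>s \<noteq> 0\<close> by (simp add: a_def b_def)
  have la: "dot l a = 0" "dot l b = 0" using lz by (auto simp: a_def b_def)
  have sub: "TA \<subseteq> A" "TB \<subseteq> A" "TD \<subseteq> A" using inc_subset TA TB TD by auto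
  have par: "g = l" if gA: "g \<in> A" "dot g a = 0" "dot g b = 0" for g
  proof (rule ccontr)
    assume "g \<noteq> l"
    then have gl: "crs g l \<noteq> 0" using gA(1) l nonparallel by simp
    obtain c1 c2 where "a = c1 *s crs g l" "b = c2 *s crs g l"
      using common_perp[OF gl gA(2) la(1)] common_perp[OF gl gA(3) la(2)] by blast
    then show False using crsab by simp
  qed
  obtain x0 where x0: "x0 \<in> TB - {l}"
  proof -
    have "TB \<noteq> {l}" using block[OF thr(1)[OF T(2)]] m by auto
    then show ?thesis using that thr(2)[OF T(2)] by blast
  qed
  obtain y0 where y0: "y0 \<in> TA - {l}"
  proof -
    have "TA \<noteq> {l}" using block[OF thr(1)[OF T(1)]] m by auto
    then show ?thesis using that thr(2)[OF T(1)] by blast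
  qed
  define og where "og = crs x0 y0"
  have neq: "g \<noteq> h" if "g \<in> T1 - {l}" "h \<in> T2 - {l}" "T1 \<in> through l" "T2 \<in> through l" "T1 \<noteq> T2" for g h T1 T2
    using that block_eqI[of T1 T2 l g] thr by auto
  have xy: "x0 \<in> A" "y0 \<in> A" "x0 \<noteq> y0" using x0 y0 sub neq[OF x0 y0 T(2,1)] T(4) by auto
  have og: "og \<noteq> 0" "dot x0 og = 0" "dot y0 og = 0" using xy nonparallel by (auto simp: og_def)
  have lO: "dot l og \<noteq> 0"
  proof
    assume "dot l og = 0"
    then have "l \<in> inc og" "x0 \<in> inc og" "y0 \<in> inc og" using og xy l by (auto simp: inc_def)
    then have "inc og = TB" "inc og = TA"
      using block_eqI[of "inc og" TB l x0] block_eqI[of "inc og" TA l y0] inc_block_of_two[of x0 og y0]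
        xy og(1) x0 y0 thr T by auto
    with T(4) show False by simp
  qed
  define P where "P x y = og + x *s a + y *s b" for x y
  have lP: "dot l (P x y) \<noteq> 0" for x y using lO la by (simp add: P_def)
  have Pne: "P x y \<noteq> 0" for x y using lP[of x y] by auto
  \<comment> \<open>Every block has as many lines as \<open>l\<close> has multiple points, so an
    intersection point off \<open>l\<close> is joined by a line of the arrangement to each multiple
    point of \<open>l\<close>.\<close>
  have meets: "\<exists>t\<in>T' - {l}. dot t (P x y) = 0"
    if T': "T' \<in> through l" and gh: "g \<in> A" "h \<in> A" "g \<noteq> h" "dot g (P x y) = 0" "dot h (P x y) = 0" for T' g h x y
  proof -
    have "g \<in> inc (P x y)" "h \<in> inc (P x y)" using gh by (auto simp: inc_def)
    then have bl: "inc (P x y) \<in> blocks" using inc_block_of_two gh(3) Pne by blast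
    have "l \<notin> inc (P x y)" using lP by (auto simp: inc_def)
    then obtain t where "t \<in> inc (P x y)" "t \<in> T'" "t \<noteq> l"
      by (rule block_meets[OF bl _ l T']) (simp add: block[OF bl] line[OF l], rule that)
    then show ?thesis by (auto simp: inc_def)
  qed
  define xc where "xc h = - dot h og / dot h a" for h
  define yc where "yc h = - dot h og / dot h b" for h
  have x_line: "dot h (P x y) = 0 \<longleftrightarrow> x = xc h" if h: "h \<in> TB - {l}" for h x y
  proof -
    have "dot h b = 0" using h TB by (auto simp: inc_def)
    moreover have "dot h a \<noteq> 0" using par[of h] calculation h sub by auto
    ultimately show ?thesis by (auto simp: P_def xc_def field_simps eq_neg_iff_add_eq_0)
  qed
  have y_line: "dot h (P x y) = 0 \<longleftrightarrow> y = yc h" if h: "h \<in> TA - {l}" for h x y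
  proof -
    have "dot h a = 0" using h TA by (auto simp: inc_def)
    moreover have "dot h b \<noteq> 0" using par[of h] calculation h sub by auto
    ultimately show ?thesis by (auto simp: P_def yc_def field_simps eq_neg_iff_add_eq_0)
  qed
  have d_line: "dot h (P x' y') = 0 \<longleftrightarrow> y' - x' = y - x"
    if h: "h \<in> TD - {l}" "dot h (P x y) = 0" for h x y x' y'
  proof -
    have ha: "dot h b = - dot h a" using h TD by (auto simp: inc_def eq_neg_iff_add_eq_0 add.commute)
    moreover have "dot h a \<noteq> 0" using par[of h] calculation h sub by auto
    moreover have "dot h og = (y - x) * dot h a" using h(2) ha by (simp add: P_def algebra_simps)
    ultimately have "dot h (P x' y') = dot h a * ((y - x) - (y' - x'))"
      by (simp add: P_def algebra_simps)
    with \<open>dot h a \<noteq> 0\<close> show ?thesis by auto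
  qed
  define X where "X = xc ` (TB - {l})"
  define Y where "Y = yc ` (TA - {l})"
  have inj_x: "inj_on xc (TB - {l})"
  proof (rule inj_onI, rule ccontr)
    fix g h assume gh: "g \<in> TB - {l}" "h \<in> TB - {l}" "xc g = xc h" "g \<noteq> h"
    then have "dot g (P (xc g) 0) = 0" "dot h (P (xc g) 0) = 0" "dot g (P (xc g) 1) = 0" "dot h (P (xc g) 1) = 0"
      using x_line by auto
    then have "g \<in> inc (P (xc g) 0)" "h \<in> inc (P (xc g) 0)" using gh sub by (auto simp: inc_def)
    then have "inc (P (xc g) 0) = TB"
      using block_eqI[of "inc (P (xc g) 0)" TB g h] inc_block_of_two[of g "P (xc g) 0" h] gh Pne thr T by auto
    then show False using lP thr(2)[OF T(2)] by (auto simp: inc_def)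
  qed
  have inj_y: "inj_on yc (TA - {l})"
  proof (rule inj_onI, rule ccontr)
    fix g h assume gh: "g \<in> TA - {l}" "h \<in> TA - {l}" "yc g = yc h" "g \<noteq> h"
    then have "dot g (P 0 (yc g)) = 0" "dot h (P 0 (yc g)) = 0" using y_line by auto
    then have "g \<in> inc (P 0 (yc g))" "h \<in> inc (P 0 (yc g))" using gh sub by (auto simp: inc_def)
    then have "inc (P 0 (yc g)) = TA"
      using block_eqI[of "inc (P 0 (yc g))" TA g h] inc_block_of_two[of g "P 0 (yc g)" h] gh Pne thr T by auto
    then show False using lP thr(2)[OF T(1)] by (auto simp: inc_def)
  qed
  have finT: "finite (TA - {l})" "finite (TB - {l})" using sub finite finite_subset by blast+
  have cardX: "card X = m - 1" using inj_x block[OF thr(1)[OF T(2)]] thr(2)[OF T(2)]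
    by (simp add: X_def card_image)
  have cardY: "card Y = m - 1" using inj_y block[OF thr(1)[OF T(1)]] thr(2)[OF T(1)]
    by (simp add: Y_def card_image)
  have finXY: "finite X" "finite Y" using finT by (auto simp: X_def Y_def)
  \<comment> \<open>The diagonal through \<open>(x, y)\<close> meets the vertical line at
    \<open>x'\<close> in height \<open>x' + (y - x)\<close>, and the horizontal line through that
    point is in the arrangement. The diagonal through the origin thus gives
    \<open>X \<subseteq> Y\<close>.\<close>
  have shift: "x' + (y - x) \<in> Y" if h: "h \<in> TD - {l}" "dot h (P x y) = 0" and x': "x' \<in> X" for h x y x'
  proof -
    obtain g where g: "g \<in> TB - {l}" "x' = xc g" using x' by (auto simp: X_def)
    let ?y' = "x' + (y - x)"
    have "dot h (P x' ?y') = 0" using d_line[OF h] by simp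
    moreover have "dot g (P x' ?y') = 0" using x_line[OF g(1)] g(2) by simp
    moreover have "h \<noteq> g" using neq[OF h(1) g(1) T(3,2)] T(6) by auto
    ultimately obtain t where t: "t \<in> TA - {l}" "dot t (P x' ?y') = 0"
      using meets[OF T(1), of h g x' ?y'] h(1) g(1) sub by blast
    then have "?y' = yc t" using y_line by blast
    then show ?thesis using t(1) by (auto simp: Y_def)
  qed
  have P00: "P 0 0 = og" by (simp add: P_def)
  obtain h0 where h0: "h0 \<in> TD - {l}" "dot h0 (P 0 0) = 0"
    using meets[OF T(3) xy, of 0 0] og P00 by auto
  have "X \<subseteq> Y" using shift[OF h0] by auto
  then have XY: "X = Y" using cardX cardY finXY by (intro card_subset_eq) auto
  \<comment> \<open>The vertical line \<open>x0\<close> is at \<open>x = 0\<close>, so its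
    intersection with the horizontal line at height \<open>y\<close> lies on a diagonal that shifts
    by \<open>y\<close>.\<close>
  have closed: "x' + y \<in> X" if y: "y \<in> X" and x': "x' \<in> X" for x' y
  proof -
    obtain g where g: "g \<in> TA - {l}" "y = yc g" using y XY by (auto simp: Y_def)
    have x00: "xc x0 = 0" using og(2) by (simp add: xc_def)
    have "dot g (P 0 y) = 0" "dot x0 (P 0 y) = 0" using y_line[OF g(1)] g(2) x_line[OF x0] x00 by auto
    moreover have "g \<noteq> x0" using neq[OF g(1) x0 T(1,2)] T(4) by auto
    ultimately obtain h where h: "h \<in> TD - {l}" "dot h (P 0 y) = 0"
      using meets[OF T(3), of g x0 0 y] g(1) xy(1) sub by blast
    show ?thesis using shift[OF h x'] XY by simp
  qed
  have "card X \<ge> 2" using cardX m by simp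
  then obtain u v where "u \<in> X" "v \<in> X" "u \<noteq> v" by (rule card_ge_2_obtain)
  then obtain y where y: "y \<in> X" "y \<noteq> 0" by (cases "u = 0") auto
  \<comment> \<open>Translation by \<open>y\<close> permutes the finite set \<open>X\<close>.
    Comparing sums shows that \<open>card X * y\<close> is zero in the field, so m - 1 vanishes
    there together with m.\<close>
  have "(\<lambda>x. x + y) ` X = X"
    by (rule card_subset_eq) (use closed[OF y(1)] finXY in \<open>auto simp: card_image\<close>)
  then have "(\<Sum>x\<in>X. x) = (\<Sum>x\<in>(\<lambda>x. x + y) ` X. x)" by simp
  also have "\<dots> = (\<Sum>x\<in>X. x + y)" by (subst sum.reindex) auto
  also have "\<dots> = (\<Sum>x\<in>X. x) + of_nat (card X) * y" by (simp add: sum.distrib)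
  finally have "of_nat (card X) = (0::'k)" using y(2) by simp
  then have "of_nat (Suc (m - 1)) = (1::'k)" unfolding cardX by simp
  with m show False by simp
qed

text \<open>Write d and s for the numbers of all lines and of multiple points on \<open>a\<close>.
  Grouping the other lines by the point where they meet \<open>a\<close>, each group contributes d -
  s. The sum does not depend on \<open>a\<close>, which puts all these s under one quadratic
  equation.\<close>

lemma double_count:
  assumes cnt: "\<And>T. T \<in> blocks \<Longrightarrow> (\<Sum>a\<in>T. card (through a) - 1) = card A - 1"
    and a: "a \<in> A" and pos: "\<And>b. b \<in> A \<Longrightarrow> card (through b) \<ge> 1"
  shows "(\<Sum>b\<in>A. card (through b) - 1) = card (through a) * (card A - card (through a)) + (card (through a) - 1)"
    and "card (through a) \<le> card A - 1"
proof -
  let ?s = "\<lambda>b. card (through b)"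
  show le: "?s a \<le> card A - 1"
  proof -
    have "?s a = (\<Sum>T\<in>through a. 1)" by simp
    also have "\<dots> \<le> (\<Sum>T\<in>through a. card T - 1)"
      by (rule sum_mono) (use block_card in \<open>force simp: through_def\<close>)
    finally show ?thesis using card_line[OF a] by simp
  qed
  have "(\<Sum>b\<in>A. ?s b - 1) = (?s a - 1) + (\<Sum>b\<in>A-{a}. ?s b - 1)"
    using a finite by (rule sum.remove[rotated])
  also have "(\<Sum>b\<in>A-{a}. ?s b - 1) = (\<Sum>T\<in>through a. \<Sum>b\<in>T-{a}. ?s b - 1)"
    by (rule sum_over_line[OF a])
  also have "\<dots> = (\<Sum>T\<in>through a. card A - ?s a)"
  proof (rule sum.cong)
    fix T assume "T \<in> through a"
    then have T: "T \<in> blocks" "a \<in> T" by (auto simp: through_def)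
    have "finite T" using block_subset[OF T(1)] finite finite_subset by blast
    then have "(\<Sum>b\<in>T. ?s b - 1) = (?s a - 1) + (\<Sum>b\<in>T-{a}. ?s b - 1)" using T(2) by (rule sum.remove)
    then have "(\<Sum>b\<in>T-{a}. ?s b - 1) = card A - 1 - (?s a - 1)" using cnt[OF T(1)] by simp
    then show "(\<Sum>b\<in>T-{a}. ?s b - 1) = card A - ?s a" using pos[OF a] by simp
  qed simp
  also have "\<dots> = ?s a * (card A - ?s a)" by simp
  finally show "(\<Sum>b\<in>A. ?s b - 1) = ?s a * (card A - ?s a) + (?s a - 1)" by simp
qed

end

text \<open>Here \<open>x + 1\<close> and \<open>y + 1\<close> are the two possible numbers of
  multiple points on a line, and \<open>n\<close> lines carry the larger one. Eliminating
  \<open>d\<close> gives \<open>n * (x - y) = x - y * y\<close>; with \<open>n \<ge> 1\<close> this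
  yields \<open>y * y \<le> y\<close>.\<close>

lemma two_values_arith:
  fixes x y n d :: int
  assumes "x + y = d - 1" "n * x + (d - n) * y = (x + 1) * (y + 1) - 1" "n \<ge> 1" "x > y" "y \<ge> 1"
  shows "y = 1"
proof -
  have "n * (x - y) = x - y * y" using assms(1,2) by algebra
  moreover have "1 * (x - y) \<le> n * (x - y)" using assms by (intro mult_right_mono) auto
  ultimately have "y * y \<le> y" by simp
  then have "y * (y - 1) \<le> 0" by (simp add: algebra_simps)
  with assms(5) show ?thesis by (smt (verit) mult_pos_pos)
qed

section \<open>From the counts to triangles and near-pencils\<close>

context polar_inverse
begin

lemma A_nonempty: "A \<noteq> {}"
proof -
  have "(axis 1 1 :: 'k ^ 3) \<noteq> 0" by (simp add: vec_eq_iff axis_nth exI[of _ 1])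
  then show ?thesis using not_concurrent by blast
qed

lemma A_not_block: "A \<notin> blocks"
proof
  assume "A \<in> blocks"
  then obtain z where z: "z \<noteq> 0" "A = inc z" by (rule blockE)
  obtain a where "a \<in> A" "dot a z \<noteq> 0" using not_concurrent[OF z(1)] by blast
  then show False using z(2) by (auto simp: inc_def)
qed

lemma two_through:
  assumes a: "a \<in> A"
  shows "card (through a) \<ge> 2"
proof -
  have a0: "a \<noteq> 0" using a nonzero by auto
  obtain e1 b1 where v: "dot b1 a = 0" "dot b1 e1 = 1" by (rule dual_basis[OF a0]) (rule that)
  then have "b1 \<noteq> 0" by auto
  then obtain b where b: "b \<in> A" "dot b b1 \<noteq> 0" using not_concurrent by blast
  have ab: "a \<noteq> b" using v(1) b(2) by (auto simp: dot_commute)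
  let ?T = "inc (crs a b)"
  have T: "?T \<in> blocks" "a \<in> ?T" using inc_crs_block[OF a b(1) ab] by auto
  have "?T \<noteq> A" "?T \<subseteq> A" using T(1) A_not_block block_subset[of ?T] by auto
  then obtain c where c: "c \<in> A" "c \<notin> ?T" by blast
  have ac: "a \<noteq> c" using c T by auto
  let ?T' = "inc (crs a c)"
  have "?T' \<in> blocks" "a \<in> ?T'" "c \<in> ?T'" using inc_crs_block[OF a c(1) ac] by auto
  then have sub: "{?T, ?T'} \<subseteq> through a" and ne: "?T \<noteq> ?T'" using T c(2) by (auto simp: through_def)
  have "card {?T, ?T'} \<le> card (through a)" by (rule card_mono[OF _ sub]) simp
  then show ?thesis using ne by simp
qed

text \<open>A second line of \<open>T1\<close> besides \<open>a\<close> would produce a line of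
  \<open>T2\<close> with three multiple points: \<open>T2\<close> itself and its intersections with
  the two lines of \<open>T1\<close>.\<close>

lemma block_singleton:
  assumes le: "\<And>a. a \<in> A \<Longrightarrow> card (through a) \<le> 2"
    and T: "T1 \<in> through a" "T2 \<in> through a" "T1 \<noteq> T2" "a \<in> A"
  shows "card (T1 - {a}) = 1"
proof -
  have b: "T1 \<in> blocks" "T2 \<in> blocks" "a \<in> T1" "a \<in> T2" using T by (auto simp: through_def)
  have "T1 \<noteq> {a}" "T2 \<noteq> {a}" using block_card b(1,2) by fastforce+
  then obtain x c where x: "x \<in> T1 - {a}" and c: "c \<in> T2 - {a}" using b by blast
  have sub: "T1 \<subseteq> A" "T2 \<subseteq> A" using b block_subset by auto
  have meet: "y = a" if "y \<in> T1" "y \<in> T2" for y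
    using block_eqI[of T1 T2 a y] that b T(3) by auto
  have "y = x" if y: "y \<in> T1 - {a}" for y
  proof (rule ccontr)
    assume "y \<noteq> x"
    have ne: "y \<noteq> c" "x \<noteq> c" "y \<in> A" "x \<in> A" "c \<in> A" using meet x y c sub by auto
    let ?U = "inc (crs y c)" and ?U' = "inc (crs x c)"
    have U: "?U \<in> blocks" "y \<in> ?U" "c \<in> ?U" "?U' \<in> blocks" "x \<in> ?U'" "c \<in> ?U'"
      using inc_crs_block[of y c] inc_crs_block[of x c] ne by auto
    have "?U \<noteq> T2" "?U' \<noteq> T2" using meet[of y] meet[of x] x y U by auto
    moreover have "?U \<noteq> ?U'"
    proof
      assume eq: "?U = ?U'"
      then have "?U = T1" using block_eqI[of ?U T1 x y] U x y b \<open>y \<noteq> x\<close> by auto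
      then show False using U(3) meet[of c] c by auto
    qed
    ultimately have "card {?U, ?U', T2} = 3" by auto
    moreover have "{?U, ?U', T2} \<subseteq> through c" using U b c by (auto simp: through_def)
    then have "card {?U, ?U', T2} \<le> card (through c)" by (rule card_mono[rotated]) simp
    ultimately show False using le[OF ne(5)] by simp
  qed
  then have "T1 - {a} = {x}" using x by blast
  then show ?thesis by simp
qed

lemma card_eq_3_if_two_points_per_line:
  assumes le: "\<And>a. a \<in> A \<Longrightarrow> card (through a) \<le> 2"
  shows "card A = 3"
proof -
  obtain a where a: "a \<in> A" using A_nonempty by blast
  have "card (through a) = 2" using le[OF a] two_through[OF a] by simp
  then obtain T1 T2 where T: "through a = {T1, T2}" "T1 \<noteq> T2" by (auto simp: card_2_iff)
  have 1: "card (T1 - {a}) = 1" "card (T2 - {a}) = 1"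
    using block_singleton[OF le, of T1 a T2] block_singleton[OF le, of T2 a T1] T a by auto
  have "card (A - {a}) = (\<Sum>T\<in>through a. card (T - {a}))"
    using sum_over_line[OF a, of "\<lambda>_. 1::nat"] by simp
  also have "\<dots> = 2" using T 1 by simp
  finally show ?thesis using a finite by (simp add: card_Diff_singleton)
qed

lemma classification:
  assumes p: "CHAR('k) = p"
  shows "card A = 3 \<or> (p dvd card A - 1 \<and> (\<exists>a\<in>A. \<exists>z. z \<noteq> 0 \<and> inc z = A - {a}))"
proof -
  have mult: "of_nat (card T) = (0::'k) \<or> card T = 2" if T: "T \<in> blocks" for T
  proof -
    obtain z where z: "z \<noteq> 0" "T = inc z" "card (inc z) \<ge> 2" using T by (rule blockE)
    then show ?thesis using multiplicity_le_2[OF z(1)] by auto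
  qed
  have H3: "of_nat (card T - 1) \<noteq> (0::'k)" if "T \<in> blocks" for T
  proof (cases "card T = 2")
    case False
    then have "of_nat (card T - 1) = (- 1 :: 'k)"
      using mult[OF that] block_card[OF that] by (simp add: of_nat_diff)
    then show ?thesis by simp
  qed simp
  show ?thesis
  proof (cases "of_nat (card A - 1) = (0::'k)")
    case False
    have "card (through a) \<le> 2" if a: "a \<in> A" for a
      by (rule points_on_line_le_2[OF a False]) (use H3 in \<open>simp add: through_def\<close>)
    then show ?thesis using card_eq_3_if_two_points_per_line by blast
  next
    case True
    then have pd: "p dvd card A - 1" using p by (simp add: of_nat_eq_0_iff_char_dvd)
    have cA: "card A \<ge> 1" using A_nonempty finite by (simp add: Suc_le_eq card_gt_0_iff)
    have d1: "of_nat (card A) = (1::'k)" using True cA by (simp add: of_nat_diff)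
    have H2: "of_nat (card (A - T)) \<noteq> (0::'k)" if T: "T \<in> blocks" for T
    proof -
      have "finite T" using block_subset[OF T] finite finite_subset by blast
      then have "of_nat (card (A - T)) = (1::'k) - of_nat (card T)"
        using block_subset[OF T] finite d1 by (simp add: card_Diff_subset of_nat_diff card_mono)
      note eq = this
      show ?thesis
      proof (cases "card T = 2")
        case True
        then have "of_nat (card (A - T)) = (- 1 :: 'k)" using eq by simp
        then show ?thesis by simp
      qed (use eq mult[OF T] in simp)
    qed
    have cnt: "(\<Sum>a\<in>T. card (through a) - 1) = card A - 1" if "T \<in> blocks" for T
      by (rule block_count[OF _ H2 H3 that]) (use d1 in auto)
    let ?s = "\<lambda>a. card (through a)"
    have pos: "?s a \<ge> 1" if "a \<in> A" for a using two_through[OF that] by simp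
    have dc: "(\<Sum>b\<in>A. ?s b - 1) = ?s a * (card A - ?s a) + (?s a - 1)" and le: "?s a \<le> card A - 1"
      if a: "a \<in> A" for a
      using double_count[OF cnt a pos] by simp_all
    show ?thesis
    proof (cases "\<exists>a\<in>A. \<exists>b\<in>A. ?s a > ?s b")
      \<comment> \<open>If every line carries \<open>s\<close> multiple points, the block count
        gives all blocks the same size \<open>m\<close>, and counting along a line gives
        \<open>s * (m - 1) = m * (s - 1)\<close>, so \<open>s = m\<close>. For \<open>m = 2\<close>
        this is a triangle, otherwise a projective plane of order \<open>m - 1\<close>.\<close>
      case False
      obtain a0 where a0: "a0 \<in> A" using A_nonempty by blast
      define s where "s = ?s a0"
      have s: "?s a = s" if "a \<in> A" for a using False that a0 unfolding s_def by (meson linorder_neqE_nat)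
      have s2: "s \<ge> 2" using two_through[OF a0] by (simp add: s_def)
      have cT: "card T * (s - 1) = card A - 1" if T: "T \<in> blocks" for T
      proof -
        have "(\<Sum>a\<in>T. ?s a - 1) = card T * (s - 1)" using s block_subset[OF T] by (simp add: subset_iff)
        then show ?thesis using cnt[OF T] by simp
      qed
      obtain T0 where T0: "T0 \<in> through a0" using two_through[OF a0] by fastforce
      define m where "m = card T0"
      have T0b: "T0 \<in> blocks" using T0 by (simp add: through_def)
      have m: "card T = m" if T: "T \<in> blocks" for T
      proof -
        have "card T * (s - 1) = m * (s - 1)" using cT[OF T] cT[OF T0b] by (simp add: m_def)
        moreover have "s - 1 \<noteq> 0" using s2 by simp
        ultimately show ?thesis by (metis mult_cancel2)
      qed
      have m2: "m \<ge> 2" using block_card[OF T0b] by (simp add: m_def)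
      have "(\<Sum>T\<in>through a0. card T - 1) = s * (m - 1)"
        using m by (simp add: s_def through_def)
      then have "s * (m - 1) = m * (s - 1)" using card_line[OF a0] cT[OF T0b] by (simp add: m_def)
      then have sm: "s = m" using s2 m2 by (cases s; cases m) (auto simp: algebra_simps)
      show ?thesis
      proof (cases "m = 2")
        case True
        then have "card A - 1 = 2" using cT[OF T0b] sm m_def by simp
        then have "card A = 3" by linarith
        then show ?thesis ..
      next
        case False
        then have "of_nat m = (0::'k)" "m \<ge> 3" using mult[OF T0b] m2 by (auto simp: m_def)
        then have False using no_projective_plane[of m] m s sm A_nonempty by auto
        then show ?thesis ..
      qed
    next
      case True
      then obtain a b where ab: "a \<in> A" "b \<in> A" "?s a > ?s b" by blast
      define d where "d = int (card A)"
      define S where "S = int (\<Sum>c\<in>A. ?s c - 1)"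
      have dcZ: "S = int (?s c) * (d - int (?s c)) + (int (?s c) - 1)" if "c \<in> A" for c
        unfolding S_def dc[OF that] using le[OF that] pos[OF that] by (simp add: d_def of_nat_diff)
      \<comment> \<open>Subtracting the quadratic equations for two lines leaves a product: their
        numbers of points are equal or add up to \<open>d + 1\<close>.\<close>
      have two: "?s c = ?s a \<or> int (?s c) + int (?s a) = d + 1" if "c \<in> A" for c
      proof -
        have "(int (?s c) - int (?s a)) * (d + 1 - int (?s c) - int (?s a)) = 0"
          using dcZ[OF that] dcZ[OF ab(1)] by algebra
        then show ?thesis by auto
      qed
      have sb: "int (?s a) + int (?s b) = d + 1" using two[OF ab(2)] ab(3) by auto
      define x y where "x = int (?s a) - 1" and "y = int (?s b) - 1"
      define N where "N = {c \<in> A. ?s c = ?s a}"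
      have N: "finite N" "N \<subseteq> A" "a \<in> N" using finite ab by (auto simp: N_def)
      have "S = (\<Sum>c\<in>A. int (?s c) - 1)"
        unfolding S_def of_nat_sum by (rule sum.cong) (use pos in \<open>auto simp: of_nat_diff\<close>)
      also have "\<dots> = (\<Sum>c\<in>N. int (?s c) - 1) + (\<Sum>c\<in>A-N. int (?s c) - 1)"
        using N finite by (simp add: sum.subset_diff add.commute)
      also have "(\<Sum>c\<in>N. int (?s c) - 1) = int (card N) * x" by (simp add: N_def x_def)
      also have "(\<Sum>c\<in>A-N. int (?s c) - 1) = (\<Sum>c\<in>A-N. y)"
      proof (rule sum.cong)
        fix c assume "c \<in> A - N"
        then have "c \<in> A" "?s c \<noteq> ?s a" by (auto simp: N_def)
        then show "int (?s c) - 1 = y" using two[of c] sb by (simp add: y_def)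
      qed simp
      also have "\<dots> = (d - int (card N)) * y"
        using N finite by (simp add: card_Diff_subset d_def of_nat_diff card_mono)
      finally have S: "S = int (card N) * x + (d - int (card N)) * y" .
      have "y = 1"
      proof (rule two_values_arith[of x y d "int (card N)"])
        show "x + y = d - 1" using sb by (simp add: x_def y_def)
        have "d = x + y + 1" using sb by (simp add: x_def y_def)
        moreover have "S = (x + 1) * (d - (x + 1)) + x" using dcZ[OF ab(1)] by (simp add: x_def)
        ultimately show "int (card N) * x + (d - int (card N)) * y = (x + 1) * (y + 1) - 1"
          using S by algebra
        have "card N > 0" using N by (auto simp: card_gt_0_iff)
        then show "int (card N) \<ge> 1" by simp
        show "x > y" "y \<ge> 1" using ab two_through[OF ab(2)] by (auto simp: x_def y_def)
      qed
      then have sb2: "?s b = 2" and sa: "?s a = card A - 1" using sb by (auto simp: y_def d_def)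
      have abne: "a \<noteq> b" using ab by auto
      \<comment> \<open>The \<open>card A - 1\<close> other lines meet \<open>a\<close> in as many
        multiple points, so all of these are double. Since \<open>b\<close> has just two multiple
        points and meets \<open>a\<close> in a double one, all lines except \<open>a\<close> pass
        through the other.\<close>
      have all2: "card T = 2" if T: "T \<in> through a" for T
      proof (rule ccontr)
        assume "card T \<noteq> 2"
        have ge: "card T' - 1 \<ge> 1" if "T' \<in> through a" for T'
          using block_card[of T'] that by (simp add: through_def)
        have gt: "card T - 1 > 1" using block_card[of T] T \<open>card T \<noteq> 2\<close> by (simp add: through_def)
        have "(\<Sum>T\<in>through a. 1) < (\<Sum>T\<in>through a. card T - 1)"
          by (rule sum_strict_mono_ex1) (use ge gt T in auto)
        then show False using card_line[OF ab(1)] sa by simp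
      qed
      let ?T0 = "inc (crs a b)"
      have T0: "?T0 \<in> blocks" "a \<in> ?T0" "b \<in> ?T0" using inc_crs_block[OF ab(1,2) abne] by auto
      have c0: "card ?T0 = 2" using all2[of ?T0] T0 by (simp add: through_def)
      have "through b - {?T0} \<noteq> {}"
      proof
        assume "through b - {?T0} = {}"
        then have "card (through b) \<le> card {?T0}" by (intro card_mono) auto
        with sb2 show False by simp
      qed
      then obtain T where T: "T \<in> through b" "T \<noteq> ?T0" by blast
      then have thb: "through b = {?T0, T}"
        using sb2 T0 by (intro card_subset_eq[symmetric]) (auto simp: through_def finite_blocks)
      have Tb: "T \<in> blocks" "b \<in> T" using T by (auto simp: through_def)
      have cT: "card T - 1 + 1 = card A - 1" using card_line[OF ab(2)] c0 T(2) unfolding thb by simp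
      have "a \<notin> T" using block_eqI[of T ?T0 a b] Tb T0 T(2) abne by auto
      then have "T \<subseteq> A - {a}" using block_subset[OF Tb(1)] by auto
      moreover have "card T = card (A - {a})" using cT block_card[OF Tb(1)] ab(1) finite by simp
      ultimately have "T = A - {a}" using finite by (intro card_subset_eq) auto
      moreover obtain z where "z \<noteq> 0" "T = inc z" by (rule blockE[OF Tb(1)])
      ultimately show ?thesis using pd ab(1) by blast
    qed
  qed
qed

end

section \<open>Polynomials in three variables as functions\<close>

lemma prod_UNIV_3: "prod f (UNIV :: 3 set) = f 1 * f 2 * f 3"
  unfolding UNIV_3 by (simp add: ac_simps)

definition mono :: "monom3 \<Rightarrow> 'k::comm_semiring_1 ^ 3 \<Rightarrow> 'k" where
  "mono m v = (\<Prod>i\<in>UNIV. (v $ i) ^ Poly_Mapping.lookup m i)"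

lemma eval3_mono: "eval3 f v = (\<Sum>m\<in>Poly_Mapping.keys f. Poly_Mapping.lookup f m * mono m v)"
  by (simp add: eval3_def mono_def)

lemma mono_add: "mono (m + n) v = mono m v * mono n v"
  by (simp add: mono_def lookup_add power_add prod.distrib)

lemma eval3_add [simp]: "eval3 (f + g) v = eval3 f v + eval3 g v"
  unfolding eval3_mono by (rule setsum_keys_plus_distrib) (simp_all add: algebra_simps)

lemma eval3_single: "eval3 (Poly_Mapping.single m c) v = c * mono m v"
  by (simp add: eval3_mono)

lemma eval3_zero [simp]: "eval3 0 v = 0"
  by (simp add: eval3_mono)

lemma eval3_sum [simp]: "eval3 (\<Sum>i\<in>I. f i) v = (\<Sum>i\<in>I. eval3 (f i) v)"
  by (induction I rule: infinite_finite_induct) auto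

lemma sum_singles: "(\<Sum>m\<in>Poly_Mapping.keys f. Poly_Mapping.single m (Poly_Mapping.lookup f m)) = f"
proof (rule poly_mapping_eqI)
  fix k
  have "Poly_Mapping.lookup (\<Sum>m\<in>Poly_Mapping.keys f. Poly_Mapping.single m (Poly_Mapping.lookup f m)) k =
      (\<Sum>m\<in>Poly_Mapping.keys f. if m = k then Poly_Mapping.lookup f m else 0)"
    by (simp add: lookup_sum lookup_single when_def)
  also have "\<dots> = Poly_Mapping.lookup f k" by (simp add: in_keys_iff)
  finally show "Poly_Mapping.lookup (\<Sum>m\<in>Poly_Mapping.keys f. Poly_Mapping.single m (Poly_Mapping.lookup f m)) k =
    Poly_Mapping.lookup f k" .
qed

lemma poly3_induct [case_names single add]:
  fixes f :: "'k::comm_semiring_1 poly3"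
  assumes "\<And>m c. P (Poly_Mapping.single m c)" "\<And>f g. P f \<Longrightarrow> P g \<Longrightarrow> P (f + g)"
  shows "P f"
proof -
  have "P (\<Sum>m\<in>S. Poly_Mapping.single m (Poly_Mapping.lookup f m))" if "finite S" for S
    using that assms(1)[of 0 0] by (induction S rule: finite_induct) (auto intro: assms)
  then show ?thesis using sum_singles[of f] by (metis finite_keys)
qed

lemma eval3_mult [simp]: "eval3 (f * g) v = eval3 f v * eval3 g v"
proof (induction f rule: poly3_induct)
  case (single m c)
  show ?case
  proof (induction g rule: poly3_induct)
    case (single n d)
    show ?case by (simp add: mult_single eval3_single mono_add mult_ac)
  qed (simp add: distrib_left)
qed (simp add: distrib_right)

lemma eval3_Const3 [simp]: "eval3 (Const3 c) v = c"
  by (simp add: Const3_def eval3_single mono_def)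

lemma eval3_one [simp]: "eval3 1 v = 1"
  using eval3_Const3[of 1 v] by (simp add: Const3_def)

lemma eval3_Var3 [simp]: "eval3 (Var3 i) v = v $ i"
proof -
  have "mono (Poly_Mapping.single i 1) v = v $ i"
    unfolding mono_def by (subst prod.remove[of _ i]) (auto simp: lookup_single when_def intro!: prod.neutral)
  then show ?thesis by (simp add: Var3_def eval3_single)
qed

lemma eval3_prod [simp]: "eval3 (\<Prod>i\<in>I. f i) v = (\<Prod>i\<in>I. eval3 (f i) v)"
  by (induction I rule: infinite_finite_induct) auto

lemma eval3_power [simp]: "eval3 (f ^ n) v = eval3 f v ^ n"
  by (induction n) auto

lemma eval3_minus [simp]: "eval3 (f - g) v = eval3 f v - eval3 g v" for f :: "'k::comm_ring_1 poly3"
  using eval3_add[of "f - g" g v] by (simp del: eval3_add add: eq_diff_eq)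

lemma eval3_subst3 [simp]: "eval3 (subst3 f P) v = eval3 f (\<chi> i. eval3 (P i) v)"
  by (simp add: subst3_def) (simp add: eval3_def)

lemma polyfun_eval3: "polyfun (eval3 f)"
  unfolding eval3_def by (intro polyfun_intros)

lemma polyfun_imp_poly3:
  assumes "polyfun \<phi>"
  obtains f where "\<And>v. eval3 f v = \<phi> v"
proof -
  have "\<exists>f. \<forall>v. eval3 f v = \<phi> v" using assms
  proof (induction rule: polyfun.induct)
    case (polyfun_const c)
    show ?case by (intro exI[of _ "Const3 c"]) simp
  next
    case (polyfun_coord i)
    show ?case by (intro exI[of _ "Var3 i"]) simp
  next
    case (polyfun_add f g)
    then show ?case by (metis eval3_add)
  next
    case (polyfun_mult f g)
    then show ?case by (metis eval3_mult)
  qed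
  then show ?thesis using that by blast
qed

text \<open>Kronecker substitution \<open>(t, t\<^sup>N, t\<^sup>M)\<close> with \<open>M = N\<^sup>2\<close> separates the monomials of a polynomial.\<close>

lemma eval3_eq_0_imp:
  fixes f :: "'k::alg_closed_field poly3"
  assumes "\<And>v. eval3 f v = 0"
  shows "f = 0"
proof -
  define N where "N = Suc (\<Sum>m\<in>Poly_Mapping.keys f. \<Sum>i\<in>UNIV. Poly_Mapping.lookup m i)"
  have N: "Poly_Mapping.lookup m i < N" if "m \<in> Poly_Mapping.keys f" for m i
  proof -
    have "Poly_Mapping.lookup m i \<le> (\<Sum>i\<in>UNIV. Poly_Mapping.lookup m i)" by (rule member_le_sum) auto
    also have "\<dots> \<le> (\<Sum>m\<in>Poly_Mapping.keys f. \<Sum>i\<in>UNIV. Poly_Mapping.lookup m i)"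
      using that by (intro member_le_sum[of m]) auto
    finally show ?thesis by (simp add: N_def)
  qed
  \<comment> \<open>The exponents are smaller than \<open>N\<close>, hence they are the
    base-\<open>N\<close> digits of \<open>\<kappa> m\<close>.\<close>
  define \<kappa> where "\<kappa> m = Poly_Mapping.lookup m (1::3) + N * (Poly_Mapping.lookup m 2 + N * Poly_Mapping.lookup m 3)" for m :: monom3
  have inj: "m = n" if mn: "m \<in> Poly_Mapping.keys f" "n \<in> Poly_Mapping.keys f" "\<kappa> m = \<kappa> n" for m n
  proof -
    have N0: "N > 0" by (simp add: N_def)
    have "\<kappa> m mod N = \<kappa> n mod N" "\<kappa> m div N = \<kappa> n div N" using mn(3) by simp_all
    then have 1: "Poly_Mapping.lookup m 1 = Poly_Mapping.lookup n 1"
      and q: "Poly_Mapping.lookup m 2 + N * Poly_Mapping.lookup m 3 = Poly_Mapping.lookup n 2 + N * Poly_Mapping.lookup n 3"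
      using N[OF mn(1), of 1] N[OF mn(2), of 1] N0 by (simp_all add: \<kappa>_def)
    from q have "(Poly_Mapping.lookup m 2 + N * Poly_Mapping.lookup m 3) mod N = (Poly_Mapping.lookup n 2 + N * Poly_Mapping.lookup n 3) mod N"
      by simp
    then have 2: "Poly_Mapping.lookup m 2 = Poly_Mapping.lookup n 2"
      using N[OF mn(1), of 2] N[OF mn(2), of 2] by simp
    with q N0 have 3: "Poly_Mapping.lookup m 3 = Poly_Mapping.lookup n 3" by simp
    show ?thesis
    proof (rule poly_mapping_eqI)
      fix j :: 3
      show "Poly_Mapping.lookup m j = Poly_Mapping.lookup n j"
        using exhaust_3[of j] 1 2 3 by (elim disjE) simp_all
    qed
  qed
  define p where "p = (\<Sum>m\<in>Poly_Mapping.keys f. monom (Poly_Mapping.lookup f m) (\<kappa> m))"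
  have "poly p t = 0" for t
  proof -
    have "mono m (vector [t, t ^ N, t ^ (N * N)]) = t ^ \<kappa> m" for m
    proof -
      have "mono m (vector [t, t ^ N, t ^ (N * N)]) = t ^ Poly_Mapping.lookup m 1 *
          ((t ^ N) ^ Poly_Mapping.lookup m 2 * (t ^ (N * N)) ^ Poly_Mapping.lookup m 3)"
        unfolding mono_def prod_UNIV_3 by (simp only: vector_3 mult.assoc)
      then show ?thesis unfolding \<kappa>_def distrib_left power_add power_mult .
    qed
    then have "poly p t = eval3 f (vector [t, t ^ N, t ^ (N * N)])"
      by (simp add: p_def poly_sum poly_monom eval3_mono)
    then show ?thesis using assms by simp
  qed
  then have "p = 0" by (intro poly_eqI_fun) simp
  have "Poly_Mapping.keys f = {}"
  proof (rule ccontr)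
    assume "Poly_Mapping.keys f \<noteq> {}"
    then obtain n where n: "n \<in> Poly_Mapping.keys f" by blast
    have "coeff p (\<kappa> n) = (\<Sum>m\<in>Poly_Mapping.keys f. if m = n then Poly_Mapping.lookup f m else 0)"
      unfolding p_def coeff_sum by (rule sum.cong) (use inj n in \<open>auto simp: coeff_monom\<close>)
    also have "\<dots> = Poly_Mapping.lookup f n" using n by simp
    finally show False using n \<open>p = 0\<close> by (simp add: in_keys_iff)
  qed
  then show ?thesis by simp
qed

lemma eval3_inject:
  fixes f g :: "'k::alg_closed_field poly3"
  assumes "\<And>v. eval3 f v = eval3 g v"
  shows "f = g"
  using eval3_eq_0_imp[of "f - g"] assms by simp

lemma poly3_nonzero:
  fixes f :: "'k::alg_closed_field poly3"
  assumes "f \<noteq> 0"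
  obtains v where "eval3 f v \<noteq> 0"
  using eval3_eq_0_imp[of f] assms by blast

lemma mono_scale: "mono m (c *s v) = c ^ monom_degree m * mono m v"
  by (simp add: mono_def monom_degree_def power_mult_distrib prod.distrib power_sum)

lemma eval3_homogeneous: "homogeneous n f \<Longrightarrow> eval3 f (c *s v) = c ^ n * eval3 f v"
  unfolding eval3_mono sum_distrib_left homogeneous_def
  by (rule sum.cong) (simp_all add: mono_scale mult_ac)

text \<open>Lets homogeneity be checked on values. Scaling the argument by \<open>c\<close>
  multiplies the coefficient at \<open>m\<close> by \<open>c ^ monom_degree m\<close>; comparison of
  coefficients for all \<open>c\<close> determines the exponent.\<close>

lemma homogeneousI:
  fixes f :: "'k::alg_closed_field poly3"
  assumes "\<And>c v. eval3 f (c *s v) = c ^ n * eval3 f v"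
  shows "homogeneous n f"
  unfolding homogeneous_def
proof
  fix m assume m: "m \<in> Poly_Mapping.keys f"
  let ?g = "\<lambda>h. \<Sum>m\<in>Poly_Mapping.keys f. Poly_Mapping.single m (h m * Poly_Mapping.lookup f m)"
  have look: "Poly_Mapping.lookup (?g h) m = h m * Poly_Mapping.lookup f m" for h
  proof -
    have "Poly_Mapping.lookup (?g h) m = (\<Sum>k\<in>Poly_Mapping.keys f. if k = m then h k * Poly_Mapping.lookup f k else 0)"
      by (simp add: lookup_sum lookup_single when_def)
    then show ?thesis using m by simp
  qed
  have "c ^ monom_degree m = c ^ n" for c :: 'k
  proof -
    have "?g (\<lambda>m. c ^ monom_degree m) = ?g (\<lambda>_. c ^ n)"
    proof (rule eval3_inject)
      fix v
      have "eval3 (?g (\<lambda>m. c ^ monom_degree m)) v = eval3 f (c *s v)"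
        by (simp add: eval3_single) (simp add: eval3_mono mono_scale mult_ac)
      moreover have "eval3 (?g (\<lambda>_. c ^ n)) v = c ^ n * eval3 f v"
        by (simp add: eval3_single) (simp add: eval3_mono sum_distrib_left mult_ac)
      ultimately show "eval3 (?g (\<lambda>m. c ^ monom_degree m)) v = eval3 (?g (\<lambda>_. c ^ n)) v"
        using assms by simp
    qed
    then have "c ^ monom_degree m * Poly_Mapping.lookup f m = c ^ n * Poly_Mapping.lookup f m"
      using look[of "\<lambda>m. c ^ monom_degree m"] look[of "\<lambda>_. c ^ n"] by (simp only:)
    then show ?thesis using m by (simp add: in_keys_iff)
  qed
  then have "monom (1::'k) (monom_degree m) = monom 1 n"
    by (intro poly_eqI_fun) (simp add: poly_monom)
  then show "monom_degree m = n" by (metis degree_monom_eq one_neq_zero)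
qed

section \<open>Formal derivatives and linear forms\<close>

lemma partial_deriv_single:
  "partial_deriv i (Poly_Mapping.single m c) =
    Poly_Mapping.single (m - Poly_Mapping.single i 1) (of_nat (Poly_Mapping.lookup m i) * c)"
  by (simp add: partial_deriv_def)

lemma partial_deriv_add: "partial_deriv i (f + g) = partial_deriv i f + partial_deriv i g"
  unfolding partial_deriv_def
  by (rule setsum_keys_plus_distrib) (simp_all add: distrib_left single_add)

lemma partial_deriv_mult:
  "partial_deriv i (f * g) = partial_deriv i f * g + f * partial_deriv i g"
proof (induction f rule: poly3_induct)
  case (single m c)
  show ?case
  proof (induction g rule: poly3_induct)
    case (single n d)
    let ?e = "Poly_Mapping.single i (1::nat)"
    \<comment> \<open>Truncated subtraction commutes with adding \<open>l\<close> only if the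
      variable occurs in \<open>k\<close>; otherwise both coefficients are zero.\<close>
    have shift: "Poly_Mapping.single (k - ?e + l) (of_nat (Poly_Mapping.lookup k i) * x) =
        Poly_Mapping.single (k + l - ?e) (of_nat (Poly_Mapping.lookup k i) * x)" for k l and x :: 'a
    proof (cases "Poly_Mapping.lookup k i = 0")
      case False
      have "k - ?e + l = k + l - ?e"
      proof (rule poly_mapping_eqI)
        fix j
        show "Poly_Mapping.lookup (k - ?e + l) j = Poly_Mapping.lookup (k + l - ?e) j"
          using False by (cases "j = i") (auto simp: lookup_add lookup_minus lookup_single when_def)
      qed
      then show ?thesis by simp
    qed simp
    have "partial_deriv i (Poly_Mapping.single m c * Poly_Mapping.single n d) =
        Poly_Mapping.single (m + n - ?e) (of_nat (Poly_Mapping.lookup m i) * (c * d)) +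
        Poly_Mapping.single (n + m - ?e) (of_nat (Poly_Mapping.lookup n i) * (c * d))"
      by (simp add: mult_single partial_deriv_single lookup_add distrib_right single_add add.commute[of n m])
    also have "\<dots> = Poly_Mapping.single (m - ?e + n) (of_nat (Poly_Mapping.lookup m i) * (c * d)) +
        Poly_Mapping.single (n - ?e + m) (of_nat (Poly_Mapping.lookup n i) * (c * d))"
      by (simp only: shift)
    also have "\<dots> = partial_deriv i (Poly_Mapping.single m c) * Poly_Mapping.single n d +
        Poly_Mapping.single m c * partial_deriv i (Poly_Mapping.single n d)"
      by (simp add: mult_single partial_deriv_single mult_ac add.commute)
    finally show ?case .
  qed (simp add: partial_deriv_add algebra_simps)
qed (simp add: partial_deriv_add algebra_simps)

lemma partial_deriv_Const3 [simp]: "partial_deriv i (Const3 c) = 0"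
  by (simp add: Const3_def partial_deriv_single)

lemma partial_deriv_one [simp]: "partial_deriv i 1 = 0"
  using partial_deriv_Const3[of i 1] by (simp add: Const3_def)

lemma partial_deriv_Var3: "partial_deriv i (Var3 j) = Const3 (if i = j then 1 else 0)"
  by (auto simp: Var3_def Const3_def partial_deriv_single lookup_single when_def)

definition lin :: "'k::field ^ 3 \<Rightarrow> 'k poly3" where
  "lin a = Const3 (a $ 1) * Var3 1 + Const3 (a $ 2) * Var3 2 + Const3 (a $ 3) * Var3 3"

lemma eval3_lin [simp]: "eval3 (lin a) v = dot a v"
  by (simp add: lin_def dot_def)

lemma eval3_partial_deriv_lin: "eval3 (partial_deriv i (lin a)) v = a $ i"
  using exhaust_3[of i] by (auto simp: lin_def partial_deriv_add partial_deriv_mult partial_deriv_Var3)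

lemma eval3_partial_deriv_prod_lin:
  assumes "finite A"
  shows "eval3 (partial_deriv i (\<Prod>a\<in>A. lin a)) v = gr A v $ i"
  using assms
proof (induction A rule: finite_induct)
  case empty
  show ?case by (simp add: gr_def)
next
  case (insert a A)
  have "gr (insert a A) v = pr A v *s a + dot a v *s gr A v"
    using gr_Un[of "{a}" A v] insert by (simp add: gr_def pr_def)
  with insert show ?case
    by (simp add: partial_deriv_mult eval3_partial_deriv_lin pr_def mult.commute)
qed

lemma homogeneous_lin: "homogeneous 1 (lin (a :: 'k::alg_closed_field ^ 3))"
  by (rule homogeneousI) simp

lemma lin_eq_0_iff [simp]: "lin (a :: 'k::alg_closed_field ^ 3) = 0 \<longleftrightarrow> a = 0"
proof
  assume "lin a = 0"
  then have "dot v a = 0" for v using eval3_lin[of a v] by (simp add: dot_commute)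
  then show "a = 0" by (rule eq_zero_if_dot)
qed (simp add: eval3_inject)

lemma linear_form_lin: "linear_form (lin a) \<longleftrightarrow> a \<noteq> 0" for a :: "'k::alg_closed_field ^ 3"
  using homogeneous_lin[of a] by (simp add: linear_form_def)

lemma linear_formE:
  fixes l :: "'k::alg_closed_field poly3"
  assumes "linear_form l"
  obtains a where "a \<noteq> 0" "l = lin a"
proof -
  have l: "l \<noteq> 0" "\<And>m. m \<in> Poly_Mapping.keys l \<Longrightarrow> monom_degree m = 1"
    using assms by (auto simp: linear_form_def homogeneous_def)
  have unit: "m = Poly_Mapping.single i 1"
    if "Poly_Mapping.lookup m i = 1" "\<And>j. j \<noteq> i \<Longrightarrow> Poly_Mapping.lookup m j = 0" for i and m :: monom3
    by (rule poly_mapping_eqI) (use that in \<open>auto simp: lookup_single when_def\<close>)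
  have key: "m = Poly_Mapping.single 1 1 \<or> m = Poly_Mapping.single 2 1 \<or> m = Poly_Mapping.single 3 1"
    if "m \<in> Poly_Mapping.keys l" for m
  proof -
    have "Poly_Mapping.lookup m 1 + Poly_Mapping.lookup m 2 + Poly_Mapping.lookup m 3 = 1"
      using l(2)[OF that] by (simp add: monom_degree_def sum_3)
    then consider "Poly_Mapping.lookup m 1 = 1" "Poly_Mapping.lookup m 2 = 0" "Poly_Mapping.lookup m 3 = 0"
      | "Poly_Mapping.lookup m 1 = 0" "Poly_Mapping.lookup m 2 = 1" "Poly_Mapping.lookup m 3 = 0"
      | "Poly_Mapping.lookup m 1 = 0" "Poly_Mapping.lookup m 2 = 0" "Poly_Mapping.lookup m 3 = 1"
      by linarith
    then show ?thesis
    proof cases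
      case 1
      then have "m = Poly_Mapping.single 1 1" by (intro unit) (metis exhaust_3)+
      then show ?thesis by simp
    next
      case 2
      then have "m = Poly_Mapping.single 2 1" by (intro unit) (metis exhaust_3)+
      then show ?thesis by simp
    next
      case 3
      then have "m = Poly_Mapping.single 3 1" by (intro unit) (metis exhaust_3)+
      then show ?thesis by simp
    qed
  qed
  have ne: "Poly_Mapping.single i 1 \<noteq> (Poly_Mapping.single j 1 :: monom3)" if "i \<noteq> j" for i j
    using that by (metis lookup_single_eq lookup_single_not_eq zero_neq_one)
  let ?e = "\<lambda>i. Poly_Mapping.single i 1 :: monom3"
  define a where "a = (\<chi> i. Poly_Mapping.lookup l (?e i))"
  have "l = (\<Sum>m\<in>{?e 1, ?e 2, ?e 3}. Poly_Mapping.single m (Poly_Mapping.lookup l m))"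
    by (subst sum_singles[of l, symmetric], rule sum.mono_neutral_left)
      (use key in \<open>auto simp: in_keys_iff\<close>)
  also have "\<dots> = lin a"
    using ne[of 1 2] ne[of 1 3] ne[of 2 3]
    by (simp add: lin_def a_def Const3_def Var3_def mult_single add.assoc)
  finally have "l = lin a" .
  moreover from this l(1) have "a \<noteq> 0" by auto
  ultimately show ?thesis using that by blast
qed

section \<open>Zero loci and reduced equations of line arrangements\<close>

lemma proj_point_eqD:
  assumes "proj_point v = proj_point w"
  obtains c where "c \<noteq> 0" "w = c *s v"
proof -
  have "w \<in> proj_point w" unfolding proj_point_def by (intro CollectI exI[of _ 1]) simp
  then have "w \<in> proj_point v" using assms by simp
  then show ?thesis using that unfolding proj_point_def by blast
qed

lemma proj_point_in_zero_locus:
  assumes "homogeneous n f" "w \<noteq> 0"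
  shows "proj_point w \<in> zero_locus f \<longleftrightarrow> eval3 f w = 0"
proof
  assume "proj_point w \<in> zero_locus f"
  then obtain v where v: "proj_point w = proj_point v" "eval3 f v = 0" unfolding zero_locus_def by blast
  obtain c where "c \<noteq> 0" "v = c *s w" by (rule proj_point_eqD[OF v(1)])
  then show "eval3 f w = 0" using v(2) eval3_homogeneous[OF assms(1)] by simp
next
  assume "eval3 f w = 0"
  then show "proj_point w \<in> zero_locus f" unfolding zero_locus_def using assms(2) by blast
qed

lemma proj_point_in_line:
  fixes w :: "'k::alg_closed_field ^ 3"
  shows "w \<noteq> 0 \<Longrightarrow> proj_point w \<in> zero_locus (lin a) \<longleftrightarrow> dot a w = 0"
  using proj_point_in_zero_locus[OF homogeneous_lin] by simp

lemma exists_crs_eq: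
  assumes "(a :: 'k::field ^ 3) \<noteq> 0" "dot a v = 0"
  obtains w where "v = crs a w"
proof -
  obtain b where "dot a b = 1" using exists_dot_eq_1[OF assms(1)] by blast
  then have "v = crs a (crs v b)" using assms(2) by (simp add: crs_crs)
  then show ?thesis by (rule that)
qed

lemma zero_locus_lin_eq_iff:
  fixes a b :: "'k::alg_closed_field ^ 3"
  assumes "a \<noteq> 0" "b \<noteq> 0"
  shows "zero_locus (lin a) = zero_locus (lin b) \<longleftrightarrow> crs a b = 0"
proof
  assume eq: "zero_locus (lin a) = zero_locus (lin b)"
  show "crs a b = 0"
  proof (rule ccontr)
    assume "crs a b \<noteq> 0"
    then obtain w where w: "dot (crs a b) w = 1" using exists_dot_eq_1 by blast
    have d: "dot b (crs a w) = - 1" using w by (simp add: dot_def algebra_simps)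
    then have "crs a w \<noteq> 0" by auto
    then show False using proj_point_in_line[of "crs a w" a] proj_point_in_line[of "crs a w" b] eq d by simp
  qed
next
  assume "crs a b = 0"
  then obtain c where "b = c *s a" using crs_eq_0_imp assms(1) by blast
  then show "zero_locus (lin a) = zero_locus (lin b)" using assms(2) by (auto simp: zero_locus_def)
qed

lemma zero_locus_prod_lin:
  "finite A \<Longrightarrow> zero_locus (\<Prod>a\<in>A. lin a) = (\<Union>a\<in>A. zero_locus (lin a))"
  unfolding zero_locus_def by auto

text \<open>The quotient is obtained as a polynomial function from \<open>polyfun_div_perp\<close>
  and converted back into a polynomial.\<close>

lemma lin_dvd_iff:
  fixes a :: "'k::alg_closed_field ^ 3"
  assumes "a \<noteq> 0"
  shows "lin a dvd f \<longleftrightarrow> (\<forall>v. dot a v = 0 \<longrightarrow> eval3 f v = 0)"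
proof
  assume "\<forall>v. dot a v = 0 \<longrightarrow> eval3 f v = 0"
  then obtain q where q: "polyfun q" "\<And>v. eval3 f v = dot a v * q v"
    using polyfun_div_perp[OF polyfun_eval3[of f] assms] by metis
  obtain g where "\<And>v. eval3 g v = q v" by (rule polyfun_imp_poly3[OF q(1)]) (rule that)
  then have "f = lin a * g" by (intro eval3_inject) (simp add: q(2))
  then show "lin a dvd f" by simp
qed (auto elim!: dvdE)

text \<open>Linear forms are prime: \<open>crs a w\<close> parametrizes the plane
  \<open>dot a v = 0\<close>, so restriction to the plane yields polynomial functions on all of
  three-space, to which \<open>polyfun_zero_product\<close> applies.\<close>

lemma lin_dvd_mult:
  fixes a :: "'k::alg_closed_field ^ 3"
  assumes a: "a \<noteq> 0" and dvd: "lin a dvd f * g"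
  shows "lin a dvd f \<or> lin a dvd g"
proof -
  have pf: "polyfun (\<lambda>w. eval3 h (crs a w))" for h
  proof (rule polyfun_comp[OF polyfun_eval3])
    show "polyfun (\<lambda>w. crs a w $ i)" for i using exhaust_3[of i] by (auto intro!: polyfun_intros)
  qed
  have "eval3 f (crs a w) * eval3 g (crs a w) = 0" for w
    using dvd lin_dvd_iff[OF a, of "f * g"] by simp
  then have "(\<forall>w. eval3 f (crs a w) = 0) \<or> (\<forall>w. eval3 g (crs a w) = 0)"
    by (rule polyfun_zero_product[OF pf pf])
  then show ?thesis using lin_dvd_iff[OF a] exists_crs_eq[OF a] by metis
qed

lemma lin_cancel:
  fixes a :: "'k::alg_closed_field ^ 3"
  assumes "a \<noteq> 0" "lin a * f = lin a * g"
  shows "f = g"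
proof (rule eval3_inject)
  fix v
  obtain u where u: "dot a u = 1" using exists_dot_eq_1[OF assms(1)] by blast
  have "dot a w * eval3 f w = dot a w * eval3 g w" for w
    using arg_cong[OF assms(2), of "\<lambda>h. eval3 h w"] by simp
  note eq = this
  have "dot a u \<noteq> 0" using u by simp
  from polyfun_cancel[OF polyfun_dot(1)[of a] polyfun_eval3[of f] polyfun_eval3[of g] this eq]
  show "eval3 f v = eval3 g v" .
qed

context arrangement
begin

lemma vec_nonzero: "a \<in> A \<Longrightarrow> a \<noteq> 0"
  using nonzero by auto

lemma lin_not_dvd_prod:
  assumes "S \<subseteq> A" "a \<in> A" "a \<notin> S"
  shows "\<not> lin a dvd (\<Prod>b\<in>S. lin b)"
proof -
  obtain v where v: "dot a v = 0" "\<And>b. b \<in> A - {a} \<Longrightarrow> dot b v \<noteq> 0"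
    by (rule generic_point[OF assms(2)]) (rule that)
  have "finite S" using assms(1) finite finite_subset by blast
  then have "eval3 (\<Prod>b\<in>S. lin b) v \<noteq> 0" using v(2) assms by auto
  then show ?thesis using lin_dvd_iff[OF vec_nonzero[OF assms(2)]] v(1) by blast
qed

lemma prod_lin_dvd:
  assumes "\<And>a. a \<in> A \<Longrightarrow> lin a dvd f"
  shows "(\<Prod>a\<in>A. lin a) dvd f"
proof -
  have "(\<Prod>a\<in>S. lin a) dvd f" if "finite S" "S \<subseteq> A" for S
    using that
  proof (induction S rule: finite_induct)
    case (insert a S)
    then obtain g where g: "f = (\<Prod>b\<in>S. lin b) * g" by (auto elim!: dvdE)
    have "lin a dvd (\<Prod>b\<in>S. lin b) * g" using assms[of a] insert g by simp
    then have "lin a dvd g"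
      using lin_dvd_mult[OF vec_nonzero] lin_not_dvd_prod[of S a] insert by blast
    then obtain g' where "g = lin a * g'" by (elim dvdE)
    then have "f = (\<Prod>b\<in>insert a S. lin b) * g'" using g insert by (simp add: mult_ac)
    then show ?case by simp
  qed simp
  then show ?thesis using finite by blast
qed

lemma eval3_prod_lin: "eval3 (\<Prod>a\<in>A. lin a) v = pr A v"
  by (simp add: pr_def)

lemma homogeneous_prod_lin: "homogeneous (card A) (\<Prod>a\<in>A. lin a)"
  by (rule homogeneousI) (simp only: eval3_prod_lin pr_scale)

text \<open>An elementary substitute for the Nullstellensatz. The product of the lines divides
  \<open>f\<close>, and squarefreeness keeps the cofactor from vanishing on any of them. If the
  cofactor had positive degree, a general line would contain one of its zeros outside the
  arrangement, where \<open>f\<close> does not vanish.\<close>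

lemma reduced_equation_unique:
  assumes ne: "A \<noteq> {}" and f: "homogeneous D f" "D \<ge> 1" "squarefree f"
    and zl: "zero_locus f = zero_locus (\<Prod>a\<in>A. lin a)"
  obtains c where "c \<noteq> 0" "f = Const3 c * (\<Prod>a\<in>A. lin a)"
proof -
  have f0: "f \<noteq> 0" using f(3) by auto
  have zero: "eval3 f v = 0 \<longleftrightarrow> pr A v = 0" if "v \<noteq> 0" for v
    using proj_point_in_zero_locus[OF f(1) that] proj_point_in_zero_locus[OF homogeneous_prod_lin that] zl
    by (simp add: pr_def)
  have at0: "eval3 f 0 = 0" using eval3_homogeneous[OF f(1), of 0 0] f(2) by (simp add: power_0_left)
  have "lin a dvd f" if a: "a \<in> A" for a
    unfolding lin_dvd_iff[OF vec_nonzero[OF a]]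
  proof (intro allI impI)
    fix v assume "dot a v = 0"
    then have "pr A v = 0" using a finite by (auto simp: pr_eq_0_iff)
    then show "eval3 f v = 0" using zero at0 by (cases "v = 0") auto
  qed
  then have "(\<Prod>a\<in>A. lin a) dvd f" by (rule prod_lin_dvd)
  then obtain r where r: "f = (\<Prod>a\<in>A. lin a) * r" by (elim dvdE)
  have fr: "eval3 f v = pr A v * eval3 r v" for v by (simp add: r pr_def)
  have not_dvd: "\<not> lin a dvd r" if a: "a \<in> A" for a
  proof
    assume "lin a dvd r"
    then obtain r' where "r = lin a * r'" by (elim dvdE)
    then have "f = lin a ^ 2 * ((\<Prod>b\<in>A-{a}. lin b) * r')"
      unfolding r using a finite by (simp add: prod.remove power2_eq_square mult_ac)
    then have "lin a dvd 1" using f(3) unfolding squarefree_def by (metis dvd_triv_left)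
    then obtain s where s: "1 = lin a * s" by (elim dvdE)
    have "eval3 1 0 = eval3 (lin a * s) (0 :: 'k ^ 3)" using s by simp
    then show False by simp
  qed
  obtain u where u: "eval3 f u \<noteq> 0" by (rule poly3_nonzero[OF f0])
  let ?r = "eval3 r"
  have w: "weighted (card A) D ?r"
    unfolding weighted_def
  proof (intro allI)
    fix c Y
    have pf: "polyfun (\<lambda>Y. ?r (c *s Y))" by (rule polyfun_comp[OF polyfun_eval3]) (auto intro!: polyfun_intros)
    show "c ^ card A * ?r (c *s Y) = c ^ D * ?r Y"
    proof (rule polyfun_cancel[of "pr A" "\<lambda>Y. c ^ card A * ?r (c *s Y)" "\<lambda>Y. c ^ D * ?r Y" u])
      show "pr A u \<noteq> 0" using u fr by auto
      fix Y
      have "pr A (c *s Y) * ?r (c *s Y) = c ^ D * (pr A Y * ?r Y)"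
        using eval3_homogeneous[OF f(1), of c Y] by (simp add: fr)
      then show "pr A Y * (c ^ card A * ?r (c *s Y)) = pr A Y * (c ^ D * ?r Y)"
        by (simp add: pr_scale mult_ac)
    qed (intro polyfun_intros pf polyfun_eval3)+
  qed
  have scale: "?r (c *s Y) \<noteq> 0" if "c \<noteq> 0" "?r Y \<noteq> 0" for c Y
  proof -
    have "c ^ card A * ?r (c *s Y) = c ^ D * ?r Y" using w unfolding weighted_def by blast
    then show ?thesis using that by auto
  qed
  have bf: "bform (D - card A) (\<lambda>x t. ?r (x *s p + t *s q))" for p q
    by (rule bform_plane[OF polyfun_eval3 w])
  have uA: "dot a u \<noteq> 0" if "a \<in> A" for a using u fr[of u] that finite by (auto simp: pr_eq_0_iff)
  have "D - card A = 0"
  proof (rule ccontr)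
    assume "D - card A \<noteq> 0"
    then obtain m where m: "D - card A = Suc m" by (cases "D - card A") auto
    \<comment> \<open>The cofactor at the intersection of \<open>a\<close> with the line joining
      \<open>u\<close> and \<open>q\<close>; for general \<open>q\<close> it is nonzero for every
      \<open>a\<close>.\<close>
    let ?\<rho> = "\<lambda>a q. ?r (dot a q *s u - dot a u *s q)"
    have "\<exists>q. \<forall>a\<in>A. ?\<rho> a q \<noteq> 0"
    proof (rule polyfun_avoid[OF finite])
      fix a assume a: "a \<in> A"
      show "polyfun (?\<rho> a)" by (rule polyfun_comp[OF polyfun_eval3]) (auto intro!: polyfun_intros)
      obtain v where v: "dot a v = 0" "?r v \<noteq> 0"
        using not_dvd[OF a] lin_dvd_iff[OF vec_nonzero[OF a]] by blast
      have "?r ((- dot a u) *s v) \<noteq> 0" by (rule scale) (use uA[OF a] v in auto)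
      then have "?\<rho> a v \<noteq> 0" using v(1) by simp
      then show "\<exists>q. ?\<rho> a q \<noteq> 0" by blast
    qed
    then obtain q where q: "\<And>a. a \<in> A \<Longrightarrow> ?\<rho> a q \<noteq> 0" by blast
    obtain x t where xt: "(x, t) \<noteq> (0, 0)" "?r (x *s u + t *s q) = 0"
      by (rule bform_zero_exists[OF bf[of u q, unfolded m]]) (rule that)
    let ?P = "x *s u + t *s q"
    obtain a0 where a0: "a0 \<in> A" using ne by blast
    have key: "dot a ?P \<noteq> 0" if a: "a \<in> A" for a
    proof
      assume z: "dot a ?P = 0"
      then have t: "t \<noteq> 0" using xt(1) uA[OF a] by auto
      have x: "x = - (t / dot a u) * dot a q" using z uA[OF a] by (simp add: field_simps eq_neg_iff_add_eq_0)
      have "?P = (- t / dot a u) *s (dot a q *s u - dot a u *s q)"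
        using uA[OF a] unfolding x by (simp add: vec.scale_right_diff_distrib)
      then show False using xt(2) scale[OF _ q[OF a], of "- t / dot a u"] t uA[OF a] by simp
    qed
    then have "?P \<noteq> 0" using a0 by force
    moreover have "pr A ?P \<noteq> 0" using key finite by (simp add: pr_eq_0_iff)
    ultimately show False using zero[of ?P] fr[of ?P] xt(2) by simp
  qed
  have const: "?r v = ?r 0" for v
    using bform_const[OF bf[of v 0, unfolded \<open>D - card A = 0\<close>], of 1 0] by simp
  have "f = Const3 (?r 0) * (\<Prod>a\<in>A. lin a)"
  proof (rule eval3_inject)
    fix v
    have "eval3 f v = pr A v * ?r 0" using fr const by metis
    then show "eval3 f v = eval3 (Const3 (?r 0) * (\<Prod>a\<in>A. lin a)) v" by (simp add: pr_def mult.commute)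
  qed
  moreover have "?r 0 \<noteq> 0" using u fr[of u] const[of u] by auto
  ultimately show ?thesis using that by blast
qed

end

section \<open>From homaloidal curves to the combinatorial classification\<close>

lemma line_arrangementE:
  fixes F :: "('k::alg_closed_field ^ 3) set set"
  assumes "line_arrangement F"
  obtains A where "arrangement A" "A \<noteq> {}" "F = zero_locus (\<Prod>a\<in>A. lin a)"
proof -
  obtain d :: nat and l :: "nat \<Rightarrow> 'k poly3" where dl: "d \<ge> 1 \<and> (\<forall>i<d. linear_form (l i)) \<and>
      (\<forall>i<d. \<forall>j<d. i \<noteq> j \<longrightarrow> \<not> proportional (l i) (l j)) \<and> F = zero_locus (\<Prod>i<d. l i)"
    using assms unfolding line_arrangement_def by (elim exE conjE) auto
  then have d: "d \<ge> 1" and l: "\<And>i. i < d \<Longrightarrow> linear_form (l i)"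
    "\<And>i j. i < d \<Longrightarrow> j < d \<Longrightarrow> i \<noteq> j \<Longrightarrow> \<not> proportional (l i) (l j)"
    and F: "F = zero_locus (\<Prod>i<d. l i)" by auto
  have "\<forall>i. \<exists>a. i < d \<longrightarrow> a \<noteq> 0 \<and> l i = lin a" using l(1) by (metis linear_formE)
  then obtain a where a: "\<And>i. i < d \<Longrightarrow> a i \<noteq> 0" "\<And>i. i < d \<Longrightarrow> l i = lin (a i)" by metis
  have nonpar: "crs (a i) (a j) \<noteq> 0" if ij: "i < d" "j < d" "i \<noteq> j" for i j
  proof
    assume "crs (a i) (a j) = 0"
    then obtain c where c: "a j = c *s a i" using crs_eq_0_imp a(1)[OF ij(1)] by blast
    then have "c \<noteq> 0" using a(1)[OF ij(2)] by auto
    moreover have "lin (a j) = Const3 c * lin (a i)" by (rule eval3_inject) (simp add: c)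
    ultimately have "proportional (l j) (l i)" unfolding proportional_def using a ij by auto
    then show False using l(2) ij by simp
  qed
  have inj: "inj_on a {..<d}" by (rule inj_onI) (metis dot_crs(5) lessThan_iff nonpar)
  let ?A = "a ` {..<d}"
  have "arrangement ?A"
  proof
    show "0 \<notin> ?A" using a(1) by (metis imageE lessThan_iff)
    show "crs u v \<noteq> 0" if "u \<in> ?A" "v \<in> ?A" "u \<noteq> v" for u v using that nonpar by auto
  qed simp
  moreover have "?A \<noteq> {}" using d by (auto simp: lessThan_empty_iff)
  moreover have "(\<Prod>i<d. l i) = (\<Prod>v\<in>?A. lin v)" using a(2) by (simp add: prod.reindex[OF inj])
  ultimately show ?thesis using that F by simp
qed

text \<open>The scalar \<open>c\<close> only contributes a factor \<open>c ^ e\<close> by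
  homogeneity. If all lines passed through \<open>z\<close>, the gradient would always be orthogonal
  to \<open>z\<close>, which the composite with the right inverse, being the identity, rules
  out.\<close>

lemma (in arrangement) polar_inverse_if_birational:
  assumes bir: "birational (polar_map f)" and f: "c \<noteq> 0" "f = Const3 c * (\<Prod>a\<in>A. lin a)"
  obtains Q e where "polar_inverse A Q e"
proof -
  let ?P = "polar_map f"
  have P: "eval3 (?P i) v = (c *s gr A v) $ i" for i v
    unfolding polar_map_def f by (simp add: partial_deriv_mult eval3_partial_deriv_prod_lin[OF finite])
  then have Pv: "(\<chi> i. eval3 (?P i) v) = c *s gr A v" for v by (simp add: vec_eq_iff)
  obtain Q where Q: "rational_map Q" "rational_map (comp_map Q ?P)" "same_rational_map (comp_map Q ?P) Var3"
    "rational_map (comp_map ?P Q)" "same_rational_map (comp_map ?P Q) Var3"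
    using bir unfolding birational_def by blast
  obtain e where e: "\<And>i. homogeneous e (Q i)" using Q(1) unfolding rational_map_def by blast
  have QP: "eval3 (comp_map Q ?P i) v = c ^ e * eval3 (Q i) (gr A v)" for i v
    unfolding comp_map_def by (simp add: Pv eval3_homogeneous[OF e])
  have PQ: "eval3 (comp_map ?P Q i) v = (c *s gr A (\<chi> i. eval3 (Q i) v)) $ i" for i v
    unfolding comp_map_def eval3_subst3 P ..
  have "polar_inverse A (\<lambda>i. eval3 (Q i)) e"
  proof
    show "polyfun (eval3 (Q i))" for i by (rule polyfun_eval3)
    show "eval3 (Q i) (c *s Y) = c ^ e * eval3 (Q i) Y" for i c Y by (rule eval3_homogeneous[OF e])
    show "eval3 (Q i) (gr A v) * v $ j = eval3 (Q j) (gr A v) * v $ i" for i j v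
    proof -
      have "comp_map Q ?P i * Var3 j = comp_map Q ?P j * Var3 i"
        using Q(3) unfolding same_rational_map_def by blast
      then have "eval3 (comp_map Q ?P i * Var3 j) v = eval3 (comp_map Q ?P j * Var3 i) v" by simp
      then show ?thesis using f(1) by (simp add: QP)
    qed
    show "\<exists>i v. eval3 (Q i) (gr A v) \<noteq> 0"
    proof -
      obtain i where "comp_map Q ?P i \<noteq> 0" using Q(2) unfolding rational_map_def by blast
      then obtain v where "eval3 (comp_map Q ?P i) v \<noteq> 0" by (rule poly3_nonzero)
      then show ?thesis unfolding QP by auto
    qed
    show "\<exists>a\<in>A. dot a z \<noteq> 0" if z: "z \<noteq> 0" for z
    proof (rule ccontr)
      assume "\<not> (\<exists>a\<in>A. dot a z \<noteq> 0)"
      then have z0: "dot z (gr A v) = 0" for v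
        unfolding dot_gr by (intro sum.neutral) (auto simp: dot_commute[of z])
      let ?R = "\<lambda>v. \<chi> i. eval3 (comp_map ?P Q i) v"
      have R: "dot z (?R v) = 0" for v
      proof -
        have "?R v = c *s gr A (\<chi> i. eval3 (Q i) v)" by (simp add: vec_eq_iff PQ)
        then show ?thesis using z0 by simp
      qed
      obtain i where i: "comp_map ?P Q i \<noteq> 0" using Q(4) unfolding rational_map_def by blast
      then obtain v0 where v0: "eval3 (comp_map ?P Q i) v0 \<noteq> 0" by (rule poly3_nonzero)
      have "eval3 (comp_map ?P Q i) v * dot z v = 0" for v
      proof -
        have "?R v $ i * v $ j = ?R v $ j * v $ i" for i j
        proof -
          have "comp_map ?P Q i * Var3 j = comp_map ?P Q j * Var3 i"
            using Q(5) unfolding same_rational_map_def by blast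
          then have "eval3 (comp_map ?P Q i * Var3 j) v = eval3 (comp_map ?P Q j * Var3 i) v" by simp
          then show ?thesis by simp
        qed
        from dot_cross_identity[of "?R v" v "axis i 1" z, OF this] R[of v] show ?thesis by simp
      qed
      then have "(\<forall>v. eval3 (comp_map ?P Q i) v = 0) \<or> (\<forall>v. dot z v = 0)"
        by (rule polyfun_zero_product[OF polyfun_eval3 polyfun_dot(1)])
      then show False using v0 exists_dot_eq_1[OF z] by (metis zero_neq_one)
    qed
  qed
  then show ?thesis by (rule that)
qed

lemma line_zero_locus_lin: "a \<noteq> 0 \<Longrightarrow> line (zero_locus (lin a))" for a :: "'k::alg_closed_field ^ 3"
  unfolding line_def using linear_form_lin by blast

lemma homaloidal_arrangement_type:
  fixes F :: "('k::alg_closed_field ^ 3) set set"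
  assumes "line_arrangement F" "homaloidal_curve F"
  shows "three_general_lines F \<or> (\<exists>n\<ge>1. CHAR('k) dvd n \<and> near_pencil n F)"
proof -
  obtain A where A: "arrangement A" "A \<noteq> {}" "F = zero_locus (\<Prod>a\<in>A. lin a)"
    by (rule line_arrangementE[OF assms(1)])
  interpret arrangement A by (rule A(1))
  obtain f where f: "reduced_equation f F" "homaloidal f" using assms(2) unfolding homaloidal_curve_def by blast
  then obtain D where D: "homogeneous D f" "D \<ge> 1" "squarefree f" "F = zero_locus f"
    unfolding reduced_equation_def by blast
  obtain c where c: "c \<noteq> 0" "f = Const3 c * (\<Prod>a\<in>A. lin a)"
    by (rule reduced_equation_unique[OF A(2) D(1-3) D(4)[symmetric, unfolded A(3)]])
  have "birational (polar_map f)" using f(2) by (simp add: homaloidal_def)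
  then obtain Q e where "polar_inverse A Q e" by (rule polar_inverse_if_birational[OF _ c])
  then interpret polar_inverse A Q e .
  have FU: "F = (\<Union>a\<in>A. zero_locus (lin a))" using A(3) zero_locus_prod_lin[OF finite] by simp
  consider "card A = 3" | a0 z where "CHAR('k) dvd card A - 1" "a0 \<in> A" "z \<noteq> 0" "inc z = A - {a0}"
    using classification[OF refl] by blast
  then show ?thesis
  proof cases
    case 1
    then obtain a b d where abd: "A = {a, b, d}" "a \<noteq> b" "a \<noteq> d" "b \<noteq> d" by (auto simp: card_3_iff)
    let ?Z = "\<lambda>a. zero_locus (lin a)"
    have nz: "a \<noteq> 0" "b \<noteq> 0" "d \<noteq> 0" using abd(1) vec_nonzero by auto
    have "?Z a \<inter> ?Z b \<inter> ?Z d = {}"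
    proof (rule ccontr)
      assume "?Z a \<inter> ?Z b \<inter> ?Z d \<noteq> {}"
      then obtain x where x: "x \<in> ?Z a" "x \<in> ?Z b" "x \<in> ?Z d" by blast
      obtain v where v: "v \<noteq> 0" "x = proj_point v" using x(1) unfolding zero_locus_def by blast
      have "dot a v = 0" "dot b v = 0" "dot d v = 0" using x v proj_point_in_line[OF v(1)] by auto
      then show False using not_concurrent[OF v(1)] abd(1) by auto
    qed
    moreover have "?Z a \<noteq> ?Z b" "?Z a \<noteq> ?Z d" "?Z b \<noteq> ?Z d"
      using zero_locus_lin_eq_iff[OF nz(1,2)] zero_locus_lin_eq_iff[OF nz(1,3)] zero_locus_lin_eq_iff[OF nz(2,3)]
        nonparallel[of a b] nonparallel[of a d] nonparallel[of b d] abd by auto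
    moreover have "F = ?Z a \<union> ?Z b \<union> ?Z d" using FU abd(1) by auto
    ultimately have "three_general_lines F"
      unfolding three_general_lines_def using line_zero_locus_lin nz by blast
    then show ?thesis ..
  next
    case (2 a0 z)
    let ?Z = "\<lambda>a. zero_locus (lin a)"
    let ?L = "?Z ` (A - {a0})"
    have inj: "inj_on ?Z (A - {a0})"
      by (rule inj_onI) (metis DiffD1 nonparallel vec_nonzero zero_locus_lin_eq_iff)
    have cardL: "card ?L = card A - 1" using inj 2(2) finite by (simp add: card_image)
    have a0z: "dot a0 z \<noteq> 0" using 2(2,4) by (auto simp: inc_def)
    have "near_pencil (card A - 1) F"
      unfolding near_pencil_def
    proof (intro bexI[of _ "proj_point z"] exI conjI ballI)
      show "finite ?L" using finite by simp
      show "card ?L = card A - 1" by (rule cardL)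
      show "line L" "proj_point z \<in> L" if L: "L \<in> ?L" for L
      proof -
        obtain a where a: "a \<in> A - {a0}" "L = ?Z a" using L by blast
        then have "a \<in> inc z" using 2(4) by simp
        then have "dot a z = 0" "a \<noteq> 0" using vec_nonzero by (auto simp: inc_def)
        then show "line L" "proj_point z \<in> L" using a(2) line_zero_locus_lin proj_point_in_line[OF 2(3)] by auto
      qed
      show "line (?Z a0)" using line_zero_locus_lin vec_nonzero[OF 2(2)] by blast
      show "proj_point z \<notin> ?Z a0" using a0z proj_point_in_line[OF 2(3)] by blast
      show "F = \<Union>?L \<union> ?Z a0" unfolding FU using 2(2) by auto
      show "proj_point z \<in> proj_plane" unfolding proj_plane_def using 2(3) by blast
    qed
    moreover have "card A - 1 \<ge> 1"
    proof -
      have "through a0 \<noteq> {}" using two_through[OF 2(2)] by auto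
      then obtain T where "T \<in> blocks" by (auto simp: through_def)
      then have "card T \<ge> 2" "card T \<le> card A" using block_card block_subset finite by (auto intro: card_mono)
      then show ?thesis by simp
    qed
    ultimately show ?thesis using 2(1) by blast
  qed
qed

section \<open>The homaloidal arrangements\<close>

text \<open>In \<open>x * x * y\<close> a line dividing \<open>x\<close> would occur twice and hence
  divide the product of the other lines. So every line divides \<open>y\<close> and can be stripped
  off, until \<open>x\<close> divides 1.\<close>

lemma (in arrangement) squarefree_prod_lin: "squarefree (\<Prod>a\<in>A. lin a)"
proof -
  have "x dvd 1" if "finite S" "S \<subseteq> A" "x * x * y = (\<Prod>a\<in>S. lin a)" for S x y
    using that
  proof (induction S arbitrary: y rule: finite_induct)
    case empty
    then have "1 = x * (x * y)" by (simp add: mult.assoc)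
    then show ?case by (metis dvd_triv_left)
  next
    case (insert a S)
    have a: "a \<in> A" "a \<noteq> 0" using insert.prems vec_nonzero by auto
    have eq: "x * x * y = lin a * (\<Prod>b\<in>S. lin b)" using insert by simp
    then have "lin a dvd (x * x) * y" by simp
    then consider "lin a dvd x" | "lin a dvd y" using lin_dvd_mult[OF a(2)] by blast
    then show ?case
    proof cases
      case 1
      then obtain x' where "x = lin a * x'" by (elim dvdE)
      then have "lin a * (lin a * (x' * x' * y)) = lin a * (\<Prod>b\<in>S. lin b)"
        using eq by (simp add: mult_ac)
      then have "lin a * (x' * x' * y) = (\<Prod>b\<in>S. lin b)" by (rule lin_cancel[OF a(2)])
      then have "lin a dvd (\<Prod>b\<in>S. lin b)" by (metis dvd_triv_left)
      then show ?thesis using lin_not_dvd_prod[of S a] a insert by blast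
    next
      case 2
      then obtain y' where "y = lin a * y'" by (elim dvdE)
      then have "lin a * (x * x * y') = lin a * (\<Prod>b\<in>S. lin b)" using eq by (simp add: mult_ac)
      then have "x * x * y' = (\<Prod>b\<in>S. lin b)" by (rule lin_cancel[OF a(2)])
      then show ?thesis using insert by blast
    qed
  qed
  then show ?thesis
    unfolding squarefree_def power2_eq_square using finite by (metis dvdE order_refl)
qed

lemma nonconstant_eval3:
  fixes h :: "'k::alg_closed_field poly3"
  assumes "total_degree h > 0"
  obtains u where "eval3 h u \<noteq> eval3 h v"
proof -
  have "\<exists>u. eval3 h u \<noteq> eval3 h v"
  proof (rule ccontr)
    assume "\<nexists>u. eval3 h u \<noteq> eval3 h v"
    then have "h = Const3 (eval3 h v)" by (intro eval3_inject) simp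
    moreover have "total_degree (Const3 c) = 0" for c :: 'k
      by (simp add: total_degree_def Const3_def monom_degree_def)
    ultimately show False using assms by (metis less_irrefl)
  qed
  then show ?thesis using that by blast
qed

text \<open>
  A common factor of the partial derivatives vanishes somewhere on an affine line that avoids the
  finitely many zeros of the polar map.
\<close>

lemma (in arrangement) no_fixed_component_polar:
  assumes two: "card A \<ge> 2"
    and sing: "\<And>v. v \<noteq> 0 \<Longrightarrow> gr A v = 0 \<Longrightarrow> card (inc v) \<ge> 2"
  shows "no_fixed_component (polar_map (\<Prod>a\<in>A. lin a))"
  unfolding no_fixed_component_def
proof (rule notI, elim exE conjE)
  fix h assume h: "total_degree h > 0" "\<forall>i. h dvd polar_map (\<Prod>a\<in>A. lin a) i"
  have zero: "gr A v = 0" if "eval3 h v = 0" for v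
  proof -
    have "gr A v $ i = 0" for i
    proof -
      obtain k where "polar_map (\<Prod>a\<in>A. lin a) i = h * k" using h(2) by (meson dvdE)
      then have "eval3 (polar_map (\<Prod>a\<in>A. lin a) i) v = eval3 (h * k) v" by simp
      then show ?thesis using that by (simp add: polar_map_def eval3_partial_deriv_prod_lin[OF finite])
    qed
    then show ?thesis by (simp add: vec_eq_iff)
  qed
  have "\<exists>p. \<forall>a\<in>A. dot a p \<noteq> 0"
  proof (rule polyfun_avoid[OF finite])
    show "\<exists>p. dot a p \<noteq> 0" if "a \<in> A" for a
      using exists_dot_eq_1[OF vec_nonzero[OF that]] by (metis zero_neq_one)
  qed (rule polyfun_dot)
  then obtain p where p: "\<And>a. a \<in> A \<Longrightarrow> dot a p \<noteq> 0" by blast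
  let ?I = "{(a, b). a \<in> A \<and> b \<in> A \<and> a \<noteq> b}"
  \<comment> \<open>The first condition makes \<open>h\<close> nonconstant on the affine line
    \<open>p + t *s q\<close>, so that it has a zero there. The others keep this line off all
    intersection points \<open>crs a b\<close>.\<close>
  let ?\<phi> = "\<lambda>i q. case i of None \<Rightarrow> eval3 h (p + q) - eval3 h p | Some (a, b) \<Rightarrow> dot (crs (crs a b) p) q"
  have "finite (insert None (Some ` ?I))"
  proof -
    have "?I \<subseteq> A \<times> A" by auto
    then show ?thesis using finite by (simp add: finite_subset)
  qed
  then have "\<exists>q. \<forall>i\<in>insert None (Some ` ?I). ?\<phi> i q \<noteq> 0"
  proof (rule polyfun_avoid)
    fix i assume i: "i \<in> insert None (Some ` ?I)"
    have "polyfun (\<lambda>q. eval3 h (p + q))"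
      by (rule polyfun_comp[OF polyfun_eval3]) (auto intro!: polyfun_intros)
    then show "polyfun (?\<phi> i)"
      by (cases i) (auto intro: polyfun_diff polyfun_const polyfun_dot)
    show "\<exists>q. ?\<phi> i q \<noteq> 0"
    proof (cases i)
      case None
      obtain u where "eval3 h u \<noteq> eval3 h p" by (rule nonconstant_eval3[OF h(1)])
      then show ?thesis using None by (intro exI[of _ "u - p"]) simp
    next
      case (Some ab)
      then obtain a b where ab: "i = Some (a, b)" "a \<in> A" "b \<in> A" "a \<noteq> b" using i by auto
      then have ne: "crs a b \<noteq> 0" using nonparallel by blast
      have "crs (crs a b) p \<noteq> 0"
      proof
        assume "crs (crs a b) p = 0"
        then obtain c where "p = c *s crs a b" using crs_eq_0_imp ne by blast
        then show False using p[OF ab(2)] by simp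
      qed
      then show ?thesis using exists_dot_eq_1 ab(1) by (metis (no_types, lifting) option.case(2) prod.case zero_neq_one)
    qed
  qed
  then obtain q where q: "eval3 h (p + q) \<noteq> eval3 h p"
    "\<And>a b. a \<in> A \<Longrightarrow> b \<in> A \<Longrightarrow> a \<noteq> b \<Longrightarrow> dot (crs (crs a b) p) q \<noteq> 0" by force
  obtain P where P: "\<And>t. eval3 h (p + t *s q) = poly P t"
    using polyfun_line[OF polyfun_eval3, of h p q] unfolding upoly_def by blast
  have "poly P 0 \<noteq> poly P 1" using q(1) P[of 0] P[of 1] by simp
  then have "degree P > 0" by (metis degree_eq_zeroE gr0I poly_const_conv)
  then obtain t where "poly P t = 0" using alg_closed_imp_poly_has_root by blast
  then have gr0: "gr A (p + t *s q) = 0" using zero P by simp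
  have off: "p + t *s q \<noteq> c *s crs a b" if ab: "a \<in> A" "b \<in> A" "a \<noteq> b" for a b c
  proof
    assume eq: "p + t *s q = c *s crs a b"
    have "dot (crs (crs a b) p) (p + t *s q) = 0" unfolding eq by simp
    then have "t = 0" using q(2)[OF ab] by simp
    then have "dot a p = 0" using eq by simp
    then show False using p ab by blast
  qed
  have ne: "p + t *s q \<noteq> 0"
  proof -
    obtain a b where "a \<in> A" "b \<in> A" "a \<noteq> b" by (rule card_ge_2_obtain[OF two])
    from off[OF this, of 0] show ?thesis by simp
  qed
  obtain a b where ab: "a \<in> inc (p + t *s q)" "b \<in> inc (p + t *s q)" "a \<noteq> b"
    by (rule card_ge_2_obtain[OF sing[OF ne gr0]])
  then have A: "a \<in> A" "b \<in> A" and "dot a (p + t *s q) = 0" "dot b (p + t *s q) = 0"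
    by (auto simp: inc_def)
  then obtain c where "p + t *s q = c *s crs a b" using common_perp[OF nonparallel[OF A ab(3)]] by blast
  then show False using off[OF A ab(3)] by blast
qed

text \<open>Both composites are the identity up to scalar functions; the points \<open>v0\<close>
  and \<open>y0\<close> ensure that these composites do not vanish identically.\<close>

lemma (in arrangement) birational_polar:
  assumes Q: "\<And>i. polyfun (\<lambda>y. Q y $ i)" "\<And>c y. Q (c *s y) = c ^ e *s Q y"
    and QP: "\<And>v. Q (gr A v) = s v *s v" and PQ: "\<And>y. gr A (Q y) = s' y *s y"
    and ne: "Q (gr A v0) \<noteq> 0" "gr A (Q y0) \<noteq> 0"
  shows "birational (polar_map (\<Prod>a\<in>A. lin a))"
proof -
  let ?P = "polar_map (\<Prod>a\<in>A. lin a)"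
  have P: "eval3 (?P i) v = gr A v $ i" for i v
    unfolding polar_map_def by (rule eval3_partial_deriv_prod_lin[OF finite])
  have "\<forall>i. \<exists>q. \<forall>y. eval3 q y = Q y $ i" using Q(1) polyfun_imp_poly3 by metis
  then obtain R where R: "\<And>i y. eval3 (R i) y = Q y $ i" by metis
  have RP: "eval3 (comp_map R ?P i) v = Q (gr A v) $ i" for i v
    by (simp add: comp_map_def R P)
  have PR: "eval3 (comp_map ?P R i) y = gr A (Q y) $ i" for i y
    by (simp add: comp_map_def R P)
  have rat: "rational_map M"
    if M: "\<And>i v. eval3 (M i) v = g v $ i" "\<And>c v. g (c *s v) = c ^ n *s g v" "g u \<noteq> 0"
    for M :: "3 \<Rightarrow> 'k poly3" and g :: "'k ^ 3 \<Rightarrow> 'k ^ 3" and n u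
    unfolding rational_map_def
  proof
    have "homogeneous n (M i)" for i by (rule homogeneousI) (simp add: M(1,2))
    then show "\<exists>d. \<forall>i. homogeneous d (M i)" by blast
    obtain i where "g u $ i \<noteq> 0" using M(3) by (auto simp: vec_eq_iff)
    then have "M i \<noteq> 0" using M(1)[of i u] by auto
    then show "\<exists>i. M i \<noteq> 0" ..
  qed
  have "rational_map ?P" by (rule rat[of ?P "gr A", OF P gr_scale[OF finite] ne(2)])
  moreover have "rational_map R" by (rule rat[of R Q, OF R Q(2) ne(1)])
  moreover have "rational_map (comp_map R ?P)"
  proof (rule rat[of "comp_map R ?P" "\<lambda>v. Q (gr A v)", OF RP _ ne(1)])
    show "Q (gr A (c *s v)) = c ^ ((card A - 1) * e) *s Q (gr A v)" for c v
      by (simp add: gr_scale[OF finite] Q(2) power_mult)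
  qed
  moreover have "rational_map (comp_map ?P R)"
  proof (rule rat[of "comp_map ?P R" "\<lambda>y. gr A (Q y)", OF PR _ ne(2)])
    show "gr A (Q (c *s y)) = c ^ (e * (card A - 1)) *s gr A (Q y)" for c y
      by (simp add: gr_scale[OF finite] Q(2) power_mult)
  qed
  moreover have "same_rational_map (comp_map R ?P) Var3"
    unfolding same_rational_map_def by (intro allI eval3_inject) (simp add: RP QP)
  moreover have "same_rational_map (comp_map ?P R) Var3"
    unfolding same_rational_map_def by (intro allI eval3_inject) (simp add: PR PQ)
  ultimately show ?thesis unfolding birational_def by blast
qed

lemma (in arrangement) homaloidal_curveI:
  assumes "card A \<ge> 2" "\<And>v. v \<noteq> 0 \<Longrightarrow> gr A v = 0 \<Longrightarrow> card (inc v) \<ge> 2"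
    and "birational (polar_map (\<Prod>a\<in>A. lin a))"
  shows "homaloidal_curve (\<Union>a\<in>A. zero_locus (lin a))"
proof -
  have "reduced_equation (\<Prod>a\<in>A. lin a) (\<Union>a\<in>A. zero_locus (lin a))"
    unfolding reduced_equation_def
    using homogeneous_prod_lin assms(1) squarefree_prod_lin zero_locus_prod_lin[OF finite]
    by (intro conjI exI[of _ "card A"]) auto
  moreover have "homaloidal (\<Prod>a\<in>A. lin a)"
    unfolding homaloidal_def
    using homogeneous_prod_lin no_fixed_component_polar[OF assms(1,2)] assms(3) by blast
  ultimately show ?thesis unfolding homaloidal_curve_def by blast
qed

section \<open>Explicit inverses for triangles and near-pencils\<close>

lemma lineE:
  fixes L :: "('k::alg_closed_field ^ 3) set set"
  assumes "line L"
  obtains a where "a \<noteq> 0" "L = zero_locus (lin a)"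
  using assms unfolding line_def by (metis linear_formE)

text \<open>In coordinates given by the three lines the polar map is the standard quadratic Cremona
  involution (yz : xz : xy), so the inverse is given by the same formula in the dual basis.\<close>

lemma three_general_lines_homaloidal:
  fixes F :: "('k::alg_closed_field ^ 3) set set"
  assumes "three_general_lines F"
  shows "homaloidal_curve F"
proof -
  obtain L M N where LMN: "line L" "line M" "line N" "L \<noteq> M" "L \<noteq> N" "M \<noteq> N"
    "L \<inter> M \<inter> N = {}" "F = L \<union> M \<union> N"
    using assms unfolding three_general_lines_def by blast
  obtain a where a: "a \<noteq> 0" "L = zero_locus (lin a)" by (rule lineE[OF LMN(1)])
  obtain b where b: "b \<noteq> 0" "M = zero_locus (lin b)" by (rule lineE[OF LMN(2)])
  obtain c where c: "c \<noteq> 0" "N = zero_locus (lin c)" by (rule lineE[OF LMN(3)])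
  have nonpar: "crs a b \<noteq> 0" "crs a c \<noteq> 0" "crs b c \<noteq> 0"
    using zero_locus_lin_eq_iff[OF a(1) b(1)] zero_locus_lin_eq_iff[OF a(1) c(1)]
      zero_locus_lin_eq_iff[OF b(1) c(1)] LMN(4-6) a b c by auto
  have distinct: "a \<noteq> b" "a \<noteq> c" "b \<noteq> c" using nonpar by auto
  let ?A = "{a, b, c}"
  interpret arrangement ?A
  proof
    show "crs u v \<noteq> 0" if "u \<in> ?A" "v \<in> ?A" "u \<noteq> v" for u v
      using that nonpar crs_anticommute[of b a] crs_anticommute[of c a] crs_anticommute[of c b] by auto
  qed (use a b c in auto)
  have det: "dot a (crs b c) \<noteq> 0"
  proof
    assume 0: "dot a (crs b c) = 0"
    have "proj_point (crs b c) \<in> L \<inter> M \<inter> N"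
      using proj_point_in_line[OF nonpar(3)] 0 a b c by auto
    then show False using LMN(7) by auto
  qed
  define d where "d = inverse (dot a (crs b c))"
  define a' b' c' where "a' = d *s crs b c" and "b' = d *s crs c a" and "c' = d *s crs a b"
  have dd: "d * dot a (crs b c) = 1" "d \<noteq> 0" using det by (simp_all add: d_def)
  have dual: "dot a' a = 1" "dot a' b = 0" "dot a' c = 0" "dot b' a = 0" "dot b' b = 1" "dot b' c = 0"
    "dot c' a = 0" "dot c' b = 0" "dot c' c = 1"
    using dd dot_crs_cyc[of a b c] dot_crs_cyc[of b c a] by (simp_all add: a'_def b'_def c'_def dot_commute)
  have exp1: "v = dot a v *s a' + dot b v *s b' + dot c v *s c'" for v
  proof -
    have "dot a (crs b c) *s v = dot a v *s crs b c + dot b v *s crs c a + dot c v *s crs a b"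
      by (simp add: vec3_eq_iff dot_def algebra_simps)
    then have "d *s (dot a (crs b c) *s v) = d *s (dot a v *s crs b c + dot b v *s crs c a + dot c v *s crs a b)" by simp
    then show ?thesis using dd by (simp add: a'_def b'_def c'_def vec.scale_right_distrib mult.commute)
  qed
  have exp2: "y = dot a' y *s a + dot b' y *s b + dot c' y *s c" for y
  proof -
    have "dot a (crs b c) *s y = dot (crs b c) y *s a + dot (crs c a) y *s b + dot (crs a b) y *s c"
      by (simp add: vec3_eq_iff dot_def algebra_simps)
    then have "d *s (dot a (crs b c) *s y) = d *s (dot (crs b c) y *s a + dot (crs c a) y *s b + dot (crs a b) y *s c)" by simp
    then show ?thesis using dd by (simp add: a'_def b'_def c'_def vec.scale_right_distrib mult.commute)
  qed
  have gr: "gr ?A v = (dot b v * dot c v) *s a + (dot a v * dot c v) *s b + (dot a v * dot b v) *s c" for v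
  proof -
    have "?A - {a} = {b, c}" "?A - {b} = {a, c}" "?A - {c} = {a, b}" using distinct by auto
    then show ?thesis using distinct by (simp add: gr_def pr_def add.assoc)
  qed
  have card: "card ?A = 3" using distinct by simp
  have comp: "dot a' (gr ?A v) = dot b v * dot c v" "dot b' (gr ?A v) = dot a v * dot c v"
    "dot c' (gr ?A v) = dot a v * dot b v" for v
    using dual by (simp_all add: gr)
  define Q where "Q y = (dot b' y * dot c' y) *s a' + (dot a' y * dot c' y) *s b' + (dot a' y * dot b' y) *s c'" for y
  have compQ: "dot a (Q y) = dot b' y * dot c' y" "dot b (Q y) = dot a' y * dot c' y"
    "dot c (Q y) = dot a' y * dot b' y" for y
    using dual by (simp_all add: Q_def dot_commute)
  let ?s = "\<lambda>v. dot a v * dot b v * dot c v" and ?s' = "\<lambda>y. dot a' y * dot b' y * dot c' y"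
  have QP: "Q (gr ?A v) = ?s v *s v" for v
  proof -
    have "Q (gr ?A v) = ?s v *s (dot a v *s a' + dot b v *s b' + dot c v *s c')"
      unfolding Q_def comp by (simp add: vec.scale_right_distrib mult_ac)
    then show ?thesis using exp1[of v] by metis
  qed
  have PQ: "gr ?A (Q y) = ?s' y *s y" for y
  proof -
    have "gr ?A (Q y) = ?s' y *s (dot a' y *s a + dot b' y *s b + dot c' y *s c)"
      unfolding gr compQ by (simp add: vec.scale_right_distrib mult_ac)
    then show ?thesis using exp2[of y] by metis
  qed
  have "birational (polar_map (\<Prod>a\<in>?A. lin a))"
  proof (rule birational_polar[where Q = Q and e = 2 and s = ?s and s' = ?s', OF _ _ QP PQ])
    show "polyfun (\<lambda>y. Q y $ i)" for i by (simp add: Q_def) (intro polyfun_intros)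
    show "Q (r *s y) = r ^ 2 *s Q y" for r y
      by (simp add: Q_def vec.scale_right_distrib power2_eq_square mult_ac)
    let ?v = "a' + b' + c'" and ?y = "a + b + c"
    have v1: "dot a ?v = 1" "dot b ?v = 1" "dot c ?v = 1" using dual by (simp_all add: dot_commute)
    then have "?v \<noteq> 0" by (metis dot_simps(8) zero_neq_one)
    then show "Q (gr ?A ?v) \<noteq> 0" unfolding QP v1 by simp
    have y1: "dot a' ?y = 1" "dot b' ?y = 1" "dot c' ?y = 1" using dual by simp_all
    then have "?y \<noteq> 0" by (metis dot_simps(8) zero_neq_one)
    then show "gr ?A (Q ?y) \<noteq> 0" unfolding PQ y1 by simp
  qed
  moreover have "card (inc v) \<ge> 2" if "gr ?A v = 0" for v
  proof -
    have "dot b v * dot c v = 0" "dot a v * dot c v = 0" "dot a v * dot b v = 0"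
      using comp[of v] that by simp_all
    then consider "{a, b} \<subseteq> inc v" | "{a, c} \<subseteq> inc v" | "{b, c} \<subseteq> inc v"
      by (auto simp: inc_def)
    then show ?thesis
    proof cases
      case 1 then show ?thesis using card_mono[OF finite_inc 1] distinct by simp
    next
      case 2 then show ?thesis using card_mono[OF finite_inc 2] distinct by simp
    next
      case 3 then show ?thesis using card_mono[OF finite_inc 3] distinct by simp
    qed
  qed
  ultimately have "homaloidal_curve (\<Union>a\<in>?A. zero_locus (lin a))"
    using card by (intro homaloidal_curveI) auto
  moreover have "(\<Union>a\<in>?A. zero_locus (lin a)) = F" using LMN(8) a(2) b(2) c(2) by auto
  ultimately show ?thesis by simp
qed

lemma exists_crs_nonzero: "(z :: 'k::field ^ 3) \<noteq> 0 \<Longrightarrow> \<exists>c. crs c z \<noteq> 0"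
proof (rule ccontr)
  assume z: "z \<noteq> 0" and "\<nexists>c. crs c z \<noteq> 0"
  then have "crs (axis i 1) z $ j = 0" for i j by simp
  from this[of 1 2] this[of 1 3] this[of 2 3] have "z = 0" by (simp add: vec3_eq_iff axis_nth)
  with z show False ..
qed

text \<open>
  The number of lines is zero in the field, so by Euler's formula the gradient at \<open>v\<close> is orthogonal
  to \<open>v\<close> and hence to the whole plane spanned by \<open>v\<close> and \<open>z\<close>.
\<close>

lemma pencil_gradient:
  fixes z :: "'k::alg_closed_field ^ 3"
  assumes T: "finite T" "\<And>a. a \<in> T \<Longrightarrow> dot a z = 0" "card T \<ge> 2" "of_nat (card T) = (0 :: 'k)"
    and "z \<noteq> 0"
  obtains h where "polyfun h" "\<And>v. gr T v = h v *s crs z v"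
    "\<And>c v. h (c *s v) = c ^ (card T - 2) * h v" "\<And>\<beta> v. h (v + \<beta> *s z) = h v"
proof -
  obtain c where c: "crs c z \<noteq> 0" using exists_crs_nonzero assms(5) by blast
  let ?w = "crs c z" and ?q = "\<lambda>v. dot c (gr T v)"
  obtain u where u: "dot ?w u = 1" using exists_dot_eq_1[OF c] by blast
  have perp: "dot z (gr T v) = 0" "dot v (gr T v) = 0" for v
  proof -
    show "dot z (gr T v) = 0" unfolding dot_gr using T(2) by (intro sum.neutral) (simp add: dot_commute)
    show "dot v (gr T v) = 0" using euler[OF T(1)] T(4) by simp
  qed
  have "pr (T - {a}) z = 0" if "a \<in> T" for a
  proof -
    have "T - {a} \<noteq> {}" using T(3) that by (metis Diff_eq_empty_iff card_mono card.empty card_insert_disjoint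
          empty_iff finite.emptyI finite_insert insert_absorb2 le_antisym numeral_le_one_iff One_nat_def
          order_trans semiring_norm(69))
    then show ?thesis using T(1,2) by (auto simp: pr_eq_0_iff)
  qed
  then have grz: "gr T z = 0" by (simp add: gr_def)
  \<comment> \<open>Such a \<open>v\<close> lies in the plane of \<open>c\<close> and
    \<open>z\<close>. If it is not a multiple of \<open>z\<close>, orthogonality of the gradient to
    \<open>v\<close> and \<open>z\<close> implies orthogonality to \<open>c\<close>. On multiples of
    \<open>z\<close> the gradient vanishes because at least two lines pass through
    \<open>z\<close>.\<close>
  have "?q v = 0" if w: "dot ?w v = 0" for v
  proof -
    obtain \<alpha> \<beta> where v: "v = \<alpha> *s c + \<beta> *s z" by (rule in_span_if_perp_crs[OF c w])
    show ?thesis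
    proof (cases "\<alpha> = 0")
      case True
      then show ?thesis using v grz by (simp add: gr_scale[OF T(1)])
    next
      case False
      have "\<alpha> * ?q v + \<beta> * dot z (gr T v) = 0" using perp(2)[of v] by (subst (asm) (1) v) simp
      then show ?thesis using False perp(1) by simp
    qed
  qed
  \<comment> \<open>The gradient is orthogonal to \<open>z\<close> and \<open>v\<close>, hence a
    multiple of \<open>crs z v\<close> where that is nonzero. Pairing with \<open>c\<close> exhibits
    the multiplier as a polynomial.\<close>
  then obtain h where h: "polyfun h" "\<And>v. ?q v = dot ?w v * h v"
    using polyfun_div_perp[OF polyfun_dot_gr c] by metis
  have cyc: "dot c (crs z v) = dot ?w v" for v
    using dot_crs_cyc[of c z v] dot_crs_cyc[of z v c] dot_commute by metis
  have gr: "gr T v = h v *s crs z v" for v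
  proof -
    have "dot ?w v * gr T v $ i = dot ?w v * (h v * crs z v $ i)" for v i
    proof (cases "dot ?w v = 0")
      case False
      then have "crs z v \<noteq> 0" using cyc[of v] by auto
      then obtain r where r: "gr T v = r *s crs z v" using common_perp perp by metis
      then have "r = h v" using h(2)[of v] cyc[of v] False by simp
      then show ?thesis using r by simp
    qed simp
    moreover have "polyfun (\<lambda>v. crs z v $ i)" for i
      unfolding crs_def by (intro polyfun_vector polyfun_intros)
    ultimately have "gr T v $ i = h v * crs z v $ i" for i
      using u by (intro polyfun_cancel[of "dot ?w" "\<lambda>v. gr T v $ i" "\<lambda>v. h v * crs z v $ i" u])
        (auto intro: polyfun_intros h(1))
    then show ?thesis by (simp add: vec_eq_iff)
  qed
  have scale: "h (r *s v) = r ^ (card T - 2) * h v" for r v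
  proof -
    have nz: "h (r *s v) = r ^ (card T - 2) * h v" if "r \<noteq> 0" for r v
    proof (rule polyfun_cancel[of "dot ?w" "\<lambda>v. h (r *s v)" "\<lambda>v. r ^ (card T - 2) * h v" u])
      show "polyfun (\<lambda>v. h (r *s v))" by (rule polyfun_comp[OF h(1)]) (auto intro!: polyfun_intros)
      show "polyfun (\<lambda>v. r ^ (card T - 2) * h v)" by (intro polyfun_intros h(1))
      show "dot ?w v * h (r *s v) = dot ?w v * (r ^ (card T - 2) * h v)" for v
      proof -
        have "card T - 1 = Suc (card T - 2)" using T(3) by simp
        then have "r * (dot ?w v * h (r *s v)) = r * (dot ?w v * (r ^ (card T - 2) * h v))"
          using h(2)[of "r *s v"] h(2)[of v] by (auto simp: gr_scale[OF T(1)])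
        then show ?thesis using that by simp
      qed
    qed (use u in \<open>auto intro: polyfun_dot\<close>)
    show ?thesis
    proof (rule upoly_eq[of "\<lambda>r. h (r *s v)" "\<lambda>r. r ^ (card T - 2) * h v" "{0}" r])
      show "upoly (\<lambda>r. h (r *s v))" by (rule polyfun_upoly[OF h(1)]) (auto intro!: upoly_intros)
      show "upoly (\<lambda>r. r ^ (card T - 2) * h v)" by (intro upoly_intros)
    qed (use nz in auto)
  qed
  have shift: "h (v + \<beta> *s z) = h v" for \<beta> v
  proof (rule polyfun_cancel[of "dot ?w" "\<lambda>v. h (v + \<beta> *s z)" h u])
    show "polyfun (\<lambda>v. h (v + \<beta> *s z))" by (rule polyfun_comp[OF h(1)]) (auto intro!: polyfun_intros)
    show "dot ?w v * h (v + \<beta> *s z) = dot ?w v * h v" for v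
    proof -
      have "gr T (v + \<beta> *s z) = gr T v" by (rule gr_cong) (simp add: T(2))
      then show ?thesis using h(2)[of "v + \<beta> *s z"] h(2)[of v] by auto
    qed
  qed (use u h(1) in \<open>auto intro: polyfun_dot\<close>)
  show ?thesis by (rule that[OF h(1) gr scale shift])
qed

text \<open>Split \<open>v = u + dot m v *s z\<close>. The gradient is \<open>pr T u\<close> times
  \<open>m\<close> plus \<open>dot m v * h u\<close> times \<open>crs z u\<close>. Its cross product
  with \<open>m\<close> returns the direction of \<open>u\<close>, its product with \<open>z\<close>
  returns \<open>pr T u\<close>, and the ratio of the two coefficients then determines
  \<open>dot m v\<close>.\<close>

lemma near_pencil_arrangement_homaloidal:
  fixes m z :: "'k::alg_closed_field ^ 3"
  assumes "arrangement (insert m T)" and T: "\<And>a. a \<in> T \<Longrightarrow> dot a z = 0" "card T \<ge> 2"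
    and m: "dot m z = 1" and zero: "of_nat (card T) = (0 :: 'k)"
  shows "homaloidal_curve (\<Union>a\<in>insert m T. zero_locus (lin a))"
proof -
  let ?A = "insert m T"
  interpret arrangement ?A by fact
  define n where "n = card T - 2"
  have n: "card T = Suc (Suc n)" using T(2) by (simp add: n_def)
  have finT: "finite T" using finite by simp
  have mT: "m \<notin> T" using T(1) m by auto
  have z: "z \<noteq> 0" using m by auto
  obtain h where h: "polyfun h" "\<And>v. gr T v = h v *s crs z v"
    "\<And>c v. h (c *s v) = c ^ n * h v" "\<And>\<beta> v. h (v + \<beta> *s z) = h v"
    by (rule pencil_gradient[OF finT T zero z, folded n_def]) (assumption, rule that)
  have grA: "gr ?A v = pr T v *s m + (dot m v * h v) *s crs z v" for v
    using gr_Un[of "{m}" T v] finT mT by (simp add: gr_def[of "{m}"] pr_def[of "{m}"] pr_def[of "{}"] h(2))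
  have prT_shift: "pr T (v + \<beta> *s z) = pr T v" for v \<beta> by (rule pr_cong) (simp add: T(1))
  have zm: "dot z m = 1" using m by (simp add: dot_commute)

  define W where "W y = crs y m" for y
  \<comment> \<open>For \<open>y = gr ?A v\<close> put \<open>k = dot m v * h v\<close>. Then
    \<open>W y = k *s u\<close>, and by homogeneity \<open>pr T (W y)\<close> divided by
    \<open>dot z y * h (W y)\<close> is \<open>k * dot m v\<close>. Hence \<open>W y\<close> plus
    this multiple of \<open>z\<close> is \<open>k *s v\<close>; clearing the denominator gives
    \<open>Q\<close>.\<close>
  define Q where "Q y = (dot z y * h (W y)) *s W y + pr T (W y) *s z" for y
  have W_scale: "W (c *s y) = c *s W y" for c y by (simp add: W_def)
  have polyW: "polyfun (\<lambda>y. W y $ i)" for i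
    unfolding W_def crs_def by (intro polyfun_vector polyfun_intros)
  have QP: "Q (gr ?A v) = (pr T v * (dot m v * h v) ^ Suc n * h v) *s v" for v
  proof -
    let ?g = "pr T v" and ?k = "dot m v * h v" and ?u = "v + (- dot m v) *s z"
    have "W (gr ?A v) = ?k *s (- crs m (crs z v))"
      unfolding W_def grA using crs_anticommute[of "crs z v" m] by simp
    also have "- crs m (crs z v) = ?u" unfolding crs_crs m by (simp add: vec_eq_iff)
    finally have W: "W (gr ?A v) = ?k *s ?u" .
    have "dot z (gr ?A v) = ?g" unfolding grA by (simp add: zm)
    moreover have "h (W (gr ?A v)) = ?k ^ n * h v" unfolding W h(3) h(4) ..
    moreover have "pr T (W (gr ?A v)) = ?k ^ Suc (Suc n) * ?g" unfolding W pr_scale prT_shift n ..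
    ultimately have "Q (gr ?A v) = (?g * (?k ^ n * h v)) *s (?k *s ?u) + (?k ^ Suc (Suc n) * ?g) *s z"
      unfolding Q_def W by simp
    also have "\<dots> = (?g * ?k ^ Suc n * h v) *s v"
      by (simp add: vec_eq_iff algebra_simps)
    finally show ?thesis .
  qed
  have PQ: "gr ?A (Q y) = (pr T (W y) * (dot z y * h (W y)) ^ Suc n * h (W y)) *s y" for y
  proof -
    let ?g = "pr T (W y)" and ?c = "dot z y * h (W y)"
    have "dot m (Q y) = ?g" unfolding Q_def by (simp add: m) (simp add: W_def)
    moreover have "pr T (Q y) = ?c ^ Suc (Suc n) * ?g" unfolding Q_def prT_shift pr_scale n ..
    moreover have "h (Q y) = ?c ^ n * h (W y)" unfolding Q_def h(4) h(3) ..
    moreover have "crs z (Q y) = ?c *s (y - dot z y *s m)"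
      unfolding Q_def by simp (simp add: W_def crs_crs zm)
    ultimately have "gr ?A (Q y) = (?c ^ Suc (Suc n) * ?g) *s m
        + (?g * (?c ^ n * h (W y))) *s (?c *s (y - dot z y *s m))"
      unfolding grA by simp
    also have "\<dots> = (?g * ?c ^ Suc n * h (W y)) *s y"
      by (simp add: vec_eq_iff algebra_simps)
    finally show ?thesis .
  qed
  obtain v where v: "pr ?A v * h v \<noteq> 0"
  proof -
    obtain a where a: "a \<in> T" using T(2) by fastforce
    then obtain u where "pr (T - {a}) u \<noteq> 0" "gr T u = pr (T - {a}) u *s a"
      using gr_generic[of T a] by blast
    then have "gr T u \<noteq> 0" using a vec_nonzero by simp
    then have "h u \<noteq> 0" using h(2)[of u] by auto
    moreover have "\<exists>p. \<forall>a\<in>?A. dot a p \<noteq> 0"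
    proof (rule polyfun_avoid[OF finite])
      show "\<exists>p. dot a p \<noteq> 0" if "a \<in> ?A" for a
        using exists_dot_eq_1[OF vec_nonzero[OF that]] by (metis zero_neq_one)
    qed (rule polyfun_dot)
    ultimately show ?thesis
      using polyfun_zero_product[OF polyfun_pr[of ?A] h(1)] pr_eq_0_iff[OF finite] that by blast
  qed
  have nz: "pr T v \<noteq> 0" "dot m v \<noteq> 0" "h v \<noteq> 0"
    using v finT mT by (auto simp: pr_def)
  have "dot z (gr ?A v) \<noteq> 0" unfolding grA using nz by (simp add: zm)
  then have gv: "gr ?A v \<noteq> 0" by auto
  have "birational (polar_map (\<Prod>a\<in>?A. lin a))"
  proof (rule birational_polar[where Q = Q and e = "Suc (Suc n)", OF _ _ QP PQ])
    show "polyfun (\<lambda>y. Q y $ i)" for i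
      by (simp add: Q_def) (intro polyfun_intros polyfun_comp[OF h(1) polyW] polyW
          polyfun_comp[OF polyfun_pr polyW])
    show "Q (c *s y) = c ^ Suc (Suc n) *s Q y" for c y
      by (simp add: Q_def W_scale h(3) pr_scale n vec.scale_right_distrib mult_ac)
    show Qv: "Q (gr ?A v) \<noteq> 0" unfolding QP using nz by auto
    show "gr ?A (Q (gr ?A v)) \<noteq> 0" unfolding QP using nz gv by (simp add: gr_scale[OF finite])
  qed
  moreover have "card (inc v) \<ge> 2" if "v \<noteq> 0" "gr ?A v = 0" for v
  proof -
    have "of_nat (card ?A) = (1 :: 'k)" using finT mT zero by simp
    then have "pr ?A v = 0" using euler[OF finite, of v] that(2) by simp
    then obtain a where a: "a \<in> ?A" "dot a v = 0" using pr_eq_0_iff[OF finite] by blast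
    then have "pr (?A - {a}) v = 0" using gr_on_line[OF finite a] that(2) vec_nonzero[OF a(1)] by simp
    then obtain b where "b \<in> ?A - {a}" "dot b v = 0" using pr_eq_0_iff[of "?A - {a}"] finite by blast
    then have "{a, b} \<subseteq> inc v" "a \<noteq> b" using a by (auto simp: inc_def)
    then show ?thesis using card_mono[OF finite_inc, of "{a, b}" v] by simp
  qed
  moreover have "card ?A \<ge> 2" using T(2) finT mT by simp
  ultimately show ?thesis by (intro homaloidal_curveI)
qed

lemma near_pencil_homaloidal:
  fixes F :: "('k::alg_closed_field ^ 3) set set"
  assumes "near_pencil n F" "n \<ge> 1" "CHAR('k) dvd n"
  shows "homaloidal_curve F"
proof -
  have n0: "of_nat n = (0 :: 'k)" using assms(3) by (simp add: of_nat_eq_0_iff_char_dvd)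
  have n2: "n \<ge> 2"
  proof -
    have "n \<noteq> 1" using n0 by auto
    then show ?thesis using assms(2) by simp
  qed
  obtain z0 \<L> M where np: "z0 \<in> proj_plane" "finite \<L>" "card \<L> = n" "\<And>L. L \<in> \<L> \<Longrightarrow> line L"
    "\<And>L. L \<in> \<L> \<Longrightarrow> z0 \<in> L" "line M" "z0 \<notin> M" "F = \<Union>\<L> \<union> M"
    using assms(1) unfolding near_pencil_def by blast
  obtain z where z: "z \<noteq> 0" "z0 = proj_point z" using np(1) unfolding proj_plane_def by blast
  obtain m0 where m0: "m0 \<noteq> 0" "M = zero_locus (lin m0)" by (rule lineE[OF np(6)])
  have m0z: "dot m0 z \<noteq> 0" using np(7) m0(2) z proj_point_in_line[OF z(1)] by simp
  define m where "m = inverse (dot m0 z) *s m0"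
  have m: "m \<noteq> 0" "dot m z = 1" using m0 m0z by (simp_all add: m_def)
  have M: "M = zero_locus (lin m)"
    using zero_locus_lin_eq_iff[OF m0(1) m(1)] m0(2) by (simp add: m_def)
  have "\<forall>L\<in>\<L>. \<exists>a. a \<noteq> 0 \<and> L = zero_locus (lin a)" using np(4) lineE by metis
  then obtain \<alpha> where \<alpha>: "\<And>L. L \<in> \<L> \<Longrightarrow> \<alpha> L \<noteq> 0" "\<And>L. L \<in> \<L> \<Longrightarrow> L = zero_locus (lin (\<alpha> L))"
    by metis
  have inj: "inj_on \<alpha> \<L>" using \<alpha>(2) by (metis inj_onI)
  let ?T = "\<alpha> ` \<L>"
  have card: "card ?T = n" using card_image[OF inj] np(3) by simp
  have Tz: "dot a z = 0" if "a \<in> ?T" for a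
  proof -
    obtain L where L: "L \<in> \<L>" "a = \<alpha> L" using \<open>a \<in> ?T\<close> by blast
    have "proj_point z \<in> zero_locus (lin (\<alpha> L))" using np(5)[OF L(1)] \<alpha>(2)[OF L(1)] z(2) by simp
    then show ?thesis using proj_point_in_line[OF z(1)] L(2) by blast
  qed
  have nonpar_m: "crs a m \<noteq> 0" if "a \<in> ?T" for a
  proof
    assume "crs a m = 0"
    then obtain c where "m = c *s a" using crs_eq_0_imp \<alpha>(1) \<open>a \<in> ?T\<close> by blast
    then show False using m(2) Tz[OF \<open>a \<in> ?T\<close>] by simp
  qed
  have nonpar: "crs a b \<noteq> 0" if ab: "a \<in> ?T" "b \<in> ?T" "a \<noteq> b" for a b
  proof
    assume 0: "crs a b = 0"
    have "a \<noteq> 0" "b \<noteq> 0" using \<alpha>(1) ab by auto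
    from zero_locus_lin_eq_iff[OF this] 0 have "zero_locus (lin a) = zero_locus (lin b)" by simp
    then show False using \<alpha>(2) ab by (metis imageE)
  qed
  have "arrangement (insert m ?T)"
  proof
    show "finite (insert m ?T)" using np(2) by simp
    show "crs a b \<noteq> 0" if "a \<in> insert m ?T" "b \<in> insert m ?T" "a \<noteq> b" for a b
      using that nonpar nonpar_m crs_anticommute[of m b] by auto
  qed (use m(1) \<alpha>(1) in auto)
  then have "homaloidal_curve (\<Union>a\<in>insert m ?T. zero_locus (lin a))"
    using near_pencil_arrangement_homaloidal[of m ?T z] Tz m(2) card n0 n2 by simp
  moreover have "(\<Union>a\<in>insert m ?T. zero_locus (lin a)) = F"
    using np(8) M \<alpha>(2) by auto
  ultimately show ?thesis by simp
qed

theorem proposition3p1: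
  fixes F :: "('k::alg_closed_field ^ 3) set set" and p :: nat
  assumes "CHAR('k) = p" and "p > 0"
    and "line_arrangement F"
  shows "homaloidal_curve F \<longleftrightarrow>
    three_general_lines F \<or> (\<exists>n\<ge>1. p dvd n \<and> near_pencil n F)"
  using homaloidal_arrangement_type[OF assms(3)] three_general_lines_homaloidal[of F]
    near_pencil_homaloidal[of _ F] assms(1) by blast

end
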